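(* Let $(\mathcal{E},d,\preceq)$ be an ordered Polish space satisfying condition (BMC): every increasing sequence $x_1\preceq x_2\preceq\cdots$ in $\mathcal{E}$ with $x_n\preceq y$ for all $n$ for some $y\in\mathcal{E}$ converges to some $x\in\mathcal{E}$. Let $P$ be a stochastically monotone Markov kernel on $\mathcal{E}$. Suppose in addition that there are two points $x_0\preceq y_0$ in $\mathcal{E}$ such that the hitting times $$\nu^-=\min\{n\ge1: X_n^{x_0}\succeq x_0\}\quad\text{and}\quad\nu^+=\min\{n\ge1: X_n^{y_0}\preceq y_0\}$$ have finite expectations. Then the Markov chain admits at least one stationary distribution.
   Context: An ordered Polish space is a Polish (complete separable metric) space $(\mathcal{E},d)$ with its Borel $\sigma$-algebra and a partial order $\preceq$ such that $\{(x,y): x\preceq y\}$ is closed in $\mathcal{E}\times\mathcal{E}$. A Markov kernel $P(x,A)$ on $\mathcal{E}$ is a probability measure in $A$ for each $x$ and measurable in $x$ for each Borel $A$; no Feller property is assumed. $P$ is stochastically monotone if, for every measurable increasing $g:\mathcal{E}\to[0,1]$ ($x\preceq y\Rightarrow g(x)\le g(y)$), the function $Pg(x)=\int g(y)P(x,dy)$ is also increasing. $(X_n^x)_{n\in\mathbb{N}_0}$ denotes the time-homogeneous Markov chain with kernel $P$ and $X_0^x=x$. A stationary distribution is a probability measure $\pi$ with $\int P(x,\cdot)\,d\pi(x)=\pi$. *)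

theory Defs
  imports "HOL-Probability.Probability"
begin

definition closed_order :: "'a::{topological_space, order} itself \<Rightarrow> bool" where
  "closed_order _ \<longleftrightarrow> closed {(x :: 'a, y). x \<le> y}"

definition bounded_monotone_convergence :: "'a::{topological_space, order} itself \<Rightarrow> bool" where
  "bounded_monotone_convergence _ \<longleftrightarrow>
     (\<forall>x :: nat \<Rightarrow> 'a. incseq x \<longrightarrow> (\<exists>y. \<forall>n. x n \<le> y) \<longrightarrow> convergent x)"

text \<open>Measurability into \<^const>\<open>prob_algebra\<close> says that each \<open>P x\<close> is a Borel probability
  measure and that \<open>x \<mapsto> P x A\<close> is measurable for each Borel set \<open>A\<close>.\<close>

definition markov_kernel :: "('a::topological_space \<Rightarrow> 'a measure) \<Rightarrow> bool" where
  "markov_kernel P \<longleftrightarrow> P \<in> borel \<rightarrow>\<^sub>M prob_algebra borel"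

definition stochastically_monotone :: "('a::{topological_space, order} \<Rightarrow> 'a measure) \<Rightarrow> bool" where
  "stochastically_monotone P \<longleftrightarrow>
     (\<forall>g :: 'a \<Rightarrow> real. g \<in> borel_measurable borel \<longrightarrow> range g \<subseteq> {0..1} \<longrightarrow> mono g \<longrightarrow>
        mono (\<lambda>x. \<integral>y. g y \<partial>(P x)))"

definition stationary_distribution ::
    "('a::topological_space \<Rightarrow> 'a measure) \<Rightarrow> 'a measure \<Rightarrow> bool" where
  "stationary_distribution P \<pi> \<longleftrightarrow>
     prob_space \<pi> \<and> sets \<pi> = sets borel \<and>
     (\<forall>A\<in>sets borel. (\<integral>\<^sup>+x. emeasure (P x) A \<partial>\<pi>) = emeasure \<pi> A)"

definition history_algebra ::
    "'b measure \<Rightarrow> (nat \<Rightarrow> 'b \<Rightarrow> 'a::topological_space) \<Rightarrow> nat \<Rightarrow> 'b measure" where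
  "history_algebra M X n =
     sigma (space M) {X k -` A \<inter> space M | k A. k \<le> n \<and> A \<in> sets borel}"

text \<open>The chain is a process on an arbitrary probability space, characterized by the Markov
  property with respect to its own history.\<close>

definition markov_chain_from ::
    "('a::topological_space \<Rightarrow> 'a measure) \<Rightarrow> 'a \<Rightarrow> 'b measure \<Rightarrow> (nat \<Rightarrow> 'b \<Rightarrow> 'a) \<Rightarrow> bool" where
  "markov_chain_from P x M X \<longleftrightarrow>
     prob_space M \<and>
     (\<forall>n. X n \<in> borel_measurable M) \<and>
     (AE \<omega> in M. X 0 \<omega> = x) \<and>
     (\<forall>n. \<forall>A\<in>sets borel. AE \<omega> in M.
        real_cond_exp M (history_algebra M X n) (\<lambda>\<omega>. indicator A (X (Suc n) \<omega>)) \<omega>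
          = measure (P (X n \<omega>)) A)"

text \<open>Time \<open>0\<close> is excluded; \<open>Inf {} = \<infinity>\<close> in \<^typ>\<open>enat\<close> covers paths that never enter \<open>S\<close>.\<close>

definition hitting_time :: "(nat \<Rightarrow> 'b \<Rightarrow> 'a) \<Rightarrow> 'a set \<Rightarrow> 'b \<Rightarrow> enat" where
  "hitting_time X S \<omega> = Inf (enat ` {n. 1 \<le> n \<and> X n \<omega> \<in> S})"

end

theory Submission
  imports Defs "HOL-Library.Diagonal_Subsequence"
begin

text \<open>Write \<open>\<mu> P\<close> for the law after one step of a chain whose current law is \<open>\<mu>\<close>, and compare Borel
probability measures by \<open>\<integral>g d\<mu> \<le> \<integral>g d\<nu>\<close> for all increasing Borel functions \<open>g\<close> into \<open>[0,1]\<close>.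
Stochastic monotonicity says that \<open>\<mu> \<mapsto> \<mu> P\<close> preserves this order.  The proof finds measures
\<open>\<alpha> \<le> \<beta>\<close> with \<open>\<alpha> \<le> \<alpha> P\<close> and \<open>\<beta> P \<le> \<beta>\<close>, and then a fixed point below \<open>\<beta>\<close>.

Follow the chain from \<open>x\<^sub>0\<close> until it first returns to \<open>{x. x\<^sub>0 \<le> x}\<close>, and let \<open>\<alpha>\<close> be the normalised
expected occupation measure of this excursion.  Its mass before normalisation is the sum over \<open>j\<close>
of the probabilities that the return happens after time \<open>j\<close>, that is, the expected return time.
If the path were sent back to \<open>x\<^sub>0\<close> on its return, \<open>\<alpha>\<close> would be invariant; the chain itself
continues from a point above \<open>x\<^sub>0\<close>, hence \<open>\<alpha> \<le> \<alpha> P\<close> (\<open>stat_le_transition\<close>).  The measure \<open>\<beta>\<close> comes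
from \<open>y\<^sub>0\<close> and \<open>{y. y \<le> y\<^sub>0}\<close> in the same way.  To see \<open>\<alpha> \<le> \<beta>\<close>, take \<open>R = (\<Sum>k. s^k P^k g)\<close>, which is
increasing when \<open>g\<close> is.  Unrolling \<open>R = g + s P R\<close> along an excursion bounds \<open>(1 - s) R(x\<^sub>0)\<close> from
below by a quotient of discounted occupations that tends to \<open>\<integral>g d\<alpha>\<close> as \<open>s\<close> tends to \<open>1\<close>, and
\<open>(1 - s) R(y\<^sub>0)\<close> from above by one that tends to \<open>\<integral>g d\<beta>\<close> (\<open>stat_ordered\<close>).

Without a Feller property, the limit \<open>\<kappa>\<close> of the increasing sequence \<open>\<alpha> P^n\<close> in general
only satisfies \<open>\<kappa> \<le> \<kappa> P\<close>, and the iteration might have to be continued transfinitely.  A greedy choice avoids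
this.  Let \<open>S\<close> be the set of all \<open>\<mu> \<le> \<beta>\<close> with \<open>\<mu> \<le> \<mu> P\<close>.  Each increasing sequence in \<open>S\<close> converges,
in a metric for weak convergence, to an upper bound that lies in \<open>S\<close>.  Taking steps that are at
least half as long as possible, one reaches, in the limit, a \<open>\<mu>\<close> in \<open>S\<close> that has no element of \<open>S\<close> above it at
positive distance (\<open>exists_maximal_up_to_distance\<close>).  As \<open>\<mu> P\<close> lies in \<open>S\<close> above \<open>\<mu>\<close>, it equals \<open>\<mu>\<close>.

The convergence of an increasing sequence of measures bounded by a measure \<open>\<rho>\<close> is reduced to
bounded monotone convergence in the state space: there is a random increasing sequence of points,
bounded by a random point of law \<open>\<rho>\<close>, with the given laws (\<open>increasing_coupling\<close>).  This is
Strassen's theorem for infinitely many marginals.  The Hahn-Banach theorem provides a finitely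
additive set function with these marginals; it applies because a sum of lower semicontinuous
functions of the coordinates that is bounded below on increasing sequences has an integral with
the same bound (\<open>chain_duality\<close>).  Since the marginals are tight, Caratheodory's theorem turns the
set function into a measure (\<open>coupling_measure\<close>).\<close>

section \<open>Linear functionals below a sublinear functional\<close>

definition sublinear :: "('v::real_vector \<Rightarrow> real) \<Rightarrow> bool" where
  "sublinear q \<longleftrightarrow> (\<forall>x y. q (x + y) \<le> q x + q y) \<and> (\<forall>t x. 0 < t \<longrightarrow> q (t *\<^sub>R x) = t * q x)"

lemma sublinear_add: "sublinear q \<Longrightarrow> q (x + y) \<le> q x + q y"
  and sublinear_scale: "sublinear q \<Longrightarrow> 0 < t \<Longrightarrow> q (t *\<^sub>R x) = t * q x"
  by (auto simp: sublinear_def)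

lemma sublinear_zero: "sublinear q \<Longrightarrow> q 0 = 0"
  using sublinear_scale[of q 2 0] by simp

lemma sublinear_minus: "sublinear q \<Longrightarrow> - q (- x) \<le> q x"
  using sublinear_add[of q x "- x"] sublinear_zero[of q] by simp

text \<open>Of two functionals in a chain the smaller one bounds both \<open>q x\<close> and \<open>r y\<close>, so the infimum stays
subadditive.  It is finite because \<open>- p (- x) \<le> - q (- x) \<le> q x\<close> for all members \<open>q\<close>.\<close>

lemma sublinear_INF_chain:
  assumes C: "C \<noteq> {}" "\<And>q. q \<in> C \<Longrightarrow> sublinear q" "\<And>q. q \<in> C \<Longrightarrow> q \<le> p"
    and chain: "\<And>q r. q \<in> C \<Longrightarrow> r \<in> C \<Longrightarrow> q \<le> r \<or> r \<le> q"
  shows "sublinear (\<lambda>x. INF q\<in>C. q x)" and "\<And>q x. q \<in> C \<Longrightarrow> (INF q\<in>C. q x) \<le> q x"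
proof -
  have lb: "- p (- x) \<le> q x" if "q \<in> C" for q x
    using sublinear_minus[OF C(2)[OF that], of x] C(3)[OF that] by (auto simp: le_fun_def dest: spec[of _ "- x"])
  then have bdd: "bdd_below ((\<lambda>q. q x) ` C)" for x
    by (auto intro!: bdd_belowI)
  show le: "(INF q\<in>C. q x) \<le> q x" if "q \<in> C" for q x
    by (rule cINF_lower[OF bdd that])
  have scale: "(INF q\<in>C. q (t *\<^sub>R x)) = t * (INF q\<in>C. q x)" if t: "0 < t" for t x
  proof (rule antisym)
    show "t * (INF q\<in>C. q x) \<le> (INF q\<in>C. q (t *\<^sub>R x))"
      using t C le by (intro cINF_greatest) (auto simp: sublinear_scale mult_left_mono)
    have "(INF q\<in>C. q (t *\<^sub>R x)) / t \<le> (INF q\<in>C. q x)"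
    proof (rule cINF_greatest[OF C(1)])
      fix q assume q: "q \<in> C"
      show "(INF q\<in>C. q (t *\<^sub>R x)) / t \<le> q x"
        using le[OF q, of "t *\<^sub>R x"] t sublinear_scale[OF C(2)[OF q] t, of x] by (simp add: field_simps)
    qed
    then show "(INF q\<in>C. q (t *\<^sub>R x)) \<le> t * (INF q\<in>C. q x)"
      using t by (simp add: field_simps)
  qed
  have add: "(INF q\<in>C. q (x + y)) \<le> (INF q\<in>C. q x) + (INF q\<in>C. q y)" for x y
  proof -
    have "(INF q\<in>C. q (x + y)) \<le> q x + r y" if q: "q \<in> C" and r: "r \<in> C" for q r
    proof -
      obtain m where m: "m \<in> C" "m \<le> q" "m \<le> r"
        using chain[OF q r] q r by blast
      show ?thesis
        using le[OF m(1), of "x + y"] sublinear_add[OF C(2)[OF m(1)], of x y]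
        using le_funD[OF m(2), of x] le_funD[OF m(3), of y] by linarith
    qed
    then have "(INF q\<in>C. q (x + y)) - q x \<le> (INF r\<in>C. r y)" if q: "q \<in> C" for q
      using that by (intro cINF_greatest[OF C(1)]) (simp add: diff_le_eq, metis add.commute)
    then have "(INF q\<in>C. q (x + y)) - (INF r\<in>C. r y) \<le> (INF q\<in>C. q x)"
      by (intro cINF_greatest[OF C(1)]) (simp add: diff_le_eq add.commute)
    then show ?thesis by simp
  qed
  show "sublinear (\<lambda>x. INF q\<in>C. q x)"
    using add scale by (auto simp: sublinear_def)
qed

text \<open>The functional \<open>r x = (INF t\<ge>0. q (x + t y) - t q y)\<close> is sublinear and lies below \<open>q\<close>, so it equals
\<open>q\<close>; the term for \<open>t = 1\<close> is the claim.\<close>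

lemma minimal_sublinear_superadditive:
  assumes q: "sublinear q" and minimal: "\<And>r. sublinear r \<Longrightarrow> r \<le> q \<Longrightarrow> r = q"
  shows "q x + q y \<le> q (x + y)"
proof -
  define r where "r = (\<lambda>x. INF t\<in>{0..}. q (x + t *\<^sub>R y) - t * q y)"
  have lb: "- q (- x) \<le> q (x + t *\<^sub>R y) - t * q y" if "0 \<le> t" for x and t :: real
  proof -
    have "t * q y = q (t *\<^sub>R y)"
      using that sublinear_scale[OF q, of t y] sublinear_zero[OF q] by (cases "t = 0") auto
    also have "\<dots> \<le> q (x + t *\<^sub>R y) + q (- x)"
      using sublinear_add[OF q, of "x + t *\<^sub>R y" "- x"] by simp
    finally show ?thesis by simp
  qed
  then have bdd: "bdd_below ((\<lambda>t. q (x + t *\<^sub>R y) - t * q y) ` {0..})" for x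
    by (auto intro!: bdd_belowI)
  have le: "r x \<le> q (x + t *\<^sub>R y) - t * q y" if "0 \<le> t" for x and t :: real
    unfolding r_def using that by (intro cINF_lower bdd) auto
  have greatest: "c \<le> r x" if "\<And>t. 0 \<le> t \<Longrightarrow> c \<le> q (x + t *\<^sub>R y) - t * q y" for c x
    unfolding r_def using that by (intro cINF_greatest) auto
  have add: "r (x + z) \<le> r x + r z" for x z
  proof -
    have "r (x + z) \<le> (q (x + t *\<^sub>R y) - t * q y) + (q (z + s *\<^sub>R y) - s * q y)"
      if "0 \<le> t" "0 \<le> s" for t s
    proof -
      have "r (x + z) \<le> q (x + z + (t + s) *\<^sub>R y) - (t + s) * q y"
        using that by (intro le) auto
      also have "q (x + z + (t + s) *\<^sub>R y) \<le> q (x + t *\<^sub>R y) + q (z + s *\<^sub>R y)"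
        using sublinear_add[OF q, of "x + t *\<^sub>R y" "z + s *\<^sub>R y"] by (simp add: algebra_simps)
      finally show ?thesis by (simp add: algebra_simps)
    qed
    then have "r (x + z) - (q (x + t *\<^sub>R y) - t * q y) \<le> r z" if "0 \<le> t" for t
      using that by (intro greatest) (simp add: diff_le_eq add.commute)
    then have "r (x + z) - r z \<le> r x"
      by (intro greatest) (simp add: diff_le_eq add.commute)
    then show ?thesis by simp
  qed
  have scale_le: "r (t *\<^sub>R x) \<le> t * r x" if t: "0 < t" for t x
  proof -
    have "r (t *\<^sub>R x) / t \<le> r x"
    proof (rule greatest)
      fix s :: real assume s: "0 \<le> s"
      have "r (t *\<^sub>R x) \<le> q (t *\<^sub>R x + (t * s) *\<^sub>R y) - (t * s) * q y"
        using s t by (intro le) auto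
      also have "q (t *\<^sub>R x + (t * s) *\<^sub>R y) = t * q (x + s *\<^sub>R y)"
        using sublinear_scale[OF q t, of "x + s *\<^sub>R y"] by (simp add: algebra_simps)
      finally show "r (t *\<^sub>R x) / t \<le> q (x + s *\<^sub>R y) - s * q y"
        using t by (simp add: field_simps)
    qed
    then show ?thesis using t by (simp add: field_simps)
  qed
  have scale: "r (t *\<^sub>R x) = t * r x" if t: "0 < t" for t x
  proof (rule antisym[OF scale_le[OF t]])
    have "r (inverse t *\<^sub>R (t *\<^sub>R x)) \<le> inverse t * r (t *\<^sub>R x)"
      using t by (intro scale_le) auto
    then show "t * r x \<le> r (t *\<^sub>R x)" using t by (simp add: field_simps)
  qed
  have "r = q"
    using le[of 0] add scale by (intro minimal) (auto simp: sublinear_def le_fun_def)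
  then show ?thesis using le[of 1 x] by simp
qed

text \<open>The Hahn-Banach theorem: by Zorn's lemma there is a minimal sublinear functional below \<open>p\<close>, and a
minimal one is additive.\<close>

theorem linear_dominated_by_sublinear:
  fixes p :: "'v::real_vector \<Rightarrow> real"
  assumes p: "sublinear p"
  shows "\<exists>L. linear L \<and> (\<forall>x. L x \<le> p x)"
proof -
  define A where "A = {q. sublinear q \<and> q \<le> p}"
  have "\<exists>q\<in>A. \<forall>r\<in>A. r \<le> q \<longrightarrow> r = q"
  proof (rule predicate_Zorn)
    show "partial_order_on A (relation_of (\<lambda>q r. r \<le> q) A)"
      by (auto simp: partial_order_on_def preorder_on_def refl_on_def trans_def antisym_def relation_of_def)
    fix C assume C: "C \<in> Chains (relation_of (\<lambda>q r. r \<le> q) A)"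
    then have sub: "C \<subseteq> A" and chain: "\<And>q r. q \<in> C \<Longrightarrow> r \<in> C \<Longrightarrow> q \<le> r \<or> r \<le> q"
      by (auto simp: Chains_def relation_of_def)
    show "\<exists>u\<in>A. \<forall>q\<in>C. u \<le> q"
    proof (cases "C = {}")
      case True then show ?thesis using p by (auto simp: A_def)
    next
      case False
      have "sublinear (\<lambda>x. INF q\<in>C. q x)" "\<And>q x. q \<in> C \<Longrightarrow> (INF q\<in>C. q x) \<le> q x"
        using sublinear_INF_chain[OF False, of p] sub chain by (auto simp: A_def)
      moreover have "(\<lambda>x. INF q\<in>C. q x) \<le> p"
      proof (rule le_funI)
        fix x
        obtain q where "q \<in> C" "q \<in> A" using False sub by auto
        with calculation(2)[of q x] show "(INF q\<in>C. q x) \<le> p x"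
          by (auto simp: A_def le_fun_def intro: order_trans)
      qed
      ultimately show ?thesis
        by (intro bexI[of _ "\<lambda>x. INF q\<in>C. q x"]) (auto simp: A_def le_fun_def)
    qed
  qed
  then obtain q where q: "sublinear q" "q \<le> p" and "\<And>r. r \<in> A \<Longrightarrow> r \<le> q \<Longrightarrow> r = q"
    by (auto simp: A_def)
  then have min: "r = q" if "sublinear r" "r \<le> q" for r
    using that by (auto simp: A_def)
  have add: "q (x + y) = q x + q y" for x y
    using minimal_sublinear_superadditive[OF q(1) min, of x y] sublinear_add[OF q(1), of x y] by simp
  have neg: "q (- x) = - q x" for x
    using add[of x "- x"] sublinear_zero[OF q(1)] by simp
  have "q (t *\<^sub>R x) = t * q x" for t x
  proof -
    consider "0 < t" | "t = 0" | "0 < - t" by linarith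
    then show ?thesis
    proof cases
      case 3
      then show ?thesis using sublinear_scale[OF q(1) 3, of x] neg[of "t *\<^sub>R x"] by simp
    qed (auto simp: sublinear_scale[OF q(1)] sublinear_zero[OF q(1)])
  qed
  then have "linear q" using add by (intro linearI) auto
  then show ?thesis using q(2) by (auto simp: le_fun_def)
qed

section \<open>Semicontinuity and regularity\<close>

text \<open>Semicontinuity through sublevel sets is the form that survives infima over compact sets: there
the sublevel sets become intersections of upward closures of compact sets.\<close>

definition bounded_lsc :: "('a::topological_space \<Rightarrow> real) \<Rightarrow> bool" where
  "bounded_lsc f \<longleftrightarrow> (\<forall>c. closed {x. f x \<le> c}) \<and> bounded (range f)"

lemma bounded_lsc_measurable: "bounded_lsc f \<Longrightarrow> f \<in> borel_measurable borel"
  by (rule borel_measurableI_le) (auto simp: bounded_lsc_def)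

lemma bounded_lsc_bound:
  assumes "bounded_lsc f" obtains B where "\<And>x. \<bar>f x\<bar> \<le> B"
  using assms by (auto simp: bounded_lsc_def bounded_iff)

lemma bounded_lsc_const: "bounded_lsc (\<lambda>_. c)"
  by (simp add: bounded_lsc_def)

lemma bounded_lsc_if: "bounded_lsc f \<Longrightarrow> bounded_lsc (\<lambda>x. if P then f x else 0)"
  by (cases P) (auto simp: bounded_lsc_const)

lemma bounded_lsc_indicator: "open U \<Longrightarrow> bounded_lsc (indicator U)"
proof -
  assume U: "open U"
  have "closed {x. indicator U x \<le> c}" for c :: real
  proof -
    have "{x. indicator U x \<le> c} = (if c < 0 then {} else if c < 1 then - U else UNIV)"
      by (auto simp: indicator_def)
    then show ?thesis using U by auto
  qed
  moreover have "bounded (range (indicator U :: _ \<Rightarrow> real))"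
    by (auto simp: bounded_iff indicator_def intro!: exI[of _ 1])
  ultimately show ?thesis by (auto simp: bounded_lsc_def)
qed

lemma bounded_lsc_add:
  assumes f: "bounded_lsc f" and g: "bounded_lsc g"
  shows "bounded_lsc (\<lambda>x. f x + g x)"
proof -
  have "closed {x. f x + g x \<le> c}" for c
  proof -
    have "{x. f x + g x \<le> c} = (\<Inter>q\<in>\<rat>. {x. f x \<le> q} \<union> {x. g x \<le> c - q})"
    proof safe
      fix x q assume "f x + g x \<le> c" "\<not> g x \<le> c - q" then show "f x \<le> q" by simp
    next
      fix x assume x: "x \<in> (\<Inter>q\<in>\<rat>. {x. f x \<le> q} \<union> {x. g x \<le> c - q})"
      show "f x + g x \<le> c"
      proof (rule ccontr)
        assume "\<not> f x + g x \<le> c"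
        then have "c - g x < f x" by simp
        then obtain q where "q \<in> \<rat>" "c - g x < q" "q < f x"
          using Rats_dense_in_real by blast
        with x show False by fastforce
      qed
    qed
    moreover have "closed (\<Inter>q\<in>\<rat>. {x. f x \<le> q} \<union> {x. g x \<le> c - q})"
      using f g by (intro closed_INT ballI closed_Un) (auto simp: bounded_lsc_def)
    ultimately show ?thesis by simp
  qed
  moreover have "bounded (range (\<lambda>x. f x + g x))"
    using f g bounded_plus_comp[of f UNIV g] by (simp add: bounded_lsc_def)
  ultimately show ?thesis by (simp add: bounded_lsc_def)
qed

lemma bounded_lsc_scale:
  assumes f: "bounded_lsc f" and t: "0 < t"
  shows "bounded_lsc (\<lambda>x. t * f x)"
proof -
  have "{x. t * f x \<le> c} = {x. f x \<le> c / t}" for c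
    using t by (auto simp: field_simps)
  moreover have "bounded (range (\<lambda>x. t * f x))"
    using f bounded_scaling[of "range f" t] by (simp add: bounded_lsc_def image_image)
  ultimately show ?thesis using f by (simp add: bounded_lsc_def)
qed

lemma bounded_lsc_integrable:
  assumes "finite_measure M" "sets M = sets borel" "bounded_lsc f"
  shows "integrable M f"
proof -
  interpret finite_measure M by fact
  obtain B where "\<And>x. \<bar>f x\<bar> \<le> B" using bounded_lsc_bound[OF assms(3)] by blast
  moreover have "f \<in> borel_measurable M"
    using bounded_lsc_measurable[OF assms(3)] assms(2) measurable_cong_sets by blast
  ultimately show ?thesis by (intro integrable_const_bound[where B=B]) auto
qed

lemma compact_inner_approx:
  fixes M :: "'a::polish_space measure"
  assumes "prob_space M" "sets M = sets borel" "A \<in> sets borel" "0 < e"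
  shows "\<exists>K. compact K \<and> K \<subseteq> A \<and> measure M (A - K) < e"
proof -
  interpret prob_space M by fact
  have sup: "emeasure M A = (SUP K \<in> {K. K \<subseteq> A \<and> compact K}. emeasure M K)"
    using assms by (intro inner_regular) auto
  have nonempty: "{K. K \<subseteq> A \<and> compact K} \<noteq> {}" by auto
  obtain K where K: "K \<subseteq> A" "compact K" "emeasure M A < emeasure M K + ennreal e"
    using SUP_approx_ennreal[OF assms(4) nonempty sup] by auto
  have Km: "K \<in> sets M" using K(2) assms(2) borel_compact by auto
  have Am: "A \<in> sets M" using assms by auto
  have "measure M A < measure M K + e"
    using K(3) assms(4) by (simp add: emeasure_eq_measure ennreal_plus[symmetric] ennreal_less_iff del: ennreal_plus)
  then have "measure M (A - K) < e"
    using finite_measure_Diff[OF Am Km K(1)] by simp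
  then show ?thesis using K by blast
qed

lemma open_outer_approx:
  fixes M :: "'a::polish_space measure"
  assumes M: "prob_space M" "sets M = sets borel" and A: "A \<in> sets borel" and e: "0 < e"
  shows "\<exists>U. open U \<and> A \<subseteq> U \<and> measure M U < measure M A + e"
proof -
  interpret prob_space M by fact
  obtain K where K: "compact K" "K \<subseteq> - A" "measure M (- A - K) < e"
    using compact_inner_approx[OF M _ e, of "- A"] A by (auto intro: borel_comp)
  have Km: "K \<in> sets M" using K(1) M borel_compact by auto
  have Am: "A \<in> sets M" using A M by auto
  have "measure M (- K) = measure M (A \<union> (- A - K))"
    using K(2) by (intro arg_cong[where f="measure M"]) auto
  also have "\<dots> = measure M A + measure M (- A - K)"
    using Km Am M(2) by (intro finite_measure_Union) (auto intro!: sets.Diff)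
  finally have "measure M (- K) < measure M A + e" using K(3) by simp
  then show ?thesis using K compact_imp_closed[OF K(1)] by (intro exI[of _ "- K"]) auto
qed

section \<open>Measures on sequence spaces with prescribed marginals\<close>

lemma bcontfun_real_bound:
  fixes h :: "'b::topological_space \<Rightarrow>\<^sub>C real"
  obtains B where "\<And>x. \<bar>h x\<bar> \<le> B"
  using bounded_apply_bcontfun[of h] that by (auto simp: bounded_iff)

text \<open>The hypothesis \<open>duality\<close> is clearly necessary for a measure on \<open>\<Omega>\<close> with marginals \<open>\<nu> i\<close>; the
results below show that it suffices.  Semicontinuous functions are enough because indicators of
open sets are among them, and these control all Borel sets by outer regularity.\<close>

locale marginal_duality =
  fixes \<nu> :: "nat \<Rightarrow> 'a::polish_space measure" and \<Omega> :: "(nat \<Rightarrow> 'a) set"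
  assumes prob_\<nu>: "\<And>i. prob_space (\<nu> i)" and sets_\<nu>: "\<And>i. sets (\<nu> i) = sets borel"
    and closed_\<Omega>: "closed \<Omega>"
    and duality: "\<And>n f c. (\<And>i. bounded_lsc (f i)) \<Longrightarrow> (\<And>\<omega>. \<omega> \<in> \<Omega> \<Longrightarrow> c \<le> (\<Sum>i<n. f i (\<omega> i))) \<Longrightarrow>
      c \<le> (\<Sum>i<n. \<integral>x. f i x \<partial>\<nu> i)"
begin

text \<open>The costs of dominating \<open>h\<close> on \<open>\<Omega>\<close> by sums of functions of the coordinates.  On a discrete space
bounded continuous functions are just bounded functions, so indicators of arbitrary sets of
sequences are available.\<close>

definition upper_bounds :: "((nat \<Rightarrow> 'a) discrete \<Rightarrow>\<^sub>C real) \<Rightarrow> real set" where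
  "upper_bounds h = {(\<Sum>i<n. \<integral>x. f i x \<partial>\<nu> i) - c | n f c.
     (\<forall>i. bounded_lsc (f i)) \<and> (\<forall>\<omega>\<in>\<Omega>. h (discrete \<omega>) + c \<le> (\<Sum>i<n. f i (\<omega> i)))}"

definition upper_integral :: "((nat \<Rightarrow> 'a) discrete \<Rightarrow>\<^sub>C real) \<Rightarrow> real" where
  "upper_integral h = Inf (upper_bounds h)"

lemma upper_boundsI:
  fixes h :: "(nat \<Rightarrow> 'a) discrete \<Rightarrow>\<^sub>C real"
  shows "(\<And>i. bounded_lsc (f i)) \<Longrightarrow> (\<And>\<omega>. \<omega> \<in> \<Omega> \<Longrightarrow> h (discrete \<omega>) + c \<le> (\<Sum>i<n. f i (\<omega> i))) \<Longrightarrow>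
   (\<Sum>i<n. \<integral>x. f i x \<partial>\<nu> i) - c \<in> upper_bounds h"
  unfolding upper_bounds_def by blast

text \<open>Padding with zero functions makes the number of coordinates arbitrarily large, so that two bounds
can be brought to the same number and added.\<close>

lemma upper_boundsD:
  fixes h :: "(nat \<Rightarrow> 'a) discrete \<Rightarrow>\<^sub>C real"
  assumes "v \<in> upper_bounds h"
  shows "\<exists>n f c. (\<forall>i. bounded_lsc (f i)) \<and> (\<forall>m\<ge>n. v = (\<Sum>i<m. \<integral>x. f i x \<partial>\<nu> i) - c) \<and>
    (\<forall>m\<ge>n. \<forall>\<omega>\<in>\<Omega>. h (discrete \<omega>) + c \<le> (\<Sum>i<m. f i (\<omega> i)))"
proof -
  obtain n f c where v: "v = (\<Sum>i<n. \<integral>x. f i x \<partial>\<nu> i) - c"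
    and f: "\<And>i. bounded_lsc (f i)"
    and le: "\<And>\<omega>. \<omega> \<in> \<Omega> \<Longrightarrow> h (discrete \<omega>) + c \<le> (\<Sum>i<n. f i (\<omega> i))"
    using assms unfolding upper_bounds_def by blast
  define g where "g = (\<lambda>i x. if i < n then f i x else 0)"
  have *: "(\<Sum>i<m. G i (g i)) = (\<Sum>i<n. G i (f i))"
    if "n \<le> m" "\<And>i. G i (\<lambda>x. 0) = 0" for m and G :: "nat \<Rightarrow> ('a \<Rightarrow> real) \<Rightarrow> real"
  proof -
    have "(\<Sum>i<n. G i (f i)) = (\<Sum>i<m. if i < n then G i (f i) else 0)"
      using that by (intro sum.mono_neutral_cong_left) auto
    also have "\<dots> = (\<Sum>i<m. G i (g i))"
      using that(2) by (intro sum.cong) (auto simp: g_def)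
    finally show ?thesis by simp
  qed
  have "bounded_lsc (g i)" for i unfolding g_def by (intro bounded_lsc_if f)
  moreover have "v = (\<Sum>i<m. \<integral>x. g i x \<partial>\<nu> i) - c" if "n \<le> m" for m
    using *[OF that, of "\<lambda>i h. \<integral>x. h x \<partial>\<nu> i"] v by simp
  moreover have "h (discrete \<omega>) + c \<le> (\<Sum>i<m. g i (\<omega> i))" if "n \<le> m" "\<omega> \<in> \<Omega>" for m \<omega>
    using *[OF that(1), of "\<lambda>i h. h (\<omega> i)"] le[OF that(2)] by simp
  ultimately show ?thesis by blast
qed

lemma upper_bounds_add:
  fixes g h :: "(nat \<Rightarrow> 'a) discrete \<Rightarrow>\<^sub>C real"
  assumes "v \<in> upper_bounds g" "w \<in> upper_bounds h"
  shows "v + w \<in> upper_bounds (g + h)"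
proof -
  obtain n f c where f: "\<And>i. bounded_lsc (f i)" "\<And>m. n \<le> m \<Longrightarrow> v = (\<Sum>i<m. \<integral>x. f i x \<partial>\<nu> i) - c"
    "\<And>m \<omega>. n \<le> m \<Longrightarrow> \<omega> \<in> \<Omega> \<Longrightarrow> g (discrete \<omega>) + c \<le> (\<Sum>i<m. f i (\<omega> i))"
    using upper_boundsD[OF assms(1)] by blast
  obtain n' f' c' where f': "\<And>i. bounded_lsc (f' i)" "\<And>m. n' \<le> m \<Longrightarrow> w = (\<Sum>i<m. \<integral>x. f' i x \<partial>\<nu> i) - c'"
    "\<And>m \<omega>. n' \<le> m \<Longrightarrow> \<omega> \<in> \<Omega> \<Longrightarrow> h (discrete \<omega>) + c' \<le> (\<Sum>i<m. f' i (\<omega> i))"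
    using upper_boundsD[OF assms(2)] by blast
  define m where "m = max n n'"
  have m: "n \<le> m" "n' \<le> m" by (auto simp: m_def)
  have "(\<Sum>i<m. \<integral>x. f i x + f' i x \<partial>\<nu> i) - (c + c') \<in> upper_bounds (g + h)"
  proof (rule upper_boundsI)
    show "bounded_lsc (\<lambda>x. f i x + f' i x)" for i by (intro bounded_lsc_add f f')
    show "(g + h) (discrete \<omega>) + (c + c') \<le> (\<Sum>i<m. f i (\<omega> i) + f' i (\<omega> i))" if "\<omega> \<in> \<Omega>" for \<omega>
      using f(3)[OF m(1) that] f'(3)[OF m(2) that] by (simp add: sum.distrib)
  qed
  moreover have "(\<Sum>i<m. \<integral>x. f i x + f' i x \<partial>\<nu> i) = (\<Sum>i<m. \<integral>x. f i x \<partial>\<nu> i) + (\<Sum>i<m. \<integral>x. f' i x \<partial>\<nu> i)"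
  proof -
    have "integrable (\<nu> i) (f i)" "integrable (\<nu> i) (f' i)" for i
      using f(1) f'(1) prob_\<nu> sets_\<nu> by (auto intro!: bounded_lsc_integrable prob_space.finite_measure)
    then show ?thesis by (simp add: sum.distrib)
  qed
  moreover have "v + w = (\<Sum>i<m. \<integral>x. f i x \<partial>\<nu> i) + (\<Sum>i<m. \<integral>x. f' i x \<partial>\<nu> i) - (c + c')"
    using f(2) f'(2) m by simp
  ultimately show ?thesis by simp
qed

lemma upper_bounds_scale:
  fixes h :: "(nat \<Rightarrow> 'a) discrete \<Rightarrow>\<^sub>C real"
  assumes "v \<in> upper_bounds h" "0 < t"
  shows "t * v \<in> upper_bounds (t *\<^sub>R h)"
proof -
  obtain n f c where f: "\<And>i. bounded_lsc (f i)" "\<And>m. n \<le> m \<Longrightarrow> v = (\<Sum>i<m. \<integral>x. f i x \<partial>\<nu> i) - c"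
    "\<And>m \<omega>. n \<le> m \<Longrightarrow> \<omega> \<in> \<Omega> \<Longrightarrow> h (discrete \<omega>) + c \<le> (\<Sum>i<m. f i (\<omega> i))"
    using upper_boundsD[OF assms(1)] by blast
  have "(\<Sum>i<n. \<integral>x. t * f i x \<partial>\<nu> i) - t * c \<in> upper_bounds (t *\<^sub>R h)"
  proof (rule upper_boundsI)
    show "bounded_lsc (\<lambda>x. t * f i x)" for i by (intro bounded_lsc_scale f assms)
    show "(t *\<^sub>R h) (discrete \<omega>) + t * c \<le> (\<Sum>i<n. t * f i (\<omega> i))" if "\<omega> \<in> \<Omega>" for \<omega>
      using mult_left_mono[OF f(3)[OF order_refl that], of t] assms(2)
      by (simp add: sum_distrib_left algebra_simps)
  qed
  moreover have "t * v = (\<Sum>i<n. \<integral>x. t * f i x \<partial>\<nu> i) - t * c"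
    unfolding f(2)[OF order_refl] by (simp add: sum_distrib_left right_diff_distrib)
  ultimately show ?thesis by simp
qed

lemma upper_bounds_nonempty:
  fixes h :: "(nat \<Rightarrow> 'a) discrete \<Rightarrow>\<^sub>C real"
  shows "upper_bounds h \<noteq> {}"
proof -
  obtain B where B: "\<And>x. \<bar>h x\<bar> \<le> B" using bcontfun_real_bound by blast
  have "(\<Sum>i<0. \<integral>x. 0 \<partial>\<nu> i) - (- B) \<in> upper_bounds h"
    using B[THEN abs_le_D1] by (intro upper_boundsI) (auto simp: bounded_lsc_const)
  then show ?thesis by blast
qed

lemma upper_bounds_bdd_below:
  fixes h :: "(nat \<Rightarrow> 'a) discrete \<Rightarrow>\<^sub>C real"
  shows "bdd_below (upper_bounds h)"
proof -
  obtain B where B: "\<And>x. \<bar>h x\<bar> \<le> B" using bcontfun_real_bound by blast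
  have "- B \<le> v" if "v \<in> upper_bounds h" for v
  proof -
    obtain n f c where f: "\<And>i. bounded_lsc (f i)" "\<And>m. n \<le> m \<Longrightarrow> v = (\<Sum>i<m. \<integral>x. f i x \<partial>\<nu> i) - c"
      "\<And>m \<omega>. n \<le> m \<Longrightarrow> \<omega> \<in> \<Omega> \<Longrightarrow> h (discrete \<omega>) + c \<le> (\<Sum>i<m. f i (\<omega> i))"
      using upper_boundsD[OF \<open>v \<in> upper_bounds h\<close>] by blast
    have "c - B \<le> (\<Sum>i<n. f i (\<omega> i))" if "\<omega> \<in> \<Omega>" for \<omega>
      using f(3)[OF order_refl that] B[THEN abs_le_D2, of "discrete \<omega>"] by linarith
    then have "c - B \<le> (\<Sum>i<n. \<integral>x. f i x \<partial>\<nu> i)" by (intro duality f(1))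
    then show ?thesis using f(2)[OF order_refl] by simp
  qed
  then show ?thesis by (rule bdd_belowI)
qed

lemma upper_integral_le:
  fixes h :: "(nat \<Rightarrow> 'a) discrete \<Rightarrow>\<^sub>C real"
  shows "v \<in> upper_bounds h \<Longrightarrow> upper_integral h \<le> v"
  unfolding upper_integral_def by (intro cInf_lower upper_bounds_bdd_below)

lemma upper_integral_ge:
  fixes h :: "(nat \<Rightarrow> 'a) discrete \<Rightarrow>\<^sub>C real"
  shows "(\<And>v. v \<in> upper_bounds h \<Longrightarrow> c \<le> v) \<Longrightarrow> c \<le> upper_integral h"
  unfolding upper_integral_def by (intro cInf_greatest upper_bounds_nonempty)

lemma sublinear_upper_integral: "sublinear upper_integral"
  unfolding sublinear_def
proof safe
  fix g h :: "(nat \<Rightarrow> 'a) discrete \<Rightarrow>\<^sub>C real"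
  have "upper_integral (g + h) - v \<le> w" if "v \<in> upper_bounds g" "w \<in> upper_bounds h" for v w
    using upper_integral_le[OF upper_bounds_add[OF that]] by simp
  then have "upper_integral (g + h) - v \<le> upper_integral h" if "v \<in> upper_bounds g" for v
    using that by (intro upper_integral_ge)
  then have "upper_integral (g + h) - upper_integral h \<le> upper_integral g"
    by (intro upper_integral_ge) (simp add: diff_le_eq add.commute)
  then show "upper_integral (g + h) \<le> upper_integral g + upper_integral h" by simp
next
  fix t :: real and h :: "(nat \<Rightarrow> 'a) discrete \<Rightarrow>\<^sub>C real"
  assume t: "0 < t"
  have *: "upper_integral (s *\<^sub>R g) \<le> s * upper_integral g" if s: "0 < s" for s and g :: "(nat \<Rightarrow> 'a) discrete \<Rightarrow>\<^sub>C real"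
  proof -
    have "upper_integral (s *\<^sub>R g) / s \<le> v" if "v \<in> upper_bounds g" for v
      using upper_integral_le[OF upper_bounds_scale[OF that s]] s by (simp add: field_simps)
    then have "upper_integral (s *\<^sub>R g) / s \<le> upper_integral g" by (rule upper_integral_ge)
    then show ?thesis using s by (simp add: field_simps)
  qed
  have "upper_integral h \<le> inverse t * upper_integral (t *\<^sub>R h)"
    using *[of "inverse t" "t *\<^sub>R h"] t by simp
  then show "upper_integral (t *\<^sub>R h) = t * upper_integral h"
    using *[OF t, of h] t by (simp add: field_simps)
qed

text \<open>The set function evaluates a linear functional below \<open>upper_integral\<close> at indicators.  The
marginal bound holds for open sets by construction and for Borel sets by outer regularity;
applied to complements it becomes an equality.\<close>

lemma finitely_additive_coupling:
  obtains l :: "(nat \<Rightarrow> 'a) set \<Rightarrow> real" where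
    "\<And>A. 0 \<le> l A" "\<And>A B. A \<inter> B = {} \<Longrightarrow> l (A \<union> B) = l A + l B" "l (- \<Omega>) = 0"
    "\<And>i A. A \<in> sets borel \<Longrightarrow> l {\<omega>. \<omega> i \<in> A} = measure (\<nu> i) A"
proof -
  obtain L where L: "linear L" "\<And>h. L h \<le> upper_integral h"
    using linear_dominated_by_sublinear[OF sublinear_upper_integral] by blast
  define ind :: "(nat \<Rightarrow> 'a) set \<Rightarrow> (nat \<Rightarrow> 'a) discrete \<Rightarrow>\<^sub>C real"
    where "ind A = Bcontfun (\<lambda>x. indicator A (of_discrete x))" for A
  have ind: "ind A (discrete \<omega>) = indicator A \<omega>" for A \<omega>
  proof -
    have "(\<lambda>x. indicator A (of_discrete x) :: real) \<in> bcontfun"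
      by (rule bcontfun_normI[where b=1])
        (auto simp: continuous_on_open_invariant open_discrete indicator_def)
    then show ?thesis by (simp add: ind_def Bcontfun_inverse discrete_inverse)
  qed
  define l where "l A = L (ind A)" for A
  have nonneg: "0 \<le> l A" for A
  proof -
    have "(\<Sum>i<0. \<integral>x. 0 \<partial>\<nu> i) - 0 \<in> upper_bounds (- ind A)"
      by (intro upper_boundsI) (auto simp: bounded_lsc_const ind)
    from order_trans[OF L(2) upper_integral_le[OF this]] show ?thesis
      by (simp add: l_def linear_neg[OF L(1)])
  qed
  have add: "l (A \<union> B) = l A + l B" if "A \<inter> B = {}" for A B
  proof -
    have "ind (A \<union> B) = ind A + ind B"
    proof (rule bcontfun_eqI)
      fix x
      show "ind (A \<union> B) x = (ind A + ind B) x"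
        using that by (cases x) (auto simp: ind indicator_def disjoint_iff)
    qed
    then show ?thesis by (simp add: l_def linear_add[OF L(1)])
  qed
  have "(\<Sum>i<0. \<integral>x. 0 \<partial>\<nu> i) - 0 \<in> upper_bounds (ind (- \<Omega>))"
    by (intro upper_boundsI) (auto simp: bounded_lsc_const ind)
  from order_trans[OF L(2) upper_integral_le[OF this]] have null: "l (- \<Omega>) = 0"
    using nonneg[of "- \<Omega>"] by (simp add: l_def)
  have mono: "l A \<le> l B" if "A \<subseteq> B" for A B
    using add[of A "B - A"] nonneg[of "B - A"] that by (simp add: Un_absorb1)
  have open_le: "l {\<omega>. \<omega> i \<in> U} \<le> measure (\<nu> i) U" if U: "open U" for i U
  proof -
    define f :: "nat \<Rightarrow> 'a \<Rightarrow> real" where "f j = (\<lambda>x. if j = i then indicator U x else 0)" for j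
    have "(\<Sum>j<Suc i. \<integral>x. f j x \<partial>\<nu> j) - 0 \<in> upper_bounds (ind {\<omega>. \<omega> i \<in> U})"
    proof (rule upper_boundsI)
      show "bounded_lsc (f j)" for j
        unfolding f_def by (intro bounded_lsc_if bounded_lsc_indicator U)
      have "(\<Sum>j<Suc i. f j (\<omega> j)) = indicator U (\<omega> i)" for \<omega>
        by (simp add: f_def)
      then show "ind {\<omega>. \<omega> i \<in> U} (discrete \<omega>) + 0 \<le> (\<Sum>j<Suc i. f j (\<omega> j))" for \<omega>
        by (simp add: ind indicator_def)
    qed
    moreover have "(\<Sum>j<Suc i. \<integral>x. f j x \<partial>\<nu> j) = measure (\<nu> i) U"
      using sets_eq_imp_space_eq[OF sets_\<nu>[of i]] by (simp add: f_def)
    ultimately show ?thesis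
      using order_trans[OF L(2) upper_integral_le] by (fastforce simp: l_def)
  qed
  have le: "l {\<omega>. \<omega> i \<in> A} \<le> measure (\<nu> i) A" if A: "A \<in> sets borel" for i A
  proof (rule field_le_epsilon)
    fix e :: real assume "0 < e"
    then obtain U where U: "open U" "A \<subseteq> U" "measure (\<nu> i) U < measure (\<nu> i) A + e"
      using open_outer_approx[OF prob_\<nu> sets_\<nu> A] by blast
    have "l {\<omega>. \<omega> i \<in> A} \<le> l {\<omega>. \<omega> i \<in> U}" using U(2) by (intro mono) auto
    also have "\<dots> \<le> measure (\<nu> i) U" by (rule open_le[OF U(1)])
    finally show "l {\<omega>. \<omega> i \<in> A} \<le> measure (\<nu> i) A + e" using U(3) by simp
  qed
  \<comment> \<open>The empty sum with constant \<open>1\<close> dominates \<open>- ind UNIV + 1\<close>, so the total mass is at least \<open>1\<close>.\<close>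
  have "(\<Sum>i<0. \<integral>x. 0 \<partial>\<nu> i) - 1 \<in> upper_bounds (- ind UNIV)"
    by (intro upper_boundsI) (auto simp: bounded_lsc_const ind)
  from order_trans[OF L(2) upper_integral_le[OF this]] have total: "1 \<le> l UNIV"
    by (simp add: l_def linear_neg[OF L(1)])
  have eq: "l {\<omega>. \<omega> i \<in> A} = measure (\<nu> i) A" if A: "A \<in> sets borel" for i A
  proof -
    interpret prob_space "\<nu> i" by (rule prob_\<nu>)
    have "1 \<le> l {\<omega>. \<omega> i \<in> A} + l {\<omega>. \<omega> i \<in> - A}"
    proof -
      have "{\<omega>. \<omega> i \<in> A} \<union> {\<omega>. \<omega> i \<in> - A} = UNIV" "{\<omega>. \<omega> i \<in> A} \<inter> {\<omega>. \<omega> i \<in> - A} = {}"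
        by auto
      with add[of "{\<omega>. \<omega> i \<in> A}" "{\<omega>. \<omega> i \<in> - A}"] total show ?thesis by metis
    qed
    moreover have "measure (\<nu> i) (- A) = 1 - measure (\<nu> i) A"
      using prob_compl[of A] A sets_\<nu>[of i] sets_eq_imp_space_eq[OF sets_\<nu>[of i]]
      by (simp add: Compl_eq_Diff_UNIV)
    moreover have "- A \<in> sets borel" using A by (rule borel_comp)
    ultimately show ?thesis using le[OF A, of i] le[of "- A" i] by linarith
  qed
  show thesis by (rule that[OF nonneg add null eq])
qed

end

lemma closed_coordinate:
  fixes C :: "'a::topological_space set"
  assumes "closed C" shows "closed {\<omega> :: nat \<Rightarrow> 'a. \<omega> i \<in> C}"
  using closed_vimage[OF assms continuous_on_product_then_coordinatewise[OF continuous_on_id], of i]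
  by (simp add: vimage_def)

lemma tendsto_coordinatewise:
  fixes s :: "nat \<Rightarrow> nat \<Rightarrow> 'a::topological_space"
  assumes "\<And>i. (\<lambda>n. s n i) \<longlonglongrightarrow> w i"
  shows "s \<longlonglongrightarrow> w"
proof -
  have "limitin (product_topology (\<lambda>i. euclidean) UNIV) s w sequentially"
    using assms by (simp add: limitin_componentwise)
  then show ?thesis by (simp add: euclidean_product_topology)
qed

text \<open>Only the first coordinates of each \<open>s n\<close> are confined to the compact sets, but every coordinate
is confined from some \<open>n\<close> on.\<close>

lemma diagonal_convergent_subsequence:
  fixes s :: "nat \<Rightarrow> nat \<Rightarrow> 'a::metric_space"
  assumes K: "\<And>i. compact (K i)" and s: "\<And>i n. i \<le> n \<Longrightarrow> s n i \<in> K i"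
  shows "\<exists>r w. strict_mono r \<and> (s \<circ> r) \<longlonglongrightarrow> w"
proof -
  interpret subseqs "\<lambda>i r. convergent (\<lambda>n. s (r n) i)"
  proof
    fix i and r :: "nat \<Rightarrow> nat" assume r: "strict_mono r"
    have "s (r (n + i)) i \<in> K i" for n
      using seq_suble[OF r, of "n + i"] by (intro s) simp
    then obtain l r' where r': "strict_mono r'" "((\<lambda>n. s (r (n + i)) i) \<circ> r') \<longlonglongrightarrow> l"
      using K[of i, unfolded compact_def, rule_format, of "\<lambda>n. s (r (n + i)) i"] by blast
    have "strict_mono (\<lambda>n. r' n + i)" using r'(1) by (simp add: strict_mono_def)
    moreover have "convergent (\<lambda>n. s ((r \<circ> (\<lambda>n. r' n + i)) n) i)"
      using r'(2) by (auto simp: convergent_def o_def)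
    ultimately show "\<exists>r'. strict_mono r' \<and> convergent (\<lambda>n. s ((r \<circ> r') n) i)" by blast
  qed
  have "convergent (\<lambda>n. s (diagseq n) i)" for i
  proof -
    have "convergent (\<lambda>n. s ((diagseq \<circ> ((+) (Suc i))) n) i)"
    proof (rule diagseq_holds)
      fix r t :: "nat \<Rightarrow> nat" and n
      assume "strict_mono r" "convergent (\<lambda>k. s (t k) n)"
      then show "convergent (\<lambda>k. s ((t \<circ> r) k) n)"
        using convergent_subseq_convergent[of "\<lambda>k. s (t k) n" r] by (simp add: o_def)
    qed
    then have "convergent (\<lambda>n. s (diagseq (n + Suc i)) i)" by (simp add: o_def add.commute)
    then show ?thesis
      by (rule convergent_ignore_initial_segment[of "\<lambda>n. s (diagseq n) i" "Suc i", THEN iffD1])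
  qed
  then have "(s \<circ> diagseq) \<longlonglongrightarrow> (\<lambda>i. lim (\<lambda>n. s (diagseq n) i))"
    by (intro tendsto_coordinatewise) (simp add: o_def convergent_LIMSEQ_iff)
  then show ?thesis using subseq_diagseq by blast
qed

text \<open>The Hahn-Banach theorem yields a set function \<open>l\<close> on all sets of sequences, with no countable
additivity beyond that of its marginals.  As these are tight, countable additivity of \<open>l\<close> follows
on an algebra large enough to make the coordinates measurable.\<close>

locale finitely_additive_tight =
  fixes \<nu> :: "nat \<Rightarrow> 'a::polish_space measure" and \<Omega> :: "(nat \<Rightarrow> 'a) set"
    and l :: "(nat \<Rightarrow> 'a) set \<Rightarrow> real"
  assumes prob_\<nu>: "\<And>i. prob_space (\<nu> i)" and sets_\<nu>: "\<And>i. sets (\<nu> i) = sets borel"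
    and closed_\<Omega>: "closed \<Omega>"
    and l_nonneg: "\<And>A. 0 \<le> l A"
    and l_Un: "\<And>A B. A \<inter> B = {} \<Longrightarrow> l (A \<union> B) = l A + l B"
    and l_null: "l (- \<Omega>) = 0"
    and l_marginal: "\<And>i A. A \<in> sets borel \<Longrightarrow> l {\<omega>. \<omega> i \<in> A} = measure (\<nu> i) A"
begin

lemma l_mono: "A \<subseteq> B \<Longrightarrow> l A \<le> l B"
  using l_Un[of A "B - A"] l_nonneg[of "B - A"] by (simp add: Un_absorb1)

lemma l_subadditive: "l (A \<union> B) \<le> l A + l B"
  using l_Un[of A "B - A"] l_mono[of "B - A" B] by auto

lemma l_empty: "l {} = 0"
  using l_Un[of "{}" "{}"] by simp

lemma l_UN_subadditive: "l (\<Union>i\<in>{..n}. A i) \<le> (\<Sum>i\<le>n. l (A i))" for n :: nat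
proof (induction n)
  case (Suc n)
  have "l (\<Union>i\<in>{..Suc n}. A i) \<le> l (\<Union>i\<in>{..n}. A i) + l (A (Suc n))"
    using l_subadditive[of "\<Union>i\<in>{..n}. A i" "A (Suc n)"] by (simp add: atMost_Suc Un_commute)
  then show ?case using Suc by simp
qed simp

lemma l_Int_\<Omega>: "l (A \<inter> \<Omega>) = l A"
proof -
  have "l A \<le> l ((A \<inter> \<Omega>) \<union> - \<Omega>)" by (rule l_mono) auto
  also have "\<dots> \<le> l (A \<inter> \<Omega>)" using l_subadditive[of "A \<inter> \<Omega>" "- \<Omega>"] l_null by simp
  finally show ?thesis using l_mono[of "A \<inter> \<Omega>" A] by auto
qed

text \<open>Outer approximation by an open set is expressed through a closed set \<open>G\<close> inside the complement,
which makes the class symmetric under complements.\<close>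

definition regular :: "(nat \<Rightarrow> 'a) set set" where
  "regular = {A. A \<subseteq> \<Omega> \<and> (\<forall>e>0. \<exists>F G. closed F \<and> closed G \<and> F \<subseteq> A \<and> G \<subseteq> \<Omega> - A \<and> l (\<Omega> - F - G) < e)}"

lemma regularD:
  assumes "A \<in> regular" "0 < e"
  obtains F G where "closed F" "closed G" "F \<subseteq> A" "G \<subseteq> \<Omega> - A" "l (\<Omega> - F - G) < e"
  using assms unfolding regular_def by blast

lemma regular_algebra: "algebra \<Omega> regular"
  unfolding algebra_iff_Un
proof safe
  fix A w assume "A \<in> regular" "w \<in> A" then show "w \<in> \<Omega>" by (auto simp: regular_def)
next
  have "closed {} \<and> closed \<Omega> \<and> {} \<subseteq> {} \<and> \<Omega> \<subseteq> \<Omega> - {} \<and> l (\<Omega> - {} - \<Omega>) < e" if "0 < e" for e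
    using closed_\<Omega> that by (simp add: l_empty)
  then show "{} \<in> regular" unfolding regular_def by blast
next
  fix A assume A: "A \<in> regular"
  have "\<exists>F G. closed F \<and> closed G \<and> F \<subseteq> \<Omega> - A \<and> G \<subseteq> \<Omega> - (\<Omega> - A) \<and> l (\<Omega> - F - G) < e"
    if e: "0 < e" for e
  proof -
    obtain F G where FG: "closed F" "closed G" "F \<subseteq> A" "G \<subseteq> \<Omega> - A" "l (\<Omega> - F - G) < e"
      by (rule regularD[OF A e])
    have "\<Omega> - G - F = \<Omega> - F - G" "F \<subseteq> \<Omega> - (\<Omega> - A)" using FG A by (auto simp: regular_def)
    with FG show ?thesis by (intro exI[of _ G] exI[of _ F]) simp
  qed
  then show "\<Omega> - A \<in> regular" by (auto simp: regular_def)
next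
  fix A B assume A: "A \<in> regular" and B: "B \<in> regular"
  have "\<exists>F G. closed F \<and> closed G \<and> F \<subseteq> A \<union> B \<and> G \<subseteq> \<Omega> - (A \<union> B) \<and> l (\<Omega> - F - G) < e"
    if e: "0 < e" for e
  proof -
    obtain F G where FG: "closed F" "closed G" "F \<subseteq> A" "G \<subseteq> \<Omega> - A" "l (\<Omega> - F - G) < e / 2"
      by (rule regularD[OF A, of "e / 2"]) (use e in auto)
    obtain F' G' where FG': "closed F'" "closed G'" "F' \<subseteq> B" "G' \<subseteq> \<Omega> - B" "l (\<Omega> - F' - G') < e / 2"
      by (rule regularD[OF B, of "e / 2"]) (use e in auto)
    have "l (\<Omega> - (F \<union> F') - (G \<inter> G')) \<le> l ((\<Omega> - F - G) \<union> (\<Omega> - F' - G'))"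
      by (rule l_mono) auto
    also have "\<dots> < e" using l_subadditive[of "\<Omega> - F - G" "\<Omega> - F' - G'"] FG(5) FG'(5) by simp
    finally show ?thesis using FG FG'
      by (intro exI[of _ "F \<union> F'"] exI[of _ "G \<inter> G'"]) auto
  qed
  then show "A \<union> B \<in> regular" using A B by (auto simp: regular_def)
qed

lemma coordinate_regular:
  assumes A: "A \<in> sets borel"
  shows "{\<omega>\<in>\<Omega>. \<omega> i \<in> A} \<in> regular"
proof -
  have "\<exists>F G. closed F \<and> closed G \<and> F \<subseteq> {\<omega>\<in>\<Omega>. \<omega> i \<in> A} \<and> G \<subseteq> \<Omega> - {\<omega>\<in>\<Omega>. \<omega> i \<in> A} \<and>
      l (\<Omega> - F - G) < e" if e: "0 < e" for e
  proof -
    obtain K where K: "compact K" "K \<subseteq> A" "measure (\<nu> i) (A - K) < e / 2"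
      using compact_inner_approx[OF prob_\<nu>[of i] sets_\<nu>[of i] A, of "e / 2"] e by auto
    obtain K' where K': "compact K'" "K' \<subseteq> - A" "measure (\<nu> i) (- A - K') < e / 2"
      using compact_inner_approx[OF prob_\<nu>[of i] sets_\<nu>[of i] borel_comp[OF A], of "e / 2"] e by auto
    define F where "F = \<Omega> \<inter> {\<omega>. \<omega> i \<in> K}"
    define G where "G = \<Omega> \<inter> {\<omega>. \<omega> i \<in> K'}"
    have "l (\<Omega> - F - G) \<le> l ({\<omega>. \<omega> i \<in> A - K} \<union> {\<omega>. \<omega> i \<in> - A - K'})"
      by (rule l_mono) (auto simp: F_def G_def)
    also have "\<dots> \<le> measure (\<nu> i) (A - K) + measure (\<nu> i) (- A - K')"
      using l_subadditive[of "{\<omega>. \<omega> i \<in> A - K}" "{\<omega>. \<omega> i \<in> - A - K'}"]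
        l_marginal[OF sets.Diff[OF A borel_compact[OF K(1)]], of i]
        l_marginal[OF sets.Diff[OF borel_comp[OF A] borel_compact[OF K'(1)]], of i]
      by simp
    also have "\<dots> < e" using K(3) K'(3) by simp
    finally have "l (\<Omega> - F - G) < e" .
    moreover have "closed F" "closed G"
      unfolding F_def G_def
      by (intro closed_Int closed_\<Omega> closed_coordinate compact_imp_closed[OF K(1)] compact_imp_closed[OF K'(1)])+
    moreover have "F \<subseteq> {\<omega>\<in>\<Omega>. \<omega> i \<in> A}" "G \<subseteq> \<Omega> - {\<omega>\<in>\<Omega>. \<omega> i \<in> A}"
      using K(2) K'(2) by (auto simp: F_def G_def)
    ultimately show ?thesis by blast
  qed
  then show ?thesis by (auto simp: regular_def)
qed

text \<open>If the values stay above \<open>e\<close>, closed inner approximations \<open>F n\<close> and compact sets \<open>K i\<close> for the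
marginals can be chosen with total loss below \<open>e\<close>.  Then for each \<open>n\<close> some sequence lies in
\<open>F 0, ..., F n\<close> with its first coordinates in \<open>K 0, ..., K n\<close>, and a limit point of these
sequences lies in all \<open>F n\<close>, contradicting the empty intersection.  Only finitely many \<open>K i\<close> are
used for each \<open>n\<close>, as finite additivity gives no control over infinitely many coordinates at once.\<close>

lemma regular_empty_continuous:
  assumes A: "range A \<subseteq> regular" and dec: "decseq A" and empty: "(\<Inter>n. A n) = {}"
  shows "(\<lambda>n. l (A n)) \<longlonglongrightarrow> 0"
proof (rule ccontr)
  assume not: "\<not> ?thesis"
  have "decseq (\<lambda>n. l (A n))" using dec by (auto simp: decseq_def intro: l_mono)
  have "\<exists>e>0. \<forall>n. e \<le> l (A n)"
  proof (rule ccontr)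
    assume "\<not> (\<exists>e>0. \<forall>n. e \<le> l (A n))"
    then have small: "\<exists>n. l (A n) < e" if "0 < e" for e using that by (auto simp: not_le)
    have "(\<lambda>n. l (A n)) \<longlonglongrightarrow> 0"
    proof (rule LIMSEQ_I)
      fix e :: real assume "0 < e"
      then obtain n where "l (A n) < e" using small by blast
      then have "l (A m) < e" if "n \<le> m" for m
        using decseqD[OF \<open>decseq (\<lambda>n. l (A n))\<close> that] by simp
      then show "\<exists>n. \<forall>m\<ge>n. norm (l (A m) - 0) < e" using l_nonneg by auto
    qed
    with not show False by simp
  qed
  then obtain e where e: "0 < e" "\<And>n. e \<le> l (A n)" by blast
  \<comment> \<open>Each of the two families of errors then sums to less than \<open>e / 2\<close>.\<close>
  define \<delta> where "\<delta> n = e * (1 / 2) ^ (n + 2)" for n :: nat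
  have \<delta>: "0 < \<delta> n" for n using e(1) by (simp add: \<delta>_def)
  have sum\<delta>: "(\<Sum>i\<le>n. \<delta> i) < e / 2" for n
  proof -
    have "(\<Sum>i\<le>n. \<delta> i) = e / 2 - e * (1 / 2) ^ (n + 2)"
      by (induction n) (auto simp: \<delta>_def)
    then show ?thesis using e(1) by simp
  qed
  have "\<exists>F. closed F \<and> F \<subseteq> A n \<and> l (A n - F) < \<delta> n" for n
  proof -
    have "A n \<in> regular" using A by auto
    then obtain F G where FG: "closed F" "closed G" "F \<subseteq> A n" "G \<subseteq> \<Omega> - A n" "l (\<Omega> - F - G) < \<delta> n"
      using regularD[OF _ \<delta>] by metis
    have "A n - F \<subseteq> \<Omega> - F - G" using FG(4) \<open>A n \<in> regular\<close> by (auto simp: regular_def)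
    from l_mono[OF this] FG show ?thesis by (intro exI[of _ F]) auto
  qed
  then obtain F where F: "\<And>n. closed (F n)" "\<And>n. F n \<subseteq> A n" "\<And>n. l (A n - F n) < \<delta> n" by metis
  have "\<exists>K. compact K \<and> l {\<omega>. \<omega> i \<in> - K} < \<delta> i" for i
  proof -
    obtain K where K: "compact K" "measure (\<nu> i) (UNIV - K) < \<delta> i"
      using compact_inner_approx[OF prob_\<nu> sets_\<nu> _ \<delta>, of UNIV i i] by auto
    then show ?thesis
      using l_marginal[OF borel_comp[OF borel_compact[OF K(1)]], of i]
      by (auto simp: Compl_eq_Diff_UNIV)
  qed
  then obtain K where K: "\<And>i. compact (K i)" "\<And>i. l {\<omega>. \<omega> i \<in> - K i} < \<delta> i" by metis
  have "\<exists>w. (\<forall>m\<le>n. w \<in> F m) \<and> (\<forall>i\<le>n. w i \<in> K i)" for n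
  proof (rule ccontr)
    assume none: "\<not> ?thesis"
    have "A n \<subseteq> (\<Union>m\<in>{..n}. A m - F m) \<union> (\<Union>i\<in>{..n}. {\<omega>. \<omega> i \<in> - K i})"
    proof
      fix w assume w: "w \<in> A n"
      have "w \<in> A m" if "m \<le> n" for m using w that dec by (auto dest: decseqD)
      then show "w \<in> (\<Union>m\<in>{..n}. A m - F m) \<union> (\<Union>i\<in>{..n}. {\<omega>. \<omega> i \<in> - K i})"
        using none by auto
    qed
    then have "l (A n) \<le> l (\<Union>m\<in>{..n}. A m - F m) + l (\<Union>i\<in>{..n}. {\<omega>. \<omega> i \<in> - K i})"
      by (rule order_trans[OF l_mono l_subadditive])
    also have "\<dots> \<le> (\<Sum>m\<le>n. l (A m - F m)) + (\<Sum>i\<le>n. l {\<omega>. \<omega> i \<in> - K i})"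
      by (intro add_mono l_UN_subadditive)
    also have "\<dots> \<le> (\<Sum>m\<le>n. \<delta> m) + (\<Sum>i\<le>n. \<delta> i)"
      using F(3) K(2) by (intro add_mono sum_mono less_imp_le)
    also have "\<dots> < e" using sum\<delta>[of n] by simp
    finally show False using e(2)[of n] by simp
  qed
  then obtain s where s: "\<And>n m. m \<le> n \<Longrightarrow> s n \<in> F m" "\<And>n i. i \<le> n \<Longrightarrow> s n i \<in> K i" by metis
  obtain r w where r: "strict_mono r" "(s \<circ> r) \<longlonglongrightarrow> w"
    using diagonal_convergent_subsequence[of K s] K(1) s(2) by blast
  have "w \<in> F m" for m
  proof (rule Lim_in_closed_set[OF F(1) _ _ r(2)])
    show "\<forall>\<^sub>F n in sequentially. (s \<circ> r) n \<in> F m"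
      using seq_suble[OF r(1)] by (intro eventually_sequentiallyI[of m]) (auto intro!: s(1) intro: order_trans)
  qed simp
  then show False using F(2) empty by blast
qed

theorem coupling_measure:
  obtains M where "prob_space M" "space M = \<Omega>"
    "\<And>i. (\<lambda>\<omega>. \<omega> i) \<in> M \<rightarrow>\<^sub>M borel" "\<And>i. distr M borel (\<lambda>\<omega>. \<omega> i) = \<nu> i"
proof -
  interpret algebra \<Omega> regular by (rule regular_algebra)
  have "\<exists>\<mu> :: (nat \<Rightarrow> 'a) set \<Rightarrow> ennreal. (\<forall>A\<in>regular. \<mu> A = ennreal (l A)) \<and>
      measure_space \<Omega> (sigma_sets \<Omega> regular) \<mu>"
  proof (rule caratheodory_empty_continuous[where f="\<lambda>A. ennreal (l A)"])
    show "positive regular (\<lambda>A. ennreal (l A))" by (auto simp: positive_def l_empty)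
    show "additive regular (\<lambda>A. ennreal (l A))"
      by (auto simp: additive_def l_Un l_nonneg)
    show "(\<lambda>n. ennreal (l (A n))) \<longlonglongrightarrow> 0"
      if "range A \<subseteq> regular" "decseq A" "(\<Inter>n. A n) = {}" for A
      using tendsto_ennrealI[OF regular_empty_continuous[OF that]] by simp
  qed auto
  then obtain \<mu> :: "(nat \<Rightarrow> 'a) set \<Rightarrow> ennreal" where
    \<mu>: "\<And>A. A \<in> regular \<Longrightarrow> \<mu> A = ennreal (l A)" "measure_space \<Omega> (sigma_sets \<Omega> regular) \<mu>" by blast
  define M where "M = measure_of \<Omega> regular \<mu>"
  have space_M: "space M = \<Omega>" and sets_M: "sets M = sigma_sets \<Omega> regular"
    using space_closed by (auto simp: M_def)
  have emeasure_M: "emeasure M A = ennreal (l A)" if "A \<in> regular" for A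
  proof -
    have "emeasure M A = \<mu> A"
      using \<mu>(2) that space_closed sets_M
      by (intro emeasure_measure_of[OF M_def]) (auto simp: measure_space_def)
    then show ?thesis using \<mu>(1)[OF that] by simp
  qed
  have meas: "(\<lambda>\<omega>. \<omega> i) \<in> M \<rightarrow>\<^sub>M borel" for i
  proof (rule measurableI)
    fix A :: "'a set" assume "A \<in> sets borel"
    from coordinate_regular[OF this, of i] show "(\<lambda>\<omega>. \<omega> i) -` A \<inter> space M \<in> sets M"
      by (auto simp: space_M sets_M vimage_def Int_def conj_commute)
  qed simp
  have distr: "distr M borel (\<lambda>\<omega>. \<omega> i) = \<nu> i" for i
  proof (rule measure_eqI)
    fix A :: "'a set" assume "A \<in> sets (distr M borel (\<lambda>\<omega>. \<omega> i))"
    then have A: "A \<in> sets borel" by simp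
    interpret prob_space "\<nu> i" by (rule prob_\<nu>)
    have "emeasure (distr M borel (\<lambda>\<omega>. \<omega> i)) A = emeasure M {\<omega>\<in>\<Omega>. \<omega> i \<in> A}"
      using meas A by (subst emeasure_distr) (auto simp: space_M intro!: arg_cong[where f="emeasure M"])
    also have "\<dots> = ennreal (l {\<omega>\<in>\<Omega>. \<omega> i \<in> A})"
      by (rule emeasure_M[OF coordinate_regular[OF A]])
    also have "l {\<omega>\<in>\<Omega>. \<omega> i \<in> A} = l {\<omega>. \<omega> i \<in> A}"
      using l_Int_\<Omega>[of "{\<omega>. \<omega> i \<in> A}"] by (simp add: Int_def conj_commute)
    also have "ennreal \<dots> = emeasure (\<nu> i) A"
      by (simp add: l_marginal[OF A] emeasure_eq_measure)
    finally show "emeasure (distr M borel (\<lambda>\<omega>. \<omega> i)) A = emeasure (\<nu> i) A" .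
  qed (simp add: sets_\<nu>)
  have "prob_space M"
    using prob_space_distrD[OF meas, of 0] prob_\<nu>[of 0] by (simp add: distr)
  then show thesis using space_M meas distr by (rule that)
qed

end

theorem (in marginal_duality) coupling_exists:
  obtains M where "prob_space M" "space M = \<Omega>"
    "\<And>i. (\<lambda>\<omega>. \<omega> i) \<in> M \<rightarrow>\<^sub>M borel" "\<And>i. distr M borel (\<lambda>\<omega>. \<omega> i) = \<nu> i"
proof (rule finitely_additive_coupling)
  fix l :: "(nat \<Rightarrow> 'a) set \<Rightarrow> real"
  assume l: "\<And>A. 0 \<le> l A" "\<And>A B. A \<inter> B = {} \<Longrightarrow> l (A \<union> B) = l A + l B" "l (- \<Omega>) = 0"
    "\<And>i A. A \<in> sets borel \<Longrightarrow> l {\<omega>. \<omega> i \<in> A} = measure (\<nu> i) A"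
  interpret finitely_additive_tight \<nu> \<Omega> l
    by (rule finitely_additive_tight.intro) (fact prob_\<nu> sets_\<nu> closed_\<Omega> l)+
  show thesis by (rule coupling_measure[OF that])
qed

section \<open>The stochastic order and increasing couplings\<close>

definition stoch_le :: "'a::{topological_space, order} measure \<Rightarrow> 'a measure \<Rightarrow> bool" where
  "stoch_le \<mu> \<nu> \<longleftrightarrow> (\<forall>g\<in>borel_measurable borel. range g \<subseteq> {0..1::real} \<longrightarrow> mono g \<longrightarrow>
     (\<integral>x. g x \<partial>\<mu>) \<le> (\<integral>x. g x \<partial>\<nu>))"

lemma stoch_leD:
  "stoch_le \<mu> \<nu> \<Longrightarrow> g \<in> borel_measurable borel \<Longrightarrow> range g \<subseteq> {0..1::real} \<Longrightarrow> mono g \<Longrightarrow>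
   (\<integral>x. g x \<partial>\<mu>) \<le> (\<integral>x. g x \<partial>\<nu>)"
  by (auto simp: stoch_le_def)

lemma stoch_le_refl: "stoch_le \<mu> \<mu>"
  by (simp add: stoch_le_def)

lemma stoch_le_trans: "stoch_le \<mu> \<nu> \<Longrightarrow> stoch_le \<nu> \<rho> \<Longrightarrow> stoch_le \<mu> \<rho>"
  unfolding stoch_le_def by (meson order_trans)

definition borel_prob :: "'a::topological_space measure \<Rightarrow> bool" where
  "borel_prob \<mu> \<longleftrightarrow> prob_space \<mu> \<and> sets \<mu> = sets borel"

lemma borel_prob_measurable: "borel_prob \<mu> \<Longrightarrow> borel_measurable \<mu> = borel_measurable borel"
  unfolding borel_prob_def by (intro measurable_cong_sets) auto

lemma borel_prob_integrable:
  fixes g :: "'a::topological_space \<Rightarrow> real"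
  assumes \<mu>: "borel_prob \<mu>" and g: "g \<in> borel_measurable borel" "\<And>x. \<bar>g x\<bar> \<le> B"
  shows "integrable \<mu> g"
proof -
  interpret prob_space \<mu> using \<mu> by (simp add: borel_prob_def)
  show ?thesis using g borel_prob_measurable[OF \<mu>] by (intro integrable_const_bound[where B=B]) auto
qed

lemma stoch_le_bounded:
  fixes g :: "'a::{topological_space, order} \<Rightarrow> real"
  assumes le: "stoch_le \<mu> \<nu>" and \<mu>: "borel_prob \<mu>" and \<nu>: "borel_prob \<nu>"
    and g: "g \<in> borel_measurable borel" "mono g" "\<And>x. \<bar>g x\<bar> \<le> B"
  shows "(\<integral>x. g x \<partial>\<mu>) \<le> (\<integral>x. g x \<partial>\<nu>)"
proof -
  define C where "C = B + 1"
  have B: "0 \<le> B" using g(3) abs_ge_zero order_trans by blast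
  then have C: "0 < C" by (simp add: C_def)
  have bnd: "- C \<le> g x" "g x \<le> C" for x using g(3)[of x] by (auto simp: C_def)
  define h where "h x = (g x + C) / (2 * C)" for x
  have "h \<in> borel_measurable borel" unfolding h_def using g(1) by measurable
  moreover have "range h \<subseteq> {0..1}"
    using bnd C by (auto simp: h_def field_simps; smt (verit))
  moreover have "mono h" using g(2) C by (auto simp: h_def mono_def divide_right_mono)
  ultimately have "(\<integral>x. h x \<partial>\<mu>) \<le> (\<integral>x. h x \<partial>\<nu>)" by (rule stoch_leD[OF le])
  moreover have "(\<integral>x. h x \<partial>\<kappa>) = ((\<integral>x. g x \<partial>\<kappa>) + C) / (2 * C)" if \<kappa>: "borel_prob \<kappa>" for \<kappa>
  proof -
    interpret prob_space \<kappa> using \<kappa> by (simp add: borel_prob_def)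
    show ?thesis unfolding h_def
      using borel_prob_integrable[OF \<kappa> g(1,3)] by (simp add: prob_space)
  qed
  ultimately show ?thesis using \<mu> \<nu> C by (simp add: divide_le_cancel)
qed

lemma stoch_le_distr:
  fixes Y Z :: "'b \<Rightarrow> 'a::{topological_space, order}"
  assumes M: "prob_space M" and [measurable]: "Y \<in> borel_measurable M" "Z \<in> borel_measurable M"
    and le: "\<And>\<omega>. \<omega> \<in> space M \<Longrightarrow> Y \<omega> \<le> Z \<omega>"
  shows "stoch_le (distr M borel Y) (distr M borel Z)"
  unfolding stoch_le_def
proof (intro ballI impI)
  fix g :: "'a \<Rightarrow> real"
  assume g[measurable]: "g \<in> borel_measurable borel" and range: "range g \<subseteq> {0..1}" and "mono g"
  interpret prob_space M by fact
  have g01: "0 \<le> g x" "g x \<le> 1" for x using range by (auto simp: subset_iff)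
  have "(\<integral>\<omega>. g (Y \<omega>) \<partial>M) \<le> (\<integral>\<omega>. g (Z \<omega>) \<partial>M)"
    using g01 le \<open>mono g\<close>
    by (intro integral_mono integrable_const_bound[where B=1]) (auto simp: mono_def)
  then show "(\<integral>x. g x \<partial>distr M borel Y) \<le> (\<integral>x. g x \<partial>distr M borel Z)"
    by (simp add: integral_distr)
qed

lemma closed_order_lim:
  fixes x y :: "nat \<Rightarrow> 'a::{metric_space, order}"
  assumes "closed_order TYPE('a)" "x \<longlonglongrightarrow> a" "y \<longlonglongrightarrow> b" "\<And>n. x n \<le> y n"
  shows "a \<le> b"
proof -
  have "(a, b) \<in> {(x, y). x \<le> y}"
    using assms(1,4) tendsto_Pair[OF assms(2,3)]
    by (intro Lim_in_closed_set[of _ "\<lambda>n. (x n, y n)" sequentially]) (auto simp: closed_order_def)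
  then show ?thesis by simp
qed

text \<open>Upward closures of general Borel sets need not be Borel; compactness is what makes the lower
envelopes below measurable.\<close>

lemma closed_upward_closure:
  fixes K :: "'a::{metric_space, order} set"
  assumes order: "closed_order TYPE('a)" and K: "compact K"
  shows "closed {y. \<exists>x\<in>K. x \<le> y}"
  unfolding closed_sequential_limits
proof safe
  fix y b assume y: "\<forall>n::nat. y n \<in> {y. \<exists>x\<in>K. x \<le> y}" and lim: "y \<longlonglongrightarrow> b"
  then have "\<exists>x. \<forall>n. x n \<in> K \<and> x n \<le> y n" by (intro choice) auto
  then obtain x where x: "\<And>n. x n \<in> K" "\<And>n. x n \<le> y n" by blast
  obtain a r where r: "a \<in> K" "strict_mono r" "(x \<circ> r) \<longlonglongrightarrow> a"
    using K[unfolded compact_def, rule_format, of x] x by blast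
  have "a \<le> b"
    using x(2) by (intro closed_order_lim[OF order r(3) LIMSEQ_subseq_LIMSEQ[OF lim r(2)]]) auto
  with r(1) show "\<exists>x\<in>K. x \<le> b" by blast
qed

lemma closed_Ici:
  fixes a :: "'a::{topological_space, order}"
  assumes "closed_order TYPE('a)" shows "closed {x. a \<le> x}"
proof -
  have "closed ((\<lambda>x. (a, x)) -` {(x :: 'a, y). x \<le> y})"
    using assms by (intro closed_vimage) (auto simp: closed_order_def intro!: continuous_intros)
  then show ?thesis by (simp add: vimage_def)
qed

lemma closed_Iic:
  fixes b :: "'a::{topological_space, order}"
  assumes "closed_order TYPE('a)" shows "closed {y. y \<le> b}"
proof -
  have "closed ((\<lambda>y. (y, b)) -` {(x :: 'a, y). x \<le> y})"
    using assms by (intro closed_vimage) (auto simp: closed_order_def intro!: continuous_intros)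
  then show ?thesis by (simp add: vimage_def)
qed

text \<open>The largest decreasing function below \<open>f\<close> on \<open>K\<close> with upper bound \<open>C\<close>; the value \<open>C\<close>, at least
\<open>sup f\<close> in all uses, stands for the infimum over the empty set.\<close>

definition lower_envelope :: "'a::order set \<Rightarrow> real \<Rightarrow> ('a \<Rightarrow> real) \<Rightarrow> 'a \<Rightarrow> real" where
  "lower_envelope K C f y = (if \<exists>x\<in>K. x \<le> y then INF x\<in>{x\<in>K. x \<le> y}. f x else C)"

context
  fixes K :: "'a::{metric_space, order} set" and f :: "'a \<Rightarrow> real" and B C :: real
  assumes bound: "\<And>x. \<bar>f x\<bar> \<le> B" and BC: "B \<le> C"
begin

lemma envelope_le: "x \<in> K \<Longrightarrow> x \<le> y \<Longrightarrow> lower_envelope K C f y \<le> f x"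
  using bound unfolding lower_envelope_def
  by (auto intro!: cINF_lower bdd_belowI[of _ "- B"] simp: abs_le_iff minus_le_iff)

lemma envelope_greatest:
  "\<exists>x\<in>K. x \<le> y \<Longrightarrow> (\<And>x. x \<in> K \<Longrightarrow> x \<le> y \<Longrightarrow> c \<le> f x) \<Longrightarrow> c \<le> lower_envelope K C f y"
  unfolding lower_envelope_def by (auto intro!: cINF_greatest)

lemma envelope_le_C: "lower_envelope K C f y \<le> C"
proof (cases "\<exists>x\<in>K. x \<le> y")
  case True
  then obtain x where "x \<in> K" "x \<le> y" by blast
  from envelope_le[OF this] bound[of x] BC show ?thesis by linarith
qed (auto simp: lower_envelope_def)

lemma envelope_ge: "- B \<le> lower_envelope K C f y"
proof (cases "\<exists>x\<in>K. x \<le> y")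
  case True
  show ?thesis
  proof (rule envelope_greatest[OF True])
    fix x show "- B \<le> f x" using bound[of x] by linarith
  qed
next
  case False
  have "- B \<le> C" using BC bound[of y] by linarith
  with False show ?thesis by (auto simp: lower_envelope_def)
qed

lemma envelope_antimono: "y \<le> z \<Longrightarrow> lower_envelope K C f z \<le> lower_envelope K C f y"
proof (cases "\<exists>x\<in>K. x \<le> y")
  case True
  assume "y \<le> z"
  then show ?thesis by (intro envelope_greatest[OF True] envelope_le) auto
next
  case False
  then have "lower_envelope K C f y = C" by (auto simp: lower_envelope_def)
  then show ?thesis by (simp add: envelope_le_C)
qed

lemma envelope_bounded_lsc:
  assumes order: "closed_order TYPE('a)" and K: "compact K" and f: "bounded_lsc f"
  shows "bounded_lsc (lower_envelope K C f)"
proof -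
  let ?h = "lower_envelope K C f"
  have "closed {y. ?h y \<le> c}" for c
  proof (cases "C \<le> c")
    case True
    then have "{y. ?h y \<le> c} = UNIV" using envelope_le_C order_trans by auto
    then show ?thesis by simp
  next
    case False
    have "{y. ?h y \<le> c} = (\<Inter>d\<in>{c<..}. {y. \<exists>x\<in>K \<inter> {x. f x \<le> d}. x \<le> y})"
    proof safe
      fix y d assume y: "?h y \<le> c" and d: "c < d"
      have ex: "\<exists>x\<in>K. x \<le> y" using y False by (auto simp: lower_envelope_def split: if_splits)
      show "\<exists>x\<in>K \<inter> {x. f x \<le> d}. x \<le> y"
      proof (rule ccontr)
        assume "\<not> ?thesis"
        then have "d \<le> ?h y" by (intro envelope_greatest[OF ex]) auto
        with y d show False by simp
      qed
    next
      fix y assume y: "y \<in> (\<Inter>d\<in>{c<..}. {y. \<exists>x\<in>K \<inter> {x. f x \<le> d}. x \<le> y})"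
      show "?h y \<le> c"
      proof (rule dense_ge)
        fix d assume "c < d"
        with y obtain x where "x \<in> K" "f x \<le> d" "x \<le> y" by auto
        with envelope_le[of x y] show "?h y \<le> d" by simp
      qed
    qed
    moreover have "closed (\<Inter>d\<in>{c<..}. {y. \<exists>x\<in>K \<inter> {x. f x \<le> d}. x \<le> y})"
      using f K by (intro closed_INT ballI closed_upward_closure[OF order] compact_Int_closed)
        (auto simp: bounded_lsc_def)
    ultimately show ?thesis by simp
  qed
  moreover have "bounded (range ?h)"
    using envelope_le_C envelope_ge BC
    by (auto simp: bounded_iff abs_le_iff intro!: exI[of _ C]) (smt (verit))
  ultimately show ?thesis by (simp add: bounded_lsc_def)
qed

end

text \<open>The envelope decreases, so its integral is smaller under the larger measure \<open>\<nu>\<close>; under \<open>\<mu>\<close> it is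
compared with \<open>f\<close> itself, which fails to dominate it only off \<open>K\<close>.\<close>

lemma envelope_integral_le:
  fixes f :: "'a::{polish_space, order} \<Rightarrow> real"
  assumes order: "closed_order TYPE('a)" and \<mu>: "borel_prob \<mu>" and \<nu>: "borel_prob \<nu>" and le: "stoch_le \<mu> \<nu>"
    and K: "compact K" and f: "bounded_lsc f" and bound: "\<And>x. \<bar>f x\<bar> \<le> B" and BC: "B \<le> C"
  shows "(\<integral>x. lower_envelope K C f x \<partial>\<nu>) \<le> (\<integral>x. f x \<partial>\<mu>) + (B + C) * measure \<mu> (- K)"
proof -
  let ?h = "lower_envelope K C f"
  interpret prob_space \<mu> using \<mu> by (simp add: borel_prob_def)
  have h: "bounded_lsc ?h" by (rule envelope_bounded_lsc[OF bound BC order K f])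
  have hm: "?h \<in> borel_measurable borel" by (rule bounded_lsc_measurable[OF h])
  have hB: "\<bar>?h x\<bar> \<le> C" for x
    using envelope_le_C[of f B C K x, OF bound BC] envelope_ge[of f B C K x, OF bound BC] BC by linarith
  have "(\<integral>x. - ?h x \<partial>\<mu>) \<le> (\<integral>x. - ?h x \<partial>\<nu>)"
    by (rule stoch_le_bounded[OF le \<mu> \<nu>, where B=C])
      (use hm hB envelope_antimono[OF bound BC] in \<open>auto simp: mono_def\<close>)
  then have "(\<integral>x. ?h x \<partial>\<nu>) \<le> (\<integral>x. ?h x \<partial>\<mu>)" by simp
  also have "\<dots> \<le> (\<integral>x. f x + (B + C) * indicator (- K) x \<partial>\<mu>)"
  proof (rule integral_mono)
    show "integrable \<mu> ?h" by (rule borel_prob_integrable[OF \<mu> hm hB])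
    have "- K \<in> sets \<mu>" using \<mu> K by (simp add: borel_prob_def borel_comp borel_compact)
    then show "integrable \<mu> (\<lambda>x. f x + (B + C) * indicator (- K) x)"
      using borel_prob_integrable[OF \<mu> bounded_lsc_measurable[OF f] bound]
      by (intro Bochner_Integration.integrable_add integrable_mult_right) (auto simp: emeasure_eq_measure)
    show "?h x \<le> f x + (B + C) * indicator (- K) x" for x
    proof (cases "x \<in> K")
      case True
      then show ?thesis using envelope_le[OF bound BC True order_refl] by simp
    next
      case False
      then show ?thesis using hB[of x] bound[of x] by (auto simp: abs_le_iff)
    qed
  qed
  also have "\<dots> = (\<integral>x. f x \<partial>\<mu>) + (B + C) * measure \<mu> (- K)"
  proof -
    have "- K \<in> sets \<mu>" using \<mu> K by (simp add: borel_prob_def borel_comp borel_compact)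
    moreover from this have "- K \<inter> space \<mu> = - K" using sets.sets_into_space by blast
    ultimately show ?thesis
      using borel_prob_integrable[OF \<mu> bounded_lsc_measurable[OF f] bound]
      by (subst Bochner_Integration.integral_add) (auto simp: emeasure_eq_measure)
  qed
  finally show ?thesis .
qed

text \<open>Induction on the length of the chain eliminates the lowest point: \<open>f 0\<close> is replaced by its lower
envelope over a large compact set, now a function of the next point.  Restricting to a compact
set keeps the envelope lower semicontinuous, hence Borel, and costs an arbitrarily small amount.\<close>

lemma chain_duality:
  fixes \<nu> :: "nat \<Rightarrow> 'a::{polish_space, order} measure"
  assumes order: "closed_order TYPE('a)"
    and "\<And>i. borel_prob (\<nu> i)" "\<And>i. stoch_le (\<nu> i) (\<nu> (Suc i))" "\<And>i. bounded_lsc (f i)"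
    and "\<And>\<omega>. (\<And>i. i < n \<Longrightarrow> \<omega> i \<le> \<omega> (Suc i)) \<Longrightarrow> c \<le> (\<Sum>i\<le>n. f i (\<omega> i))"
  shows "c \<le> (\<Sum>i\<le>n. \<integral>x. f i x \<partial>\<nu> i)"
  using assms(2-)
proof (induction n arbitrary: \<nu> f)
  case 0
  interpret prob_space "\<nu> 0" using 0(1) by (simp add: borel_prob_def)
  have "integrable (\<nu> 0) (f 0)"
    using 0(1,3) by (intro bounded_lsc_integrable) (auto simp: borel_prob_def finite_measure)
  moreover have "c \<le> f 0 x" for x using 0(4)[of "\<lambda>_. x"] by simp
  ultimately show ?case by (auto intro: integral_ge_const)
next
  case (Suc n)
  note \<nu> = Suc.prems(1) and le = Suc.prems(2) and f = Suc.prems(3) and sum_ge = Suc.prems(4)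
  have "\<exists>B. \<forall>x. \<bar>f i x\<bar> \<le> B" for i using bounded_lsc_bound[OF f] by metis
  then obtain B where B: "\<And>i x. \<bar>f i x\<bar> \<le> B i" by metis
  have B0: "0 \<le> B i" for i using B[of i] abs_ge_zero order_trans by blast
  \<comment> \<open>So large that the bound \<open>c\<close> holds trivially when no point of \<open>K\<close> lies below the next point.\<close>
  define C where "C = B 0 + \<bar>c\<bar> + (\<Sum>i\<le>n. B (Suc i))"
  have BC: "B 0 \<le> C" using B0 by (auto simp: C_def intro!: add_nonneg_nonneg sum_nonneg)
  show ?case
  proof (rule field_le_epsilon)
    fix e :: real assume e: "0 < e"
    have "0 < B 0 + C + 1" using B0[of 0] BC by linarith
    then obtain K where K: "compact K" "measure (\<nu> 0) (UNIV - K) < e / (B 0 + C + 1)"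
      using compact_inner_approx[of "\<nu> 0" UNIV "e / (B 0 + C + 1)"] \<nu>[of 0] e
      by (auto simp: borel_prob_def)
    define h where "h = lower_envelope K C (f 0)"
    have h: "bounded_lsc h"
      unfolding h_def by (rule envelope_bounded_lsc[OF B BC order K(1) f])
    define g where "g = (\<lambda>i x. f (Suc i) x + (if i = 0 then h x else 0))"
    have sum_g: "(\<Sum>i\<le>n. g i (\<omega> i)) = (\<Sum>i\<le>n. f (Suc i) (\<omega> i)) + h (\<omega> 0)" for \<omega>
      by (simp add: g_def sum.distrib sum.delta)
    have "c \<le> (\<Sum>i\<le>n. \<integral>x. g i x \<partial>\<nu> (Suc i))"
    proof (rule Suc.IH)
      show "bounded_lsc (g i)" for i
        unfolding g_def using f h by (cases "i = 0") (auto intro!: bounded_lsc_add bounded_lsc_const)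
      fix \<omega> :: "nat \<Rightarrow> 'a" assume \<omega>: "\<And>i. i < n \<Longrightarrow> \<omega> i \<le> \<omega> (Suc i)"
      have "c - (\<Sum>i\<le>n. f (Suc i) (\<omega> i)) \<le> h (\<omega> 0)"
      proof (cases "\<exists>x\<in>K. x \<le> \<omega> 0")
        case True
        show ?thesis unfolding h_def
        proof (rule envelope_greatest[OF B BC True])
          fix x assume x: "x \<le> \<omega> 0"
          have "c \<le> (\<Sum>i\<le>Suc n. f i (case_nat x \<omega> i))"
            using \<omega> x by (intro sum_ge) (auto split: nat.split)
          then show "c - (\<Sum>i\<le>n. f (Suc i) (\<omega> i)) \<le> f 0 x"
            unfolding sum.atMost_Suc_shift by simp
        qed
      next
        case False
        have "- (\<Sum>i\<le>n. f (Suc i) (\<omega> i)) \<le> (\<Sum>i\<le>n. B (Suc i))"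
          unfolding sum_negf[symmetric] using B by (intro sum_mono) (auto simp: abs_le_iff)
        then have "c - (\<Sum>i\<le>n. f (Suc i) (\<omega> i)) \<le> C" using B0[of 0] by (simp add: C_def)
        with False show ?thesis by (auto simp: h_def lower_envelope_def)
      qed
      then show "c \<le> (\<Sum>i\<le>n. g i (\<omega> i))" by (simp add: sum_g)
    qed (use \<nu> le in auto)
    also have "(\<Sum>i\<le>n. \<integral>x. g i x \<partial>\<nu> (Suc i)) = (\<Sum>i\<le>n. \<integral>x. f (Suc i) x \<partial>\<nu> (Suc i)) + (\<integral>x. h x \<partial>\<nu> 1)"
    proof -
      have int: "integrable (\<nu> j) k" if "bounded_lsc k" for j k
        using \<nu> that by (intro bounded_lsc_integrable) (auto simp: borel_prob_def prob_space.finite_measure)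
      have "(\<integral>x. g i x \<partial>\<nu> (Suc i)) = (\<integral>x. f (Suc i) x \<partial>\<nu> (Suc i)) + (if i = 0 then \<integral>x. h x \<partial>\<nu> 1 else 0)" for i
        using int[OF f] int[OF h] by (simp add: g_def)
      then show ?thesis by (simp add: sum.distrib sum.delta)
    qed
    also have "(\<integral>x. h x \<partial>\<nu> 1) \<le> (\<integral>x. f 0 x \<partial>\<nu> 0) + (B 0 + C) * measure (\<nu> 0) (- K)"
      unfolding h_def using envelope_integral_le[OF order \<nu> \<nu> le K(1) f B BC, of 0] by simp
    also have "(B 0 + C) * measure (\<nu> 0) (- K) \<le> e"
    proof -
      have "(B 0 + C) * measure (\<nu> 0) (- K) \<le> (B 0 + C + 1) * measure (\<nu> 0) (- K)"
        by (intro mult_right_mono) auto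
      also have "\<dots> \<le> e" using K(2) \<open>0 < B 0 + C + 1\<close> by (simp add: Compl_eq_Diff_UNIV field_simps)
      finally show ?thesis .
    qed
    finally show "c \<le> (\<Sum>i\<le>Suc n. \<integral>x. f i x \<partial>\<nu> i) + e"
      unfolding sum.atMost_Suc_shift by simp
  qed
qed

text \<open>Strassen's theorem for an increasing sequence with an upper bound.  Coordinate \<open>0\<close> of a path
carries the bound \<open>\<rho>\<close> and coordinate \<open>i + 1\<close> the law \<open>\<mu> i\<close>.\<close>

lemma increasing_coupling:
  fixes \<mu> :: "nat \<Rightarrow> 'a::{polish_space, order} measure"
  assumes order: "closed_order TYPE('a)"
    and \<mu>: "\<And>i. borel_prob (\<mu> i)" "\<And>i. stoch_le (\<mu> i) (\<mu> (Suc i))"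
    and \<rho>: "borel_prob \<rho>" "\<And>i. stoch_le (\<mu> i) \<rho>"
  obtains M :: "(nat \<Rightarrow> 'a) measure" where "prob_space M"
    "\<And>\<omega> i. \<omega> \<in> space M \<Longrightarrow> \<omega> (Suc i) \<le> \<omega> (Suc (Suc i)) \<and> \<omega> (Suc i) \<le> \<omega> 0"
    "\<And>i. (\<lambda>\<omega>. \<omega> i) \<in> M \<rightarrow>\<^sub>M borel" "distr M borel (\<lambda>\<omega>. \<omega> 0) = \<rho>"
    "\<And>i. distr M borel (\<lambda>\<omega>. \<omega> (Suc i)) = \<mu> i"
proof -
  define \<Omega> :: "(nat \<Rightarrow> 'a) set" where
    "\<Omega> = {\<omega>. \<forall>i. \<omega> (Suc i) \<le> \<omega> (Suc (Suc i)) \<and> \<omega> (Suc i) \<le> \<omega> 0}"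
  have cl: "closed {\<omega> :: nat \<Rightarrow> 'a. \<omega> i \<le> \<omega> j}" for i j
  proof -
    have "continuous_on UNIV (\<lambda>\<omega> :: nat \<Rightarrow> 'a. (\<omega> i, \<omega> j))"
      by (intro continuous_on_Pair continuous_on_product_then_coordinatewise[OF continuous_on_id])
    then have "closed ((\<lambda>\<omega> :: nat \<Rightarrow> 'a. (\<omega> i, \<omega> j)) -` {(x, y). x \<le> y})"
      using order by (intro closed_vimage) (auto simp: closed_order_def)
    then show ?thesis by (simp add: vimage_def)
  qed
  interpret marginal_duality "case_nat \<rho> \<mu>" \<Omega>
  proof (rule marginal_duality.intro)
    show "closed \<Omega>"
      unfolding \<Omega>_def by (intro closed_Collect_all closed_Collect_conj cl)
    show "prob_space (case_nat \<rho> \<mu> i)" "sets (case_nat \<rho> \<mu> i) = sets borel" for i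
      using \<mu>(1) \<rho>(1) by (auto simp: borel_prob_def split: nat.split)
    fix n f c
    assume f: "\<And>i :: nat. bounded_lsc (f i)" and c: "\<And>\<omega> :: nat \<Rightarrow> 'a. \<omega> \<in> \<Omega> \<Longrightarrow> c \<le> (\<Sum>i<n. f i (\<omega> i))"
    show "c \<le> (\<Sum>i<n. \<integral>x. f i x \<partial>case_nat \<rho> \<mu> i)"
    proof (cases n)
      case 0
      then show ?thesis using c[of "\<lambda>_. undefined"] by (simp add: \<Omega>_def)
    next
      case (Suc m)
      \<comment> \<open>In a finite chain the bound comes last, after \<open>m\<close> members of the sequence.\<close>
      define \<nu> where "\<nu> = (\<lambda>i. if i < m then \<mu> i else \<rho>)"
      define g where "g = (\<lambda>i. if i < m then f (Suc i) else f 0)"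
      have "c \<le> (\<Sum>i\<le>m. \<integral>x. g i x \<partial>\<nu> i)"
      proof (rule chain_duality[OF order])
        show "borel_prob (\<nu> i)" "stoch_le (\<nu> i) (\<nu> (Suc i))" "bounded_lsc (g i)" for i
          using \<mu> \<rho> f by (auto simp: \<nu>_def g_def stoch_le_refl)
        fix \<omega> :: "nat \<Rightarrow> 'a" assume step: "\<And>i. i < m \<Longrightarrow> \<omega> i \<le> \<omega> (Suc i)"
        have mono: "i \<le> j \<Longrightarrow> j \<le> m \<Longrightarrow> \<omega> i \<le> \<omega> j" for i j
          by (induction j rule: dec_induct) (auto intro: order_trans[OF _ step])
        \<comment> \<open>A finite chain becomes a path by repeating its last point below the bound; for \<open>m = 0\<close> that is the bound itself.\<close>
        define w where "w = case_nat (\<omega> m) (\<lambda>i. \<omega> (min i (m - 1)))"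
        have "w \<in> \<Omega>" by (auto simp: \<Omega>_def w_def intro!: mono)
        then have "c \<le> (\<Sum>i<Suc m. f i (w i))" using c[of w] Suc by simp
        also have "\<dots> = f 0 (\<omega> m) + (\<Sum>i<m. f (Suc i) (\<omega> i))"
          unfolding sum.lessThan_Suc_shift by (auto simp: w_def min_def intro!: sum.cong)
        also have "\<dots> = (\<Sum>i\<le>m. g i (\<omega> i))"
          by (simp add: g_def lessThan_Suc_atMost[symmetric])
        finally show "c \<le> (\<Sum>i\<le>m. g i (\<omega> i))" .
      qed
      also have "(\<Sum>i\<le>m. \<integral>x. g i x \<partial>\<nu> i) = (\<Sum>i<n. \<integral>x. f i x \<partial>case_nat \<rho> \<mu> i)"
        unfolding Suc sum.lessThan_Suc_shift
        by (simp add: g_def \<nu>_def lessThan_Suc_atMost[symmetric])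
      finally show ?thesis .
    qed
  qed
  show thesis
  proof (rule coupling_exists)
    fix M assume M: "prob_space M" "space M = \<Omega>" "\<And>i. (\<lambda>\<omega>. \<omega> i) \<in> M \<rightarrow>\<^sub>M borel"
      "\<And>i. distr M borel (\<lambda>\<omega>. \<omega> i) = case_nat \<rho> \<mu> i"
    show thesis
      by (rule that[OF M(1)]) (use M(2-3) M(4)[of 0] M(4)[of "Suc i" for i] in \<open>auto simp: \<Omega>_def\<close>)
  qed
qed

section \<open>Limits of stochastically increasing sequences\<close>

text \<open>Test functions for the bounded Lipschitz metric.  Only differences are restricted, because adding
a constant does not affect the difference of two integrals against probability measures.\<close>

definition short_maps :: "('a::metric_space \<Rightarrow> real) set" where
  "short_maps = {f. \<forall>x y. \<bar>f x - f y\<bar> \<le> min 1 (dist x y)}"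

definition bl_dist :: "'a::metric_space measure \<Rightarrow> 'a measure \<Rightarrow> real" where
  "bl_dist \<mu> \<nu> = (SUP f\<in>short_maps. \<bar>(\<integral>x. f x \<partial>\<mu>) - (\<integral>x. f x \<partial>\<nu>)\<bar>)"

lemma short_maps_nonempty: "short_maps \<noteq> {}"
proof -
  have "(\<lambda>x. 0) \<in> short_maps" by (simp add: short_maps_def)
  then show ?thesis by blast
qed

lemma short_maps_diff:
  assumes "f \<in> short_maps" shows "\<bar>f x - f y\<bar> \<le> 1" "\<bar>f x - f y\<bar> \<le> dist x y"
proof -
  have "\<bar>f x - f y\<bar> \<le> min 1 (dist x y)" using assms by (simp add: short_maps_def)
  then show "\<bar>f x - f y\<bar> \<le> 1" "\<bar>f x - f y\<bar> \<le> dist x y" by auto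
qed

lemma short_maps_measurable:
  assumes "f \<in> short_maps" shows "f \<in> borel_measurable borel"
proof -
  have "1-lipschitz_on UNIV f"
    using assms by (intro lipschitz_onI) (auto simp: dist_real_def short_maps_diff(2))
  then show ?thesis
    by (intro borel_measurable_continuous_onI lipschitz_on_continuous_on)
qed

lemma short_maps_bound:
  assumes "f \<in> short_maps" shows "\<bar>f x\<bar> \<le> \<bar>f a\<bar> + 1"
  using short_maps_diff(1)[OF assms, of x a] by linarith

lemma short_maps_integrable:
  "borel_prob \<mu> \<Longrightarrow> f \<in> short_maps \<Longrightarrow> integrable \<mu> f"
  by (rule borel_prob_integrable[OF _ short_maps_measurable short_maps_bound])

lemma short_maps_integral_diff:
  assumes \<mu>: "borel_prob \<mu>" and \<nu>: "borel_prob \<nu>" and f: "f \<in> short_maps"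
  shows "\<bar>(\<integral>x. f x \<partial>\<mu>) - (\<integral>x. f x \<partial>\<nu>)\<bar> \<le> 2"
proof -
  have *: "\<bar>(\<integral>x. f x \<partial>\<kappa>) - f a\<bar> \<le> 1" if \<kappa>: "borel_prob \<kappa>" for \<kappa> a
  proof -
    interpret prob_space \<kappa> using \<kappa> by (simp add: borel_prob_def)
    have fa: "f a - 1 \<le> f x" "f x \<le> f a + 1" for x
      using short_maps_diff(1)[OF f, of x a] by linarith+
    have "f a - 1 \<le> (\<integral>x. f x \<partial>\<kappa>)"
      by (rule integral_ge_const[OF short_maps_integrable[OF \<kappa> f]]) (use fa in auto)
    moreover have "(\<integral>x. f x \<partial>\<kappa>) \<le> f a + 1"
      by (rule integral_le_const[OF short_maps_integrable[OF \<kappa> f]]) (use fa in auto)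
    ultimately show ?thesis by linarith
  qed
  show ?thesis using *[OF \<mu>, of undefined] *[OF \<nu>, of undefined] by linarith
qed

lemma bl_dist_bdd:
  "borel_prob \<mu> \<Longrightarrow> borel_prob \<nu> \<Longrightarrow> bdd_above ((\<lambda>f. \<bar>(\<integral>x. f x \<partial>\<mu>) - (\<integral>x. f x \<partial>\<nu>)\<bar>) ` short_maps)"
  using short_maps_integral_diff by (intro bdd_aboveI[of _ 2]) auto

lemma bl_dist_upper:
  "borel_prob \<mu> \<Longrightarrow> borel_prob \<nu> \<Longrightarrow> f \<in> short_maps \<Longrightarrow>
   \<bar>(\<integral>x. f x \<partial>\<mu>) - (\<integral>x. f x \<partial>\<nu>)\<bar> \<le> bl_dist \<mu> \<nu>"
  unfolding bl_dist_def by (rule cSUP_upper[OF _ bl_dist_bdd])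

lemma bl_dist_least:
  "(\<And>f. f \<in> short_maps \<Longrightarrow> \<bar>(\<integral>x. f x \<partial>\<mu>) - (\<integral>x. f x \<partial>\<nu>)\<bar> \<le> c) \<Longrightarrow> bl_dist \<mu> \<nu> \<le> c"
  unfolding bl_dist_def by (intro cSUP_least short_maps_nonempty)

lemma bl_dist_le_2: "borel_prob \<mu> \<Longrightarrow> borel_prob \<nu> \<Longrightarrow> bl_dist \<mu> \<nu> \<le> 2"
  by (intro bl_dist_least short_maps_integral_diff)

lemma bl_dist_nonneg: "borel_prob \<mu> \<Longrightarrow> borel_prob \<nu> \<Longrightarrow> 0 \<le> bl_dist \<mu> \<nu>"
proof -
  assume "borel_prob \<mu>" "borel_prob \<nu>"
  from bl_dist_upper[OF this, of "\<lambda>_. 0"] show ?thesis by (simp add: short_maps_def)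
qed

lemma bl_dist_sym: "bl_dist \<mu> \<nu> = bl_dist \<nu> \<mu>"
  unfolding bl_dist_def by (simp add: abs_minus_commute)

lemma bl_dist_triangle:
  assumes "borel_prob \<mu>" "borel_prob \<nu>" "borel_prob \<rho>"
  shows "bl_dist \<mu> \<rho> \<le> bl_dist \<mu> \<nu> + bl_dist \<nu> \<rho>"
proof (rule bl_dist_least)
  fix f :: "'a \<Rightarrow> real" assume f: "f \<in> short_maps"
  show "\<bar>(\<integral>x. f x \<partial>\<mu>) - (\<integral>x. f x \<partial>\<rho>)\<bar> \<le> bl_dist \<mu> \<nu> + bl_dist \<nu> \<rho>"
    using bl_dist_upper[OF assms(1,2) f] bl_dist_upper[OF assms(2,3) f] by linarith
qed

lemma infdist_cutoff_tendsto:
  fixes C :: "'a::metric_space set"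
  assumes "closed C" "C \<noteq> {}"
  shows "(\<lambda>n. real (Suc n) * min (1 / real (Suc n)) (infdist x C)) \<longlonglongrightarrow> indicator (- C) x"
proof (cases "x \<in> C")
  case True
  then show ?thesis by simp
next
  case False
  then have pos: "0 < infdist x C"
    using assms in_closed_iff_infdist_zero[of C x] infdist_nonneg[of x C] by force
  obtain N where N: "inverse (real (Suc N)) < infdist x C" using reals_Archimedean[OF pos] by blast
  have "real (Suc n) * min (1 / real (Suc n)) (infdist x C) = 1" if "N \<le> n" for n
  proof -
    have "1 / real (Suc n) \<le> inverse (real (Suc N))" using that by (simp add: divide_simps)
    with N show ?thesis by (simp add: min_def)
  qed
  then have "\<forall>\<^sub>F n in sequentially. real (Suc n) * min (1 / real (Suc n)) (infdist x C) = 1"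
    by (auto simp: eventually_sequentially)
  then show ?thesis using False by (simp add: tendsto_eventually)
qed

text \<open>The indicator of an open set is the limit of multiples of the test functions
\<open>min (1 / n) (infdist x C)\<close>, where \<open>C\<close> is the complement.\<close>

lemma bl_dist_zero_imp_eq:
  fixes \<mu> \<nu> :: "'a::metric_space measure"
  assumes \<mu>: "borel_prob \<mu>" and \<nu>: "borel_prob \<nu>" and zero: "bl_dist \<mu> \<nu> = 0"
  shows "\<mu> = \<nu>"
proof -
  interpret \<mu>: prob_space \<mu> using \<mu> by (simp add: borel_prob_def)
  interpret \<nu>: prob_space \<nu> using \<nu> by (simp add: borel_prob_def)
  have space: "space \<mu> = UNIV" "space \<nu> = UNIV"
    using \<mu> \<nu> by (auto simp: borel_prob_def dest: sets_eq_imp_space_eq)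
  have eq: "(\<integral>x. f x \<partial>\<mu>) = (\<integral>x. f x \<partial>\<nu>)" if "f \<in> short_maps" for f
    using bl_dist_upper[OF \<mu> \<nu> that] zero by simp
  have open_eq: "measure \<mu> U = measure \<nu> U" if U: "open U" for U
  proof (cases "U = UNIV")
    case True
    then show ?thesis using \<mu>.prob_space \<nu>.prob_space space by simp
  next
    case False
    define g where "g n x = min (1 / real (Suc n)) (infdist x (- U))" for n x
    have g: "g n \<in> short_maps" for n
    proof -
      have "\<bar>g n x - g n y\<bar> \<le> min 1 (dist x y)" for x y
      proof -
        have "\<bar>g n x - g n y\<bar> \<le> 1 / real (Suc n)"
          using infdist_nonneg[of x "- U"] infdist_nonneg[of y "- U"] by (auto simp: g_def min_def)
        also have "\<dots> \<le> 1" by simp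
        finally have "\<bar>g n x - g n y\<bar> \<le> 1" .
        moreover have "\<bar>g n x - g n y\<bar> \<le> \<bar>infdist x (- U) - infdist y (- U)\<bar>"
          by (auto simp: g_def min_def)
        ultimately show ?thesis using infdist_triangle_abs[of x "- U" y] by simp
      qed
      then show ?thesis by (simp add: short_maps_def)
    qed
    have lim: "(\<lambda>n. real (Suc n) * g n x) \<longlonglongrightarrow> indicator U x" for x
      using infdist_cutoff_tendsto[of "- U" x] U False by (auto simp: g_def closed_Compl)
    have bound: "\<bar>real (Suc n) * g n x\<bar> \<le> 1" for n x
    proof -
      have "0 \<le> g n x" "g n x \<le> 1 / real (Suc n)" by (auto simp: g_def infdist_nonneg)
      then show ?thesis by (simp add: abs_mult field_simps)
    qed
    have conv: "(\<lambda>n. \<integral>x. real (Suc n) * g n x \<partial>\<kappa>) \<longlonglongrightarrow> measure \<kappa> U" if \<kappa>: "borel_prob \<kappa>" for \<kappa>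
    proof -
      interpret prob_space \<kappa> using \<kappa> by (simp add: borel_prob_def)
      have Us: "U \<in> sets \<kappa>" using U \<kappa> by (simp add: borel_prob_def)
      have "(\<lambda>n. \<integral>x. real (Suc n) * g n x \<partial>\<kappa>) \<longlonglongrightarrow> (\<integral>x. indicator U x \<partial>\<kappa>)"
      proof (rule integral_dominated_convergence[where w="\<lambda>_. 1"])
        show "(indicator U :: 'a \<Rightarrow> real) \<in> borel_measurable \<kappa>" using Us by simp
        show "(\<lambda>x. real (Suc n) * g n x) \<in> borel_measurable \<kappa>" for n
          by (intro borel_measurable_times borel_measurable_const
              borel_measurable_integrable[OF short_maps_integrable[OF \<kappa> g]])
      qed (use lim bound in auto)
      moreover have "U \<inter> space \<kappa> = U" using Us sets.sets_into_space by blast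
      ultimately show ?thesis by simp
    qed
    have "(\<integral>x. real (Suc n) * g n x \<partial>\<mu>) = (\<integral>x. real (Suc n) * g n x \<partial>\<nu>)" for n
      using eq[OF g[of n]] by simp
    with conv[OF \<mu>] conv[OF \<nu>] show ?thesis by (simp add: LIMSEQ_unique)
  qed
  show ?thesis
  proof (rule measure_eqI_generator_eq[where E="Collect open" and \<Omega>=UNIV and A="\<lambda>_. UNIV"])
    show "Int_stable (Collect open)" by (auto simp: Int_stable_def)
    show "sets \<mu> = sigma_sets UNIV (Collect open)" "sets \<nu> = sigma_sets UNIV (Collect open)"
      using \<mu> \<nu> by (simp_all add: borel_prob_def borel_def)
    show "emeasure \<mu> U = emeasure \<nu> U" if "U \<in> Collect open" for U
      using open_eq[of U] that by (simp add: \<mu>.emeasure_eq_measure \<nu>.emeasure_eq_measure)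
  qed (auto simp: \<mu>.emeasure_eq_measure)
qed

lemma bl_dist_limit_unique:
  assumes "\<And>n. borel_prob (m n)" "borel_prob \<mu>" "borel_prob \<nu>"
    and "(\<lambda>n. bl_dist (m n) \<mu>) \<longlonglongrightarrow> 0" "(\<lambda>n. bl_dist (m n) \<nu>) \<longlonglongrightarrow> 0"
  shows "\<mu> = \<nu>"
proof (rule bl_dist_zero_imp_eq[OF assms(2,3)])
  have "(\<lambda>n. bl_dist (m n) \<mu> + bl_dist (m n) \<nu>) \<longlonglongrightarrow> 0 + 0"
    by (intro tendsto_add assms)
  moreover have "bl_dist \<mu> \<nu> \<le> bl_dist (m n) \<mu> + bl_dist (m n) \<nu>" for n
    using bl_dist_triangle[OF assms(2) assms(1)[of n] assms(3)] bl_dist_sym[of \<mu> "m n"] by simp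
  ultimately have "bl_dist \<mu> \<nu> \<le> 0"
    using LIMSEQ_le_const by (metis (no_types, lifting) add_0)
  then show "bl_dist \<mu> \<nu> = 0" using bl_dist_nonneg[OF assms(2,3)] by simp
qed

text \<open>Along an increasing coupling the points converge by bounded monotone convergence; the limit
stays between the sequence and its bound because the order is closed, and the coupling bounds the
distance of the laws by the mean of \<open>min 1 (dist (X i) X)\<close>.\<close>

lemma stoch_increasing_limit:
  fixes \<mu> :: "nat \<Rightarrow> 'a::{polish_space, order} measure"
  assumes order: "closed_order TYPE('a)" and bmc: "bounded_monotone_convergence TYPE('a)"
    and \<mu>: "\<And>i. borel_prob (\<mu> i)" "\<And>i. stoch_le (\<mu> i) (\<mu> (Suc i))"
    and \<rho>: "borel_prob \<rho>" "\<And>i. stoch_le (\<mu> i) \<rho>"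
  obtains \<kappa> where "borel_prob \<kappa>" "\<And>i. stoch_le (\<mu> i) \<kappa>" "stoch_le \<kappa> \<rho>"
    "(\<lambda>i. bl_dist (\<mu> i) \<kappa>) \<longlonglongrightarrow> 0"
proof (rule increasing_coupling[of \<mu> \<rho>, OF order \<mu> \<rho>])
  fix M :: "(nat \<Rightarrow> 'a) measure"
  assume M: "prob_space M"
    and path: "\<And>\<omega> i. \<omega> \<in> space M \<Longrightarrow> \<omega> (Suc i) \<le> \<omega> (Suc (Suc i)) \<and> \<omega> (Suc i) \<le> \<omega> 0"
    and meas[measurable]: "\<And>i. (\<lambda>\<omega>. \<omega> i) \<in> M \<rightarrow>\<^sub>M borel"
    and top: "distr M borel (\<lambda>\<omega>. \<omega> 0) = \<rho>" and marg: "\<And>i. distr M borel (\<lambda>\<omega>. \<omega> (Suc i)) = \<mu> i"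
  interpret prob_space M by fact
  define X where "X \<omega> = lim (\<lambda>i. \<omega> (Suc i))" for \<omega> :: "nat \<Rightarrow> 'a"
  have inc: "incseq (\<lambda>i. \<omega> (Suc i))" if "\<omega> \<in> space M" for \<omega>
    using path[OF that] by (intro incseq_SucI) auto
  have lim: "(\<lambda>i. \<omega> (Suc i)) \<longlonglongrightarrow> X \<omega>" if "\<omega> \<in> space M" for \<omega>
    unfolding X_def convergent_LIMSEQ_iff[symmetric]
    using bmc inc[OF that] path[OF that] unfolding bounded_monotone_convergence_def by blast
  have X[measurable]: "X \<in> borel_measurable M"
    by (rule borel_measurable_LIMSEQ_metric[where f="\<lambda>i \<omega>. \<omega> (Suc i)"]) (use lim in auto)
  have le_X: "\<omega> (Suc i) \<le> X \<omega>" if "\<omega> \<in> space M" for \<omega> i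
  proof (rule closed_order_lim[OF order tendsto_const])
    show "(\<lambda>n. \<omega> (Suc (n + i))) \<longlonglongrightarrow> X \<omega>" using LIMSEQ_ignore_initial_segment[OF lim[OF that], of i] by simp
    show "\<omega> (Suc i) \<le> \<omega> (Suc (n + i))" for n using incseqD[OF inc[OF that], of i "n + i"] by simp
  qed
  have X_le: "X \<omega> \<le> \<omega> 0" if "\<omega> \<in> space M" for \<omega>
    by (rule closed_order_lim[OF order lim[OF that] tendsto_const]) (use path[OF that] in auto)
  define W where "W i = (\<integral>\<omega>. min 1 (dist (\<omega> (Suc i)) (X \<omega>)) \<partial>M)" for i
  have W: "W \<longlonglongrightarrow> (\<integral>\<omega>. 0 \<partial>M)"
    unfolding W_def
  proof (rule integral_dominated_convergence[where w="\<lambda>_. 1"])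
    show "AE \<omega> in M. (\<lambda>i. min 1 (dist (\<omega> (Suc i)) (X \<omega>))) \<longlonglongrightarrow> 0"
    proof (rule AE_I2)
      fix \<omega> assume "\<omega> \<in> space M"
      have "(\<lambda>i. min 1 (dist (\<omega> (Suc i)) (X \<omega>))) \<longlonglongrightarrow> min 1 (dist (X \<omega>) (X \<omega>))"
        by (intro tendsto_intros lim) fact
      then show "(\<lambda>i. min 1 (dist (\<omega> (Suc i)) (X \<omega>))) \<longlonglongrightarrow> 0" by simp
    qed
  qed auto
  have bl: "bl_dist (\<mu> i) (distr M borel X) \<le> W i" for i
  proof (rule bl_dist_least)
    fix f :: "'a \<Rightarrow> real" assume f: "f \<in> short_maps"
    note fm[measurable] = short_maps_measurable[OF f]
    have int: "integrable M (\<lambda>\<omega>. f (Z \<omega>))" if "Z \<in> borel_measurable M" for Z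
      using that short_maps_bound[OF f]
      by (intro integrable_const_bound[where B="\<bar>f undefined\<bar> + 1"]) auto
    have "\<bar>(\<integral>x. f x \<partial>\<mu> i) - (\<integral>x. f x \<partial>distr M borel X)\<bar> = \<bar>\<integral>\<omega>. f (\<omega> (Suc i)) - f (X \<omega>) \<partial>M\<bar>"
      unfolding marg[of i, symmetric] using int[of "\<lambda>\<omega>. \<omega> (Suc i)"] int[of X]
      by (simp add: integral_distr)
    also have "\<dots> \<le> (\<integral>\<omega>. \<bar>f (\<omega> (Suc i)) - f (X \<omega>)\<bar> \<partial>M)" by (rule integral_abs_bound)
    also have "\<dots> \<le> W i"
      unfolding W_def
    proof (rule integral_mono)
      show "integrable M (\<lambda>\<omega>. \<bar>f (\<omega> (Suc i)) - f (X \<omega>)\<bar>)"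
        using int[OF meas] int[OF X] by (intro integrable_abs Bochner_Integration.integrable_diff)
      show "integrable M (\<lambda>\<omega>. min 1 (dist (\<omega> (Suc i)) (X \<omega>)))"
        by (rule integrable_const_bound[where B=1]) auto
      show "\<bar>f (\<omega> (Suc i)) - f (X \<omega>)\<bar> \<le> min 1 (dist (\<omega> (Suc i)) (X \<omega>))" for \<omega>
        using f by (simp add: short_maps_def)
    qed
    finally show "\<bar>(\<integral>x. f x \<partial>\<mu> i) - (\<integral>x. f x \<partial>distr M borel X)\<bar> \<le> W i" .
  qed
  have \<kappa>: "borel_prob (distr M borel X)" by (simp add: borel_prob_def prob_space_distr)
  show thesis
  proof (rule that[OF \<kappa>])
    show "stoch_le (\<mu> i) (distr M borel X)" for i
      unfolding marg[of i, symmetric] by (rule stoch_le_distr[OF M]) (auto simp: le_X)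
    show "stoch_le (distr M borel X) \<rho>"
      unfolding top[symmetric] by (rule stoch_le_distr[OF M]) (auto simp: X_le)
    show "(\<lambda>i. bl_dist (\<mu> i) (distr M borel X)) \<longlonglongrightarrow> 0"
    proof (rule tendsto_sandwich[OF _ _ tendsto_const])
      show "W \<longlonglongrightarrow> 0" using W by simp
    qed (simp_all add: bl bl_dist_nonneg[OF \<mu>(1) \<kappa>])
  qed
qed

text \<open>From each point one moves up by at least half of the largest possible distance.  The resulting
sequence converges, so its steps tend to \<open>0\<close>, and with them the distances from the sequence to
whatever lies above its limit.\<close>

lemma exists_maximal_up_to_distance:
  fixes S :: "'b set" and D :: "'b \<Rightarrow> 'b \<Rightarrow> real" and le :: "'b \<Rightarrow> 'b \<Rightarrow> bool"
  assumes S: "a \<in> S"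
    and refl: "\<And>u. le u u" and trans: "\<And>u v w. le u v \<Longrightarrow> le v w \<Longrightarrow> le u w"
    and D: "\<And>u v. u \<in> S \<Longrightarrow> v \<in> S \<Longrightarrow> 0 \<le> D u v" "\<And>u v. u \<in> S \<Longrightarrow> v \<in> S \<Longrightarrow> D u v \<le> b"
      "\<And>u v. D u v = D v u"
      "\<And>u v w. u \<in> S \<Longrightarrow> v \<in> S \<Longrightarrow> w \<in> S \<Longrightarrow> D u w \<le> D u v + D v w"
    and sup: "\<And>m :: nat \<Rightarrow> 'b. (\<And>n. m n \<in> S) \<Longrightarrow> (\<And>n. le (m n) (m (Suc n))) \<Longrightarrow>
      \<exists>u\<in>S. (\<forall>n. le (m n) u) \<and> (\<lambda>n. D (m n) u) \<longlonglongrightarrow> 0"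
  shows "\<exists>u\<in>S. \<forall>v\<in>S. le u v \<longrightarrow> D u v = 0"
proof -
  \<comment> \<open>The greedy step; if nothing above \<open>u\<close> is at positive distance, it stays at \<open>u\<close>.\<close>
  have "\<exists>w. w \<in> S \<and> le u w \<and> (\<forall>v\<in>S. le u v \<longrightarrow> D u v \<le> 2 * D u w)" if u: "u \<in> S" for u
  proof (cases "\<exists>v\<in>S. le u v \<and> 0 < D u v")
    case False
    then show ?thesis using u refl[of u] D(1)[OF u u] by (intro exI[of _ u]) force
  next
    case True
    let ?V = "{v\<in>S. le u v}"
    have ne: "?V \<noteq> {}" using True by auto
    have bdd: "bdd_above (D u ` ?V)" using D(2)[OF u] by (auto intro!: bdd_aboveI[of _ b])
    have up: "D u v \<le> (SUP v\<in>?V. D u v)" if "v \<in> ?V" for v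
      by (rule cSUP_upper[OF that bdd])
    have pos: "0 < (SUP v\<in>?V. D u v)" using True up by force
    have "(SUP v\<in>?V. D u v) / 2 < (SUP v\<in>?V. D u v)" using pos by simp
    then obtain w where "w \<in> ?V" "(SUP v\<in>?V. D u v) / 2 < D u w"
      using less_cSUP_iff[OF ne bdd] by blast
    with up show ?thesis by (intro exI[of _ w]) force
  qed
  then obtain nxt where nx: "\<And>u. u \<in> S \<Longrightarrow> nxt u \<in> S" "\<And>u. u \<in> S \<Longrightarrow> le u (nxt u)"
    "\<And>u v. u \<in> S \<Longrightarrow> v \<in> S \<Longrightarrow> le u v \<Longrightarrow> D u v \<le> 2 * D u (nxt u)" by metis
  define m where "m n = (nxt ^^ n) a" for n
  have m: "m n \<in> S" for n by (induction n) (auto simp: m_def S nx)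
  have m_Suc: "m (Suc n) = nxt (m n)" for n by (simp add: m_def)
  have m_le: "le (m n) (m (Suc n))" for n unfolding m_Suc by (rule nx(2)[OF m])
  obtain u where u: "u \<in> S" "\<And>n. le (m n) u" "(\<lambda>n. D (m n) u) \<longlonglongrightarrow> 0"
    using sup[of m, OF m m_le] by blast
  have "D u v = 0" if v: "v \<in> S" "le u v" for v
  proof -
    have "D u v \<le> 3 * D (m n) u + 2 * D (m (Suc n)) u" for n
    proof -
      have "D u v \<le> D (m n) u + D (m n) v" using D(4)[OF u(1) m[of n] v(1)] D(3)[of u "m n"] by simp
      also have "D (m n) v \<le> 2 * D (m n) (m (Suc n))"
        unfolding m_Suc using trans[OF u(2) v(2)] by (intro nx(3) m v(1))
      also have "D (m n) (m (Suc n)) \<le> D (m n) u + D (m (Suc n)) u"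
        using D(4)[OF m[of n] u(1) m[of "Suc n"]] D(3)[of u "m (Suc n)"] by simp
      finally show ?thesis by simp
    qed
    moreover have "(\<lambda>n. 3 * D (m n) u + 2 * D (m (Suc n)) u) \<longlonglongrightarrow> 3 * 0 + 2 * 0"
      using u(3) by (intro tendsto_intros LIMSEQ_Suc)
    ultimately have "D u v \<le> 3 * 0 + 2 * 0" by (intro LIMSEQ_le_const) auto
    then show ?thesis using D(1)[OF u(1) v(1)] by simp
  qed
  then show ?thesis using u(1) by blast
qed

section \<open>Monotone kernels between a sub- and a supersolution\<close>

locale borel_kernel =
  fixes P :: "'a::topological_space \<Rightarrow> 'a measure"
  assumes kernel: "markov_kernel P"
begin

lemma kernel_prob_algebra[measurable]: "P \<in> borel \<rightarrow>\<^sub>M prob_algebra borel"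
  using kernel by (simp add: markov_kernel_def)

lemma kernel_subprob_algebra[measurable]: "P \<in> borel \<rightarrow>\<^sub>M subprob_algebra borel"
  by (rule measurable_prob_algebraD[OF kernel_prob_algebra])

lemma borel_prob_kernel: "borel_prob (P x)"
  using measurable_space[OF kernel_prob_algebra, of x] by (simp add: space_prob_algebra borel_prob_def)

definition transition :: "('a \<Rightarrow> real) \<Rightarrow> 'a \<Rightarrow> real" where
  "transition g x = (\<integral>y. g y \<partial>P x)"

lemma transition_measurable[measurable]:
  "g \<in> borel_measurable borel \<Longrightarrow> transition g \<in> borel_measurable borel"
  unfolding transition_def
  by (rule measurable_compose[OF kernel_subprob_algebra integral_measurable_subprob_algebra])

lemma transition_ge:
  assumes "g \<in> borel_measurable borel" "\<And>x. \<bar>g x\<bar> \<le> B" "\<And>x. c \<le> g x"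
  shows "c \<le> transition g x"
proof -
  interpret prob_space "P x" using borel_prob_kernel[of x] by (simp add: borel_prob_def)
  show ?thesis unfolding transition_def
    using borel_prob_integrable[OF borel_prob_kernel assms(1,2)] assms(3)
    by (intro integral_ge_const) auto
qed

lemma transition_le:
  assumes "g \<in> borel_measurable borel" "\<And>x. \<bar>g x\<bar> \<le> B" "\<And>x. g x \<le> c"
  shows "transition g x \<le> c"
proof -
  interpret prob_space "P x" using borel_prob_kernel[of x] by (simp add: borel_prob_def)
  show ?thesis unfolding transition_def
    using borel_prob_integrable[OF borel_prob_kernel assms(1,2)] assms(3)
    by (intro integral_le_const) auto
qed

lemma transition_abs_le:
  assumes "g \<in> borel_measurable borel" "\<And>x. \<bar>g x\<bar> \<le> B"
  shows "\<bar>transition g x\<bar> \<le> B"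
proof -
  have "- B \<le> g x" "g x \<le> B" for x using assms(2)[of x] by auto
  then have "- B \<le> transition g x" "transition g x \<le> B"
    by (auto intro: transition_ge[OF assms] transition_le[OF assms])
  then show ?thesis by simp
qed

lemma transition_range:
  assumes "g \<in> borel_measurable borel" "range g \<subseteq> {0..1}"
  shows "range (transition g) \<subseteq> {0..1}"
proof -
  have g: "0 \<le> g x" "g x \<le> 1" for x using assms(2) by (auto simp: subset_iff)
  then have "\<bar>g x\<bar> \<le> 1" for x by (simp add: abs_le_iff order_trans[of _ 0])
  then show ?thesis
    using transition_ge[OF assms(1) _ g(1)] transition_le[OF assms(1) _ g(2)] by fastforce
qed

lemma integral_bind_kernel:
  assumes "finite_measure \<mu>" "sets \<mu> = sets borel"
    and g[measurable]: "g \<in> borel_measurable borel" and B: "\<And>x. \<bar>g x\<bar> \<le> B"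
  shows "(\<integral>x. g x \<partial>(\<mu> \<bind> P)) = (\<integral>x. transition g x \<partial>\<mu>)"
  unfolding transition_def
proof (rule integral_bind[where K=borel and B=B and B'=1])
  show "P \<in> \<mu> \<rightarrow>\<^sub>M subprob_algebra borel"
    using kernel_subprob_algebra measurable_cong_sets[OF assms(2) refl] by blast
  show "AE x in \<mu>. emeasure (P x) (space (P x)) \<le> ennreal 1"
    using borel_prob_kernel by (auto simp: borel_prob_def prob_space.emeasure_space_1)
qed (use assms in auto)

lemma borel_prob_bind: "borel_prob \<mu> \<Longrightarrow> borel_prob (\<mu> \<bind> P)"
proof -
  assume "borel_prob \<mu>"
  then have "\<mu> \<in> space (prob_algebra borel)" by (simp add: borel_prob_def space_prob_algebra)
  then show ?thesis
    unfolding borel_prob_def using prob_space_bind'[OF _ kernel_prob_algebra] sets_bind'[OF _ kernel_prob_algebra]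
    by blast
qed

lemma stationary_if_fixed:
  assumes "borel_prob \<mu>" "\<mu> \<bind> P = \<mu>"
  shows "stationary_distribution P \<mu>"
proof -
  have "\<mu> \<in> space (prob_algebra borel)" using assms(1) by (simp add: borel_prob_def space_prob_algebra)
  then have "(\<integral>\<^sup>+x. emeasure (P x) A \<partial>\<mu>) = emeasure \<mu> A" if "A \<in> sets borel" for A
    using emeasure_bind_prob_algebra[OF _ kernel_prob_algebra that, of \<mu>] assms(2) by simp
  then show ?thesis using assms(1) by (simp add: stationary_distribution_def borel_prob_def)
qed

end

locale monotone_kernel = borel_kernel P for P :: "'a::{polish_space, order} \<Rightarrow> 'a measure" +
  assumes monotone: "stochastically_monotone P"
begin

lemma transition_mono:
  "g \<in> borel_measurable borel \<Longrightarrow> range g \<subseteq> {0..1} \<Longrightarrow> mono g \<Longrightarrow> mono (transition g)"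
  using monotone unfolding stochastically_monotone_def transition_def by blast

lemma stoch_le_bind:
  assumes le: "stoch_le \<mu> \<nu>" and \<mu>: "borel_prob \<mu>" and \<nu>: "borel_prob \<nu>"
  shows "stoch_le (\<mu> \<bind> P) (\<nu> \<bind> P)"
  unfolding stoch_le_def
proof (intro ballI impI)
  fix g :: "'a \<Rightarrow> real"
  assume g: "g \<in> borel_measurable borel" "range g \<subseteq> {0..1}" "mono g"
  have B: "\<bar>g x\<bar> \<le> 1" for x using g(2) by (auto simp: subset_iff abs_le_iff intro: order_trans[of _ 0])
  have "(\<integral>x. g x \<partial>(\<kappa> \<bind> P)) = (\<integral>x. transition g x \<partial>\<kappa>)" if "borel_prob \<kappa>" for \<kappa>
    using that g(1) B by (intro integral_bind_kernel) (auto simp: borel_prob_def prob_space.finite_measure)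
  moreover have "(\<integral>x. transition g x \<partial>\<mu>) \<le> (\<integral>x. transition g x \<partial>\<nu>)"
    using g by (intro stoch_leD[OF le] transition_measurable transition_range transition_mono)
  ultimately show "(\<integral>x. g x \<partial>(\<mu> \<bind> P)) \<le> (\<integral>x. g x \<partial>(\<nu> \<bind> P))" using \<mu> \<nu> by simp
qed

text \<open>Let \<open>\<kappa>\<close> be the limit of an increasing sequence \<open>m n\<close> of measures with \<open>m n \<le> m n P\<close>.  That
\<open>\<kappa> \<le> \<kappa> P\<close> is seen by taking the limit a second time, now below the bound \<open>\<kappa> P\<close>: the two limits
agree, since both are limits for the metric.\<close>

theorem stationary_between:
  assumes order: "closed_order TYPE('a)" and bmc: "bounded_monotone_convergence TYPE('a)"
    and \<alpha>: "borel_prob \<alpha>" "stoch_le \<alpha> (\<alpha> \<bind> P)" and \<beta>: "borel_prob \<beta>" "stoch_le (\<beta> \<bind> P) \<beta>"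
    and \<alpha>\<beta>: "stoch_le \<alpha> \<beta>"
  shows "\<exists>\<pi>. stationary_distribution P \<pi>"
proof -
  define S where "S = {\<mu>. borel_prob \<mu> \<and> stoch_le \<mu> (\<mu> \<bind> P) \<and> stoch_le \<mu> \<beta>}"
  have S: "\<mu> \<in> S \<longleftrightarrow> borel_prob \<mu> \<and> stoch_le \<mu> (\<mu> \<bind> P) \<and> stoch_le \<mu> \<beta>" for \<mu>
    by (simp add: S_def)
  have "\<exists>\<mu>\<in>S. \<forall>\<nu>\<in>S. stoch_le \<mu> \<nu> \<longrightarrow> bl_dist \<mu> \<nu> = 0"
  proof (rule exists_maximal_up_to_distance[where a=\<alpha> and b=2])
    show "\<alpha> \<in> S" using \<alpha> \<alpha>\<beta> by (simp add: S)
    show "\<exists>\<kappa>\<in>S. (\<forall>n. stoch_le (m n) \<kappa>) \<and> (\<lambda>n. bl_dist (m n) \<kappa>) \<longlonglongrightarrow> 0"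
      if m: "\<And>n. m n \<in> S" "\<And>n. stoch_le (m n) (m (Suc n))" for m :: "nat \<Rightarrow> 'a measure"
    proof -
      have m': "borel_prob (m n)" "stoch_le (m n) (m n \<bind> P)" "stoch_le (m n) \<beta>" for n
        using m(1)[of n] by (auto simp: S)
      obtain \<kappa> where \<kappa>: "borel_prob \<kappa>" "\<And>n. stoch_le (m n) \<kappa>" "stoch_le \<kappa> \<beta>"
        "(\<lambda>n. bl_dist (m n) \<kappa>) \<longlonglongrightarrow> 0"
        using stoch_increasing_limit[of m \<beta>, OF order bmc m'(1) m(2) \<beta>(1) m'(3)] by metis
      have "stoch_le (m n) (\<kappa> \<bind> P)" for n
        by (rule stoch_le_trans[OF m'(2) stoch_le_bind[OF \<kappa>(2) m'(1) \<kappa>(1)]])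
      then obtain \<kappa>' where \<kappa>': "borel_prob \<kappa>'" "stoch_le \<kappa>' (\<kappa> \<bind> P)" "(\<lambda>n. bl_dist (m n) \<kappa>') \<longlonglongrightarrow> 0"
        using stoch_increasing_limit[of m "\<kappa> \<bind> P", OF order bmc m'(1) m(2) borel_prob_bind[OF \<kappa>(1)]]
        by metis
      have "\<kappa>' = \<kappa>" by (rule bl_dist_limit_unique[of m, OF m'(1) \<kappa>'(1) \<kappa>(1) \<kappa>'(3) \<kappa>(4)])
      with \<kappa> \<kappa>' show ?thesis by (intro bexI[of _ \<kappa>]) (auto simp: S)
    qed
  qed (auto simp: S bl_dist_nonneg bl_dist_le_2 stoch_le_refl intro: stoch_le_trans bl_dist_sym bl_dist_triangle)
  then obtain \<mu> where \<mu>: "\<mu> \<in> S" and max: "\<And>\<nu>. \<nu> \<in> S \<Longrightarrow> stoch_le \<mu> \<nu> \<Longrightarrow> bl_dist \<mu> \<nu> = 0" by blast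
  have \<mu>': "borel_prob \<mu>" "stoch_le \<mu> (\<mu> \<bind> P)" "stoch_le \<mu> \<beta>" using \<mu> by (auto simp: S)
  have bp: "borel_prob (\<mu> \<bind> P)" by (rule borel_prob_bind[OF \<mu>'(1)])
  have "\<mu> \<bind> P \<in> S"
    using bp stoch_le_bind[OF \<mu>'(2,1) bp] stoch_le_trans[OF stoch_le_bind[OF \<mu>'(3,1) \<beta>(1)] \<beta>(2)]
    by (simp add: S)
  from bl_dist_zero_imp_eq[OF \<mu>'(1) bp max[OF this \<mu>'(2)]] have "\<mu> \<bind> P = \<mu>" by simp
  then show ?thesis using stationary_if_fixed[OF \<mu>'(1)] by blast
qed

end

section \<open>Occupation measures of excursions\<close>

context borel_kernel
begin

lemma iterated_transition:
  assumes "g \<in> borel_measurable borel" "range g \<subseteq> {0..1}"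
  shows "(transition ^^ k) g \<in> borel_measurable borel" "range ((transition ^^ k) g) \<subseteq> {0..1}"
proof (induction k)
  case (Suc k)
  { case 1 show ?case using transition_measurable[OF Suc.IH(1)] by simp }
  { case 2 show ?case using transition_range[OF Suc.IH] by simp }
qed (use assms in auto)

definition resolvent :: "real \<Rightarrow> ('a \<Rightarrow> real) \<Rightarrow> 'a \<Rightarrow> real" where
  "resolvent s g x = (\<Sum>k. s ^ k * (transition ^^ k) g x)"

context
  fixes s :: real and g :: "'a \<Rightarrow> real"
  assumes s: "0 < s" "s < 1" and g: "g \<in> borel_measurable borel" "range g \<subseteq> {0..1}"
begin

lemma resolvent_term: "0 \<le> s ^ k * (transition ^^ k) g x" "s ^ k * (transition ^^ k) g x \<le> s ^ k"
proof -
  have "0 \<le> (transition ^^ k) g x" "(transition ^^ k) g x \<le> 1"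
    using iterated_transition(2)[OF g, of k] by (auto simp: subset_iff)
  then show "0 \<le> s ^ k * (transition ^^ k) g x" "s ^ k * (transition ^^ k) g x \<le> s ^ k"
    using s by (auto intro: mult_left_le)
qed

lemma resolvent_summable: "summable (\<lambda>k. s ^ k * (transition ^^ k) g x)"
proof (rule summable_comparison_test'[of "\<lambda>k. s ^ k" 0])
  show "summable (\<lambda>k. s ^ k)" using s by (simp add: summable_geometric)
  show "norm (s ^ k * (transition ^^ k) g x) \<le> s ^ k" for k using resolvent_term[of k x] by simp
qed

lemma resolvent_bounds: "0 \<le> resolvent s g x" "resolvent s g x \<le> 1 / (1 - s)"
proof -
  show "0 \<le> resolvent s g x"
    unfolding resolvent_def by (rule suminf_nonneg[OF resolvent_summable]) (rule resolvent_term)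
  have "resolvent s g x \<le> (\<Sum>k. s ^ k)"
    unfolding resolvent_def 
    by (rule suminf_le[OF resolvent_term(2) resolvent_summable]) (use s in \<open>simp add: summable_geometric\<close>)
  then show "resolvent s g x \<le> 1 / (1 - s)" using s by (simp add: suminf_geometric)
qed

lemma resolvent_measurable: "resolvent s g \<in> borel_measurable borel"
  unfolding resolvent_def[abs_def]
  by (intro borel_measurable_suminf borel_measurable_times borel_measurable_const iterated_transition(1)[OF g])

lemma resolvent_equation: "resolvent s g x = g x + s * transition (resolvent s g) x"
proof -
  interpret prob_space "P x" using borel_prob_kernel[of x] by (simp add: borel_prob_def)
  have "transition (resolvent s g) x = (\<integral>y. (\<Sum>k. s ^ k * (transition ^^ k) g y) \<partial>P x)"
    by (simp add: transition_def resolvent_def)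
  also have "\<dots> = (\<Sum>k. \<integral>y. s ^ k * (transition ^^ k) g y \<partial>P x)"
  proof (rule integral_suminf)
    have bound: "\<bar>s ^ k * (transition ^^ k) g y\<bar> \<le> s ^ k" for k y
      using resolvent_term[of k y] by simp
    show int: "integrable (P x) (\<lambda>y. s ^ k * (transition ^^ k) g y)" for k
      by (rule borel_prob_integrable[OF borel_prob_kernel _ bound])
        (intro borel_measurable_times borel_measurable_const iterated_transition(1)[OF g])
    show "AE y in P x. summable (\<lambda>k. norm (s ^ k * (transition ^^ k) g y))"
      using resolvent_summable resolvent_term(1) by simp
    have "(\<integral>y. norm (s ^ k * (transition ^^ k) g y) \<partial>P x) \<le> s ^ k" for k
      using bound int by (intro integral_le_const) auto
    then have "norm (\<integral>y. norm (s ^ k * (transition ^^ k) g y) \<partial>P x) \<le> s ^ k" for k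
      by (simp only: real_norm_def abs_of_nonneg[OF integral_nonneg_AE] abs_ge_zero AE_I2)
    then show "summable (\<lambda>k. \<integral>y. norm (s ^ k * (transition ^^ k) g y) \<partial>P x)"
      using s summable_geometric[of s] by (auto intro: summable_comparison_test'[of "\<lambda>k. s ^ k" 0])
  qed
  also have "\<dots> = (\<Sum>k. s ^ k * (transition ^^ Suc k) g x)"
    by (simp add: transition_def)
  finally have "s * transition (resolvent s g) x = s * (\<Sum>k. s ^ k * (transition ^^ Suc k) g x)" by simp
  also have "\<dots> = (\<Sum>k. s ^ Suc k * (transition ^^ Suc k) g x)"
  proof -
    have "summable (\<lambda>k. s ^ Suc k * (transition ^^ Suc k) g x)"
      using resolvent_summable[of x] by (subst summable_Suc_iff)
    then have "summable (\<lambda>k. s * (s ^ k * (transition ^^ Suc k) g x))" by (simp only: power_Suc mult.assoc)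
    then have "summable (\<lambda>k. s ^ k * (transition ^^ Suc k) g x)" using s by (subst (asm) summable_cmult_iff) simp
    then show ?thesis by (subst suminf_mult[symmetric]) (simp_all only: power_Suc mult.assoc)
  qed
  also have "\<dots> = resolvent s g x - g x"
    unfolding resolvent_def using suminf_split_head[OF resolvent_summable[of x]] by simp
  finally show ?thesis by simp
qed

end

end

lemma (in monotone_kernel) resolvent_mono:
  assumes s: "0 < s" "s < 1" and g: "g \<in> borel_measurable borel" "range g \<subseteq> {0..1}" "mono g"
  shows "mono (resolvent s g)"
proof (rule monoI)
  have mono: "mono ((transition ^^ k) g)" for k
  proof (induction k)
    case (Suc k)
    then show ?case using transition_mono[OF iterated_transition[OF g(1,2)]] by simp
  qed (use g in simp)
  fix x y :: 'a assume "x \<le> y"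
  then have le: "(transition ^^ k) g x \<le> (transition ^^ k) g y" for k using mono by (simp add: mono_def)
  show "resolvent s g x \<le> resolvent s g y"
    unfolding resolvent_def
    using le s by (intro suminf_le resolvent_summable[OF s g(1,2)]) (auto intro: mult_left_mono)
qed

locale excursion = borel_kernel P for P :: "'a::topological_space \<Rightarrow> 'a measure" +
  fixes a :: 'a and U :: "'a set"
  assumes U[measurable]: "U \<in> sets borel"
begin

text \<open>\<open>occ j\<close> is the law of the position at time \<open>j\<close> of the chain from \<open>a\<close>, restricted to the event
that \<open>U\<close> is not visited at times \<open>1, ..., j\<close>.\<close>

primrec occ :: "nat \<Rightarrow> 'a measure" where
  "occ 0 = return borel a"
| "occ (Suc j) = density (occ j \<bind> P) (\<lambda>x. ennreal (indicator (- U) x))"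

lemma compl_U[measurable]: "- U \<in> sets borel"
  using U by (rule borel_comp)

lemma occ_subprob: "subprob_space (occ j) \<and> sets (occ j) = sets borel"
proof (induction j)
  case 0
  then show ?case using prob_space_return[of a borel] prob_space_imp_subprob_space by auto
next
  case (Suc j)
  have P: "P \<in> occ j \<rightarrow>\<^sub>M subprob_algebra borel"
    using kernel_subprob_algebra measurable_cong_sets[of "occ j" borel] Suc by blast
  interpret B: subprob_space "occ j \<bind> P" using Suc P by (intro subprob_space_bind) auto
  have sets: "sets (occ j \<bind> P) = sets borel"
    using Suc by (intro sets_bind[OF sets_kernel[OF P]]) (auto dest: sets_eq_imp_space_eq)
  have space: "space (occ j \<bind> P) = UNIV" using sets_eq_imp_space_eq[OF sets] by simp
  have "subprob_space (density (occ j \<bind> P) (\<lambda>x. ennreal (indicator (- U) x)))"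
  proof (rule subprob_spaceI)
    have [measurable_cong]: "sets (occ j \<bind> P) = sets borel" by (rule sets)
    have "emeasure (density (occ j \<bind> P) (\<lambda>x. ennreal (indicator (- U) x))) UNIV
        = (\<integral>\<^sup>+x. ennreal (indicator (- U) x) * indicator UNIV x \<partial>(occ j \<bind> P))"
      by (rule emeasure_density) (auto simp: sets)
    also have "\<dots> \<le> (\<integral>\<^sup>+x. 1 \<partial>(occ j \<bind> P))"
      by (intro nn_integral_mono) (simp add: indicator_def)
    also have "\<dots> \<le> 1" using B.emeasure_space_le_1 by simp
    finally show "emeasure (density (occ j \<bind> P) (\<lambda>x. ennreal (indicator (- U) x)))
        (space (density (occ j \<bind> P) (\<lambda>x. ennreal (indicator (- U) x)))) \<le> 1" by (simp add: space)
  qed (simp add: space)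
  with sets show ?case by simp
qed

lemma sets_occ[simp, measurable_cong]: "sets (occ j) = sets borel"
  using occ_subprob by blast

lemma space_occ[simp]: "space (occ j) = UNIV"
  using sets_eq_imp_space_eq[OF sets_occ] by simp

lemma finite_occ: "finite_measure (occ j)"
  using occ_subprob subprob_space_def by blast

lemma occ_integrable:
  fixes g :: "'a \<Rightarrow> real"
  assumes "g \<in> borel_measurable borel" "\<And>x. \<bar>g x\<bar> \<le> B"
  shows "integrable (occ j) g"
proof -
  interpret finite_measure "occ j" by (rule finite_occ)
  show ?thesis using assms by (intro integrable_const_bound[where B=B]) auto
qed

lemma integral_occ_0: "g \<in> borel_measurable borel \<Longrightarrow> (\<integral>x. g x \<partial>occ 0) = (g a :: real)"
  by (simp add: integral_return)

lemma integral_occ_Suc: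
  assumes g[measurable]: "g \<in> borel_measurable borel" and B: "\<And>x. \<bar>g x\<bar> \<le> B"
  shows "(\<integral>x. g x \<partial>occ (Suc j)) = (\<integral>x. transition (\<lambda>y. indicator (- U) y * g y) x \<partial>occ j)"
proof -
  have P: "P \<in> occ j \<rightarrow>\<^sub>M subprob_algebra borel" by measurable
  have [measurable_cong]: "sets (occ j \<bind> P) = sets borel"
    by (intro sets_bind[OF sets_kernel[OF P]]) auto
  have "(\<integral>x. g x \<partial>occ (Suc j)) = (\<integral>x. indicator (- U) x * g x \<partial>(occ j \<bind> P))"
    by (simp add: integral_density)
  also have "\<dots> = (\<integral>x. transition (\<lambda>y. indicator (- U) y * g y) x \<partial>occ j)"
  proof (rule integral_bind_kernel[OF finite_occ sets_occ])
    have "0 \<le> B" using B[of a] abs_ge_zero order_trans by blast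
    then show "\<bar>indicator (- U) x * g x\<bar> \<le> B" for x using B[of x] by (simp add: indicator_def)
  qed measurable
  finally show ?thesis .
qed

definition mass :: "nat \<Rightarrow> real" where
  "mass j = measure (occ j) UNIV"

lemma mass_eq_integral: "mass j = (\<integral>x. 1 \<partial>occ j)"
proof -
  interpret finite_measure "occ j" by (rule finite_occ)
  show ?thesis by (simp add: mass_def)
qed

lemma mass_0: "mass 0 = 1"
  unfolding mass_eq_integral by (subst integral_occ_0) auto

lemma mass_nonneg: "0 \<le> mass j"
  by (simp add: mass_def)

lemma integral_occ_abs_le:
  assumes "g \<in> borel_measurable borel" "\<And>x. \<bar>g x\<bar> \<le> B"
  shows "\<bar>\<integral>x. g x \<partial>occ j\<bar> \<le> B * mass j"
proof -
  have "\<bar>\<integral>x. g x \<partial>occ j\<bar> \<le> (\<integral>x. \<bar>g x\<bar> \<partial>occ j)" by (rule integral_abs_bound)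
  also have "\<dots> \<le> (\<integral>x. B * 1 \<partial>occ j)"
    using assms occ_integrable[of "\<lambda>_. B" "\<bar>B\<bar>" j] occ_integrable[OF assms, of j] by (intro integral_mono) auto
  also have "\<dots> = B * mass j" unfolding mass_eq_integral by (subst integral_mult_right_zero) simp
  finally show ?thesis .
qed

text \<open>One step of the excursion: the mass \<open>mass j - mass (Suc j)\<close> enters \<open>U\<close>, where \<open>h\<close> is at least \<open>h a\<close>.\<close>

lemma occ_step:
  assumes h[measurable]: "h \<in> borel_measurable borel" and B: "\<And>x. \<bar>h x\<bar> \<le> B" and hU: "\<And>y. y \<in> U \<Longrightarrow> h a \<le> h y"
  shows "(\<integral>x. h x \<partial>occ (Suc j)) + h a * (mass j - mass (Suc j)) \<le> (\<integral>x. transition h x \<partial>occ j)"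
proof -
  let ?p = "transition (\<lambda>y. indicator (- U) y * h y)"
  let ?q = "transition (\<lambda>y. indicator (- U) y * 1)"
  have B0: "0 \<le> B" using B[of a] abs_ge_zero order_trans by blast
  have bp: "\<bar>indicator (- U) y * h y\<bar> \<le> B" for y using B[of y] B0 by (auto simp: indicator_def)
  have bq: "\<bar>indicator (- U) y * 1\<bar> \<le> (1::real)" for y by (auto simp: indicator_def)
  have int: "integrable (P x) k" if "k \<in> borel_measurable borel" "\<And>y. \<bar>k y\<bar> \<le> C"
    for x C and k :: "'a \<Rightarrow> real"
    using borel_prob_integrable[OF borel_prob_kernel that] .
  have pq: "?p x + h a * (1 - ?q x) \<le> transition h x" for x
  proof -
    interpret prob_space "P x" using borel_prob_kernel[of x] by (simp add: borel_prob_def)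
    have ip: "integrable (P x) (\<lambda>y. indicator (- U) y * h y)" by (rule int[OF _ bp]) measurable
    have iq: "integrable (P x) (\<lambda>y. indicator (- U) y * 1 :: real)" by (rule int[OF _ bq]) measurable
    have "?p x + h a * (1 - ?q x) = (\<integral>y. indicator (- U) y * h y + h a * (1 - indicator (- U) y * 1) \<partial>P x)"
      unfolding transition_def using ip iq
      by (subst Bochner_Integration.integral_add) (auto simp: prob_space intro!: integrable_mult_right)
    also have "\<dots> \<le> (\<integral>y. h y \<partial>P x)"
      using ip iq hU int[OF h B, of x]
      by (intro integral_mono Bochner_Integration.integrable_add integrable_mult_right
            Bochner_Integration.integrable_diff integrable_const) (auto simp: indicator_def)
    finally show ?thesis by (simp add: transition_def)
  qed
  have mp: "?p \<in> borel_measurable borel" "?q \<in> borel_measurable borel" by measurable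
  have bp': "\<bar>?p x\<bar> \<le> B" for x by (rule transition_abs_le[OF _ bp]) measurable
  have bq': "\<bar>?q x\<bar> \<le> 1" for x by (rule transition_abs_le[OF _ bq]) measurable
  have bh': "\<bar>transition h x\<bar> \<le> B" for x by (rule transition_abs_le[OF h B])
  have ip: "integrable (occ j) ?p" by (rule occ_integrable[OF mp(1) bp'])
  have iq: "integrable (occ j) ?q" by (rule occ_integrable[OF mp(2) bq'])
  have i1: "integrable (occ j) (\<lambda>x. 1 :: real)" by (rule occ_integrable[of _ 1]) auto
  have "(\<integral>x. h x \<partial>occ (Suc j)) = (\<integral>x. ?p x \<partial>occ j)" by (rule integral_occ_Suc[OF h B])
  moreover have "mass (Suc j) = (\<integral>x. ?q x \<partial>occ j)"
    unfolding mass_eq_integral by (rule integral_occ_Suc[where B=1]) auto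
  moreover have "(\<integral>x. ?p x + h a * (1 - ?q x) \<partial>occ j) = (\<integral>x. ?p x \<partial>occ j) + h a * (mass j - (\<integral>x. ?q x \<partial>occ j))"
    unfolding mass_eq_integral using ip iq i1 by simp
  moreover have "(\<integral>x. ?p x + h a * (1 - ?q x) \<partial>occ j) \<le> (\<integral>x. transition h x \<partial>occ j)"
    using ip iq i1 occ_integrable[OF transition_measurable[OF h] bh', of j]
    by (intro integral_mono pq) auto
  ultimately show ?thesis by simp
qed

text \<open>The resolvent equation \<open>h = g + s P h\<close> is unrolled along the excursion until it returns to \<open>U\<close>,
where \<open>h \<ge> h a\<close> restarts it.  Up to time \<open>n\<close>, the discounted masses returned to \<open>U\<close> combine by
summation by parts into \<open>1 - (1 - s) (\<Sum>j<n. s^j mass j) - s^n mass n\<close>.\<close>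

lemma discounted_occupation_partial:
  assumes s: "0 < s" "s < 1" and g: "g \<in> borel_measurable borel" "\<And>x. \<bar>g x\<bar> \<le> C"
    and h: "h \<in> borel_measurable borel" "\<And>x. \<bar>h x\<bar> \<le> B" "\<And>y. y \<in> U \<Longrightarrow> h a \<le> h y"
    and eq: "\<And>x. h x = g x + s * transition h x"
  shows "(\<Sum>j<n. s ^ j * (\<integral>x. g x \<partial>occ j)) + s ^ n * (\<integral>x. h x \<partial>occ n)
    \<le> h a * ((1 - s) * (\<Sum>j<n. s ^ j * mass j) + s ^ n * mass n)"
proof (induction n)
  case 0
  then show ?case using integral_occ_0[OF h(1)] by (simp add: mass_0 del: occ.simps)
next
  case (Suc n)
  let ?g = "\<lambda>j. \<integral>x. g x \<partial>occ j" and ?h = "\<lambda>j. \<integral>x. h x \<partial>occ j"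
  have bh': "\<bar>transition h x\<bar> \<le> B" for x
    by (rule transition_abs_le[OF h(1,2)])
  have "?h n = (\<integral>x. g x + s * transition h x \<partial>occ n)" using eq by simp
  also have "\<dots> = ?g n + s * (\<integral>x. transition h x \<partial>occ n)"
    using occ_integrable[OF g] occ_integrable[OF transition_measurable[OF h(1)] bh'] by simp
  finally have hn: "?h n = ?g n + s * (\<integral>x. transition h x \<partial>occ n)" .
  have "s ^ n * (?g n + s * (?h (Suc n) + h a * (mass n - mass (Suc n)))) \<le> s ^ n * ?h n"
    unfolding hn using s occ_step[OF h, of n] by (intro mult_left_mono add_left_mono) auto
  with Suc show ?case by (simp add: algebra_simps del: occ.simps)
qed

lemma discounted_occupation:
  assumes s: "0 < s" "s < 1" and g: "g \<in> borel_measurable borel" "\<And>x. \<bar>g x\<bar> \<le> C"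
    and h: "h \<in> borel_measurable borel" "\<And>x. \<bar>h x\<bar> \<le> B" "\<And>y. y \<in> U \<Longrightarrow> h a \<le> h y"
    and eq: "\<And>x. h x = g x + s * transition h x"
    and summable: "summable mass"
  shows "(\<Sum>j. s ^ j * (\<integral>x. g x \<partial>occ j)) \<le> (1 - s) * h a * (\<Sum>j. s ^ j * mass j)"
proof -
  have sm: "summable (\<lambda>j. s ^ j * mass j)"
    by (rule summable_comparison_test'[OF summable, of 0])
      (use s mass_nonneg in \<open>auto simp: mult_left_le_one_le power_le_one\<close>)
  have gm: "norm (s ^ j * (\<integral>x. g x \<partial>occ j)) \<le> C * (s ^ j * mass j)" for j
    using mult_left_mono[OF integral_occ_abs_le[OF g, of j], of "s ^ j"] s by (simp add: abs_mult mult_ac)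
  have sg: "summable (\<lambda>j. s ^ j * (\<integral>x. g x \<partial>occ j))"
    by (rule summable_comparison_test'[OF summable_mult[OF sm, of C], of 0]) (rule gm)
  have hm: "norm (s ^ j * (\<integral>x. h x \<partial>occ j)) \<le> B * (s ^ j * mass j)" for j
    using mult_left_mono[OF integral_occ_abs_le[OF h(1,2), of j], of "s ^ j"] s by (simp add: abs_mult mult_ac)
  have hlim: "(\<lambda>j. s ^ j * (\<integral>x. h x \<partial>occ j)) \<longlonglongrightarrow> 0"
    by (rule summable_LIMSEQ_zero[OF summable_comparison_test'[OF summable_mult[OF sm, of B], of 0]]) (rule hm)
  have "(\<lambda>n. (\<Sum>j<n. s ^ j * (\<integral>x. g x \<partial>occ j)) + s ^ n * (\<integral>x. h x \<partial>occ n))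
      \<longlonglongrightarrow> (\<Sum>j. s ^ j * (\<integral>x. g x \<partial>occ j)) + 0"
    by (intro tendsto_add summable_LIMSEQ sg hlim)
  moreover have "(\<lambda>n. h a * ((1 - s) * (\<Sum>j<n. s ^ j * mass j) + s ^ n * mass n))
      \<longlonglongrightarrow> h a * ((1 - s) * (\<Sum>j. s ^ j * mass j) + 0)"
    by (intro tendsto_intros summable_LIMSEQ sm summable_LIMSEQ_zero)
  ultimately have "(\<Sum>j. s ^ j * (\<integral>x. g x \<partial>occ j)) + 0 \<le> h a * ((1 - s) * (\<Sum>j. s ^ j * mass j) + 0)"
    by (rule LIMSEQ_le) (use discounted_occupation_partial[OF s g h eq] in blast)
  then show ?thesis by (simp add: mult_ac)
qed

end

text \<open>Abel's theorem along a sequence of discount factors; the summand \<open>2\<close> keeps them inside \<open>(0, 1)\<close>.\<close>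

lemma abel_limit:
  fixes b :: "nat \<Rightarrow> real"
  assumes "summable (\<lambda>j. \<bar>b j\<bar>)"
  shows "(\<lambda>m. \<Sum>j. (1 - 1 / (real m + 2)) ^ j * b j) \<longlonglongrightarrow> (\<Sum>j. b j)"
proof -
  have "((\<lambda>m. \<Sum>j. (1 - 1 / (real m + 2)) ^ j * b j) \<longlongrightarrow> (\<Sum>j. b j)) sequentially"
  proof (rule tannerys_theorem[THEN conjunct2, THEN conjunct2])
    fix j
    have "(\<lambda>m. inverse (real (Suc (Suc m)))) \<longlonglongrightarrow> 0"
      by (intro LIMSEQ_Suc LIMSEQ_inverse_real_of_nat)
    then have "(\<lambda>m. (1 - inverse (real (Suc (Suc m)))) ^ j * b j) \<longlonglongrightarrow> (1 - 0) ^ j * b j"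
      by (intro tendsto_intros)
    then show "(\<lambda>m. (1 - 1 / (real m + 2)) ^ j * b j) \<longlonglongrightarrow> b j"
      by (simp add: inverse_eq_divide add.commute)
  next
    show "\<forall>\<^sub>F (j, m) in at_top \<times>\<^sub>F sequentially. norm ((1 - 1 / (real m + 2)) ^ j * b j) \<le> \<bar>b j\<bar>"
    proof (rule always_eventually, safe)
      fix j m :: nat
      have "\<bar>(1 - 1 / (real m + 2)) ^ j\<bar> \<le> 1"
        by (simp add: power_abs power_le_one_iff abs_le_iff)
      then show "norm ((1 - 1 / (real m + 2)) ^ j * b j) \<le> \<bar>b j\<bar>"
        by (simp add: abs_mult mult_left_le_one_le)
    qed
  qed (use assms in auto)
  then show ?thesis .
qed

context excursion
begin

definition total :: real where "total = (\<Sum>j. mass j)"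

text \<open>The normalised sum of the measures \<open>occ j\<close>, written as a mixture over the time \<open>j\<close>.  It would be
stationary for the chain that restarts at \<open>a\<close> whenever it enters \<open>U\<close>.\<close>

definition stat :: "'a measure" where
  "stat = density (count_space UNIV) (\<lambda>_. ennreal (1 / total)) \<bind> occ"

context
  assumes summable: "summable mass"
begin

lemma total_pos: "0 < total"
proof -
  have "mass 0 \<le> total"
    unfolding total_def using sum_le_suminf[OF summable, of "{0}"] mass_nonneg by simp
  then show ?thesis by (simp add: mass_0)
qed

lemma occ_measurable: "occ \<in> density (count_space UNIV) f \<rightarrow>\<^sub>M subprob_algebra borel"
proof -
  have "occ \<in> count_space UNIV \<rightarrow>\<^sub>M subprob_algebra borel"
    using occ_subprob by (auto simp: space_subprob_algebra)
  then show ?thesis by (simp cong: measurable_cong_sets)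
qed

lemma sets_stat[simp, measurable_cong]: "sets stat = sets borel"
  unfolding stat_def by (rule sets_bind[OF sets_kernel[OF occ_measurable]]) auto

lemma space_stat[simp]: "space stat = UNIV"
  using sets_eq_imp_space_eq[OF sets_stat] by simp

lemma nn_integral_stat:
  assumes "g \<in> borel_measurable borel"
  shows "(\<integral>\<^sup>+x. g x \<partial>stat) = (\<Sum>j. ennreal (1 / total) * (\<integral>\<^sup>+x. g x \<partial>occ j))"
  unfolding stat_def nn_integral_bind[OF assms occ_measurable]
  by (subst nn_integral_density) (auto simp: nn_integral_count_space_nat)

lemma summable_integral_occ:
  fixes g :: "'a \<Rightarrow> real"
  assumes g: "g \<in> borel_measurable borel" "\<And>x. \<bar>g x\<bar> \<le> B"
  shows "summable (\<lambda>j. \<bar>\<integral>x. g x \<partial>occ j\<bar>)" "summable (\<lambda>j. \<integral>x. g x \<partial>occ j)"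
proof -
  show "summable (\<lambda>j. \<bar>\<integral>x. g x \<partial>occ j\<bar>)"
    by (rule summable_comparison_test'[OF summable_mult[OF summable, of B], of 0])
      (use integral_occ_abs_le[OF g] in simp)
  then show "summable (\<lambda>j. \<integral>x. g x \<partial>occ j)" by (rule summable_rabs_cancel)
qed

lemma integral_stat:
  assumes g: "g \<in> borel_measurable borel" "range g \<subseteq> {0..1::real}"
  shows "(\<integral>x. g x \<partial>stat) = (\<Sum>j. \<integral>x. g x \<partial>occ j) / total"
proof -
  have g01: "0 \<le> g x" "g x \<le> 1" for x using g(2) by (auto simp: subset_iff)
  have B: "\<bar>g x\<bar> \<le> 1" for x using g01[of x] by simp
  have nonneg: "0 \<le> (\<integral>x. g x \<partial>occ j)" for j using g01 by simp
  have sm: "summable (\<lambda>j. 1 / total * (\<integral>x. g x \<partial>occ j))"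
    by (intro summable_mult summable_integral_occ(2)[OF g(1) B])
  have "(\<integral>\<^sup>+x. ennreal (g x) \<partial>stat) = (\<Sum>j. ennreal (1 / total) * (\<integral>\<^sup>+x. ennreal (g x) \<partial>occ j))"
    using g(1) by (intro nn_integral_stat) measurable
  also have "\<dots> = (\<Sum>j. ennreal (1 / total * (\<integral>x. g x \<partial>occ j)))"
    using nonneg total_pos g01 nn_integral_eq_integral[OF occ_integrable[OF g(1) B]]
    by (intro suminf_cong) (simp add: ennreal_mult[symmetric])
  also have "\<dots> = ennreal (\<Sum>j. 1 / total * (\<integral>x. g x \<partial>occ j))"
    using nonneg total_pos by (intro suminf_ennreal2 sm) auto
  also have "(\<Sum>j. 1 / total * (\<integral>x. g x \<partial>occ j)) = (\<Sum>j. \<integral>x. g x \<partial>occ j) / total"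
    using suminf_mult[OF summable_integral_occ(2)[OF g(1) B], of "1 / total"] by simp
  finally have eq: "(\<integral>\<^sup>+x. ennreal (g x) \<partial>stat) = ennreal ((\<Sum>j. \<integral>x. g x \<partial>occ j) / total)" .
  have "(\<integral>x. g x \<partial>stat) = enn2real (\<integral>\<^sup>+x. ennreal (g x) \<partial>stat)"
    using g g01 by (intro integral_eq_nn_integral) auto
  also have "\<dots> = (\<Sum>j. \<integral>x. g x \<partial>occ j) / total"
    unfolding eq using nonneg total_pos summable_integral_occ(2)[OF g(1) B]
    by (intro enn2real_ennreal divide_nonneg_pos suminf_nonneg) auto
  finally show ?thesis .
qed

lemma borel_prob_stat: "borel_prob stat"
proof -
  have "emeasure stat UNIV = (\<integral>\<^sup>+x. 1 \<partial>stat)" by simp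
  also have "\<dots> = (\<Sum>j. ennreal (1 / total) * (\<integral>\<^sup>+x. 1 \<partial>occ j))" by (rule nn_integral_stat) simp
  also have "\<dots> = (\<Sum>j. ennreal (1 / total * mass j))"
    using total_pos by (intro suminf_cong)
      (simp add: ennreal_mult[symmetric] mass_nonneg mass_def finite_measure.emeasure_eq_measure[OF finite_occ])
  also have "\<dots> = ennreal (\<Sum>j. 1 / total * mass j)"
    using total_pos mass_nonneg by (intro suminf_ennreal2 summable_mult summable) auto
  also have "(\<Sum>j. 1 / total * mass j) = 1"
    using suminf_mult[OF summable, of "1 / total"] total_pos by (simp add: total_def)
  finally show ?thesis by (auto simp: borel_prob_def intro!: prob_spaceI)
qed

text \<open>Summing \<open>occ_step\<close> over all times, the returned mass adds up to \<open>1\<close> and replaces the contribution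
\<open>g a\<close> of time \<open>0\<close>, which the shift by one step removes.\<close>

lemma stat_le_transition:
  assumes g: "g \<in> borel_measurable borel" "range g \<subseteq> {0..1::real}" and gU: "\<And>y. y \<in> U \<Longrightarrow> g a \<le> g y"
  shows "(\<integral>x. g x \<partial>stat) \<le> (\<integral>x. g x \<partial>(stat \<bind> P))"
proof -
  have B: "\<bar>g x\<bar> \<le> 1" for x using g(2) by (auto simp: subset_iff abs_le_iff intro: order_trans[of _ 0])
  have tB: "\<bar>transition g x\<bar> \<le> 1" for x by (rule transition_abs_le[OF g(1) B])
  let ?g = "\<lambda>j. \<integral>x. g x \<partial>occ j"
  have sg: "summable ?g" by (rule summable_integral_occ(2)[OF g(1) B])
  have tele: "(\<lambda>j. mass j - mass (Suc j)) sums 1"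
    using telescope_sums'[OF summable_LIMSEQ_zero[OF summable]] by (simp add: mass_0)
  have sg': "(\<lambda>j. ?g (Suc j)) sums (suminf ?g - g a)"
    using sums_Suc_iff[of ?g "suminf ?g - g a"] summable_sums[OF sg] integral_occ_0[OF g(1)]
    by (simp del: occ.simps)
  have lower: "(\<lambda>j. ?g (Suc j) + g a * (mass j - mass (Suc j))) sums (suminf ?g - g a + g a * 1)"
    by (intro sums_add sg' sums_mult tele)
  have "suminf ?g = (\<Sum>j. ?g (Suc j) + g a * (mass j - mass (Suc j)))"
    using sums_unique[OF lower] by simp
  also have "\<dots> \<le> (\<Sum>j. \<integral>x. transition g x \<partial>occ j)"
    by (rule suminf_le[OF occ_step[OF g(1) B gU] sums_summable[OF lower]
          summable_integral_occ(2)[OF transition_measurable[OF g(1)] tB]])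
  finally have "suminf ?g / total \<le> (\<Sum>j. \<integral>x. transition g x \<partial>occ j) / total"
    using total_pos by (simp add: divide_right_mono)
  also have "(\<Sum>j. \<integral>x. transition g x \<partial>occ j) / total = (\<integral>x. transition g x \<partial>stat)"
    by (rule integral_stat[symmetric, OF transition_measurable[OF g(1)] transition_range[OF g]])
  also have "\<dots> = (\<integral>x. g x \<partial>(stat \<bind> P))"
    using borel_prob_stat
    by (intro integral_bind_kernel[symmetric, OF _ _ g(1) B]) (auto simp: borel_prob_def prob_space.finite_measure)
  finally show ?thesis by (simp add: integral_stat[OF g])
qed

end

end

context monotone_kernel
begin

text \<open>The resolvent \<open>h\<close> of \<open>g\<close> is increasing, so \<open>discounted_occupation\<close> applies to \<open>h\<close> at \<open>x0\<close> and to
\<open>1 / (1 - s) - h\<close>, the resolvent of \<open>1 - g\<close>, at \<open>y0\<close>.  The two bounds are linked by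
\<open>h x0 \<le> h y0\<close>, and \<open>s\<close> tends to \<open>1\<close>.\<close>

lemma stat_ordered:
  fixes x0 y0 :: 'a
  assumes order: "closed_order TYPE('a)" and le: "x0 \<le> y0"
    and sL: "summable (excursion.mass P x0 {x. x0 \<le> x})"
    and sR: "summable (excursion.mass P y0 {y. y \<le> y0})"
  shows "stoch_le (excursion.stat P x0 {x. x0 \<le> x}) (excursion.stat P y0 {y. y \<le> y0})"
  unfolding stoch_le_def
proof (intro ballI impI)
  interpret L: excursion P x0 "{x. x0 \<le> x}"
    by (intro excursion.intro excursion_axioms.intro borel_kernel_axioms borel_closed closed_Ici order)
  interpret R: excursion P y0 "{y. y \<le> y0}"
    by (intro excursion.intro excursion_axioms.intro borel_kernel_axioms borel_closed closed_Iic order)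
  fix g :: "'a \<Rightarrow> real"
  assume g: "g \<in> borel_measurable borel" "range g \<subseteq> {0..1}" "mono g"
  have g01: "0 \<le> g x" "g x \<le> 1" for x using g(2) by (auto simp: subset_iff)
  have B: "\<bar>g x\<bar> \<le> 1" "\<bar>1 - g x\<bar> \<le> 1" for x using g01[of x] by auto
  let ?gL = "\<lambda>j. \<integral>x. g x \<partial>L.occ j" and ?gR = "\<lambda>j. \<integral>x. g x \<partial>R.occ j"
  have discounted: "(\<Sum>j. s ^ j * ?gL j) * (\<Sum>j. s ^ j * R.mass j) \<le> (\<Sum>j. s ^ j * ?gR j) * (\<Sum>j. s ^ j * L.mass j)"
    if s: "0 < s" "s < 1" for s :: real
  proof -
    define h where "h = resolvent s g"
    have h: "h \<in> borel_measurable borel" "\<And>x. 0 \<le> h x" "\<And>x. h x \<le> 1 / (1 - s)" "mono h"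
      "\<And>x. h x = g x + s * transition h x"
      unfolding h_def
      using resolvent_measurable[OF s g(1,2)] resolvent_bounds[OF s g(1,2)] resolvent_mono[OF s g]
        resolvent_equation[OF s g(1,2)] by auto
    have hB: "\<bar>h x\<bar> \<le> 1 / (1 - s)" "\<bar>1 / (1 - s) - h x\<bar> \<le> 1 / (1 - s)" for x
      using h(2,3)[of x] by auto
    have left: "(\<Sum>j. s ^ j * ?gL j) \<le> (1 - s) * h x0 * (\<Sum>j. s ^ j * L.mass j)"
      by (rule L.discounted_occupation[OF s g(1) B(1) h(1) hB(1) _ h(5) sL]) (use h(4) in \<open>auto simp: mono_def\<close>)
    have eq': "1 / (1 - s) - h x = (1 - g x) + s * transition (\<lambda>y. 1 / (1 - s) - h y) x" for x
    proof -
      interpret prob_space "P x" using borel_prob_kernel[of x] by (simp add: borel_prob_def)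
      have "transition (\<lambda>y. 1 / (1 - s) - h y) x = 1 / (1 - s) - transition h x"
        unfolding transition_def using borel_prob_integrable[OF borel_prob_kernel h(1) hB(1), of x]
        by (simp add: prob_space)
      then have "s * transition (\<lambda>y. 1 / (1 - s) - h y) x = s * (1 / (1 - s)) - s * transition h x"
        by (simp only: right_diff_distrib)
      moreover have "1 / (1 - s) = 1 + s * (1 / (1 - s))" using s by (simp add: field_simps)
      ultimately show ?thesis using h(5)[of x] by linarith
    qed
    have right: "(\<Sum>j. s ^ j * (\<integral>x. 1 - g x \<partial>R.occ j))
        \<le> (1 - s) * (1 / (1 - s) - h y0) * (\<Sum>j. s ^ j * R.mass j)"
      by (rule R.discounted_occupation[OF s _ B(2) _ hB(2) _ eq' sR])
        (use g(1) h(1,4) in \<open>auto simp: mono_def\<close>)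
    have mR: "summable (\<lambda>j. s ^ j * R.mass j)"
      by (rule summable_comparison_test'[OF sR, of 0])
        (use s R.mass_nonneg in \<open>auto simp: mult_left_le_one_le power_le_one\<close>)
    have mL: "summable (\<lambda>j. s ^ j * L.mass j)"
      by (rule summable_comparison_test'[OF sL, of 0])
        (use s L.mass_nonneg in \<open>auto simp: mult_left_le_one_le power_le_one\<close>)
    have gR: "summable (\<lambda>j. s ^ j * ?gR j)"
    proof (rule summable_comparison_test'[OF sR, of 0])
      fix j
      have "\<bar>?gR j\<bar> \<le> R.mass j" using R.integral_occ_abs_le[OF g(1) B(1), of j] by simp
      then show "norm (s ^ j * ?gR j) \<le> R.mass j"
        using s mult_mono[of "s ^ j" 1 "\<bar>?gR j\<bar>" "R.mass j"] by (simp add: abs_mult power_le_one R.mass_nonneg)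
    qed
    have "(\<integral>x. 1 - g x \<partial>R.occ j) = R.mass j - ?gR j" for j
      unfolding R.mass_eq_integral
      using R.occ_integrable[of "\<lambda>_. 1" 1 j] R.occ_integrable[OF g(1) B(1), of j] by simp
    then have "(\<Sum>j. s ^ j * (\<integral>x. 1 - g x \<partial>R.occ j)) = (\<Sum>j. s ^ j * R.mass j) - (\<Sum>j. s ^ j * ?gR j)"
      using suminf_diff[OF mR gR] by (simp add: right_diff_distrib)
    moreover have "(1 - s) * (1 / (1 - s) - h y0) = 1 - (1 - s) * h y0"
      using s by (simp add: right_diff_distrib)
    ultimately have "(\<Sum>j. s ^ j * R.mass j) - (\<Sum>j. s ^ j * ?gR j) \<le> (1 - (1 - s) * h y0) * (\<Sum>j. s ^ j * R.mass j)"
      using right by (simp only:)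
    also have "\<dots> = (\<Sum>j. s ^ j * R.mass j) - (1 - s) * h y0 * (\<Sum>j. s ^ j * R.mass j)"
      by (simp only: left_diff_distrib mult_1_left)
    finally have right': "(1 - s) * h y0 * (\<Sum>j. s ^ j * R.mass j) \<le> (\<Sum>j. s ^ j * ?gR j)" by linarith
    have mR0: "0 \<le> (\<Sum>j. s ^ j * R.mass j)" and mL0: "0 \<le> (\<Sum>j. s ^ j * L.mass j)"
      using s by (auto intro!: suminf_nonneg mR mL simp: R.mass_nonneg L.mass_nonneg)
    have "(\<Sum>j. s ^ j * ?gL j) * (\<Sum>j. s ^ j * R.mass j)
        \<le> ((1 - s) * h x0 * (\<Sum>j. s ^ j * L.mass j)) * (\<Sum>j. s ^ j * R.mass j)"
      by (rule mult_right_mono[OF left mR0])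
    also have "\<dots> \<le> ((1 - s) * h y0 * (\<Sum>j. s ^ j * L.mass j)) * (\<Sum>j. s ^ j * R.mass j)"
      using s h(4) le mL0 mR0 by (intro mult_right_mono mult_left_mono) (auto simp: mono_def)
    also have "\<dots> = ((1 - s) * h y0 * (\<Sum>j. s ^ j * R.mass j)) * (\<Sum>j. s ^ j * L.mass j)" by simp
    also have "\<dots> \<le> (\<Sum>j. s ^ j * ?gR j) * (\<Sum>j. s ^ j * L.mass j)"
      by (rule mult_right_mono[OF right' mL0])
    finally show ?thesis .
  qed
  have "suminf ?gL * R.total \<le> suminf ?gR * L.total"
  proof (rule LIMSEQ_le)
    let ?s = "\<lambda>m. 1 - 1 / (real m + 2)"
    show "(\<lambda>m. (\<Sum>j. ?s m ^ j * ?gL j) * (\<Sum>j. ?s m ^ j * R.mass j)) \<longlonglongrightarrow> suminf ?gL * R.total"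
      unfolding R.total_def using sR R.mass_nonneg
      by (intro tendsto_mult abel_limit L.summable_integral_occ(1)[OF sL g(1) B(1)]) auto
    show "(\<lambda>m. (\<Sum>j. ?s m ^ j * ?gR j) * (\<Sum>j. ?s m ^ j * L.mass j)) \<longlonglongrightarrow> suminf ?gR * L.total"
      unfolding L.total_def using sL L.mass_nonneg
      by (intro tendsto_mult abel_limit R.summable_integral_occ(1)[OF sR g(1) B(1)]) auto
    show "\<exists>N. \<forall>m\<ge>N. (\<Sum>j. ?s m ^ j * ?gL j) * (\<Sum>j. ?s m ^ j * R.mass j)
        \<le> (\<Sum>j. ?s m ^ j * ?gR j) * (\<Sum>j. ?s m ^ j * L.mass j)"
      by (intro exI[of _ 0] allI impI discounted) (auto simp: field_simps)
  qed
  then have "suminf ?gL / L.total \<le> suminf ?gR / R.total"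
    using L.total_pos[OF sL] R.total_pos[OF sR] by (simp add: field_simps)
  then show "(\<integral>x. g x \<partial>L.stat) \<le> (\<integral>x. g x \<partial>R.stat)"
    by (simp add: L.integral_stat[OF sL g(1,2)] R.integral_stat[OF sR g(1,2)])
qed

theorem stationary_if_summable:
  fixes x0 y0 :: 'a
  assumes order: "closed_order TYPE('a)" and bmc: "bounded_monotone_convergence TYPE('a)"
    and le: "x0 \<le> y0"
    and sL: "summable (excursion.mass P x0 {x. x0 \<le> x})"
    and sR: "summable (excursion.mass P y0 {y. y \<le> y0})"
  shows "\<exists>\<pi>. stationary_distribution P \<pi>"
proof -
  interpret L: excursion P x0 "{x. x0 \<le> x}"
    by (intro excursion.intro excursion_axioms.intro borel_kernel_axioms borel_closed closed_Ici order)
  interpret R: excursion P y0 "{y. y \<le> y0}"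
    by (intro excursion.intro excursion_axioms.intro borel_kernel_axioms borel_closed closed_Iic order)
  note L = L.borel_prob_stat[OF sL] and R = R.borel_prob_stat[OF sR]
  show ?thesis
  proof (rule stationary_between[OF order bmc L _ R _ stat_ordered[OF order le sL sR]])
    show "stoch_le L.stat (L.stat \<bind> P)"
      unfolding stoch_le_def by (auto intro!: L.stat_le_transition[OF sL] simp: mono_def)
    show "stoch_le (R.stat \<bind> P) R.stat"
      unfolding stoch_le_def
    proof (intro ballI impI)
      fix g :: "'a \<Rightarrow> real"
      assume g: "g \<in> borel_measurable borel" "range g \<subseteq> {0..1}" "mono g"
      have B: "\<bar>g x\<bar> \<le> 1" for x using g(2) by (auto simp: subset_iff abs_le_iff intro: order_trans[of _ 0])
      have compl: "(\<integral>x. 1 - g x \<partial>\<mu>) = 1 - (\<integral>x. g x \<partial>\<mu>)" if \<mu>: "borel_prob \<mu>" for \<mu>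
      proof -
        interpret prob_space \<mu> using \<mu> by (simp add: borel_prob_def)
        show ?thesis using borel_prob_integrable[OF \<mu> g(1) B] by (simp add: prob_space)
      qed
      have "(\<integral>x. 1 - g x \<partial>R.stat) \<le> (\<integral>x. 1 - g x \<partial>(R.stat \<bind> P))"
        by (rule R.stat_le_transition[OF sR]) (use g in \<open>auto simp: mono_def subset_iff\<close>)
      then show "(\<integral>x. g x \<partial>(R.stat \<bind> P)) \<le> (\<integral>x. g x \<partial>R.stat)"
        using compl[OF R] compl[OF borel_prob_bind[OF R]] by simp
    qed
  qed
qed

end

section \<open>Return times of a Markov chain\<close>

context excursion
begin

context
  fixes M :: "'b measure" and X :: "nat \<Rightarrow> 'b \<Rightarrow> 'a"
  assumes chain: "markov_chain_from P a M X"
begin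

definition avoid :: "nat \<Rightarrow> 'b set" where
  "avoid j = {\<omega>\<in>space M. \<forall>i. 1 \<le> i \<and> i \<le> j \<longrightarrow> X i \<omega> \<notin> U}"

lemma prob_space_chain: "prob_space M"
  using chain by (simp add: markov_chain_from_def)

lemma X_measurable[measurable]: "X n \<in> borel_measurable M"
  using chain by (simp add: markov_chain_from_def)

lemma space_history: "space (history_algebra M X n) = space M"
  by (simp add: history_algebra_def space_measure_of_conv)

lemma sets_history:
  "sets (history_algebra M X n) = sigma_sets (space M) {X k -` A \<inter> space M | k A. k \<le> n \<and> A \<in> sets borel}"
  unfolding history_algebra_def by (rule sets_measure_of) auto

lemma subalgebra_history: "subalgebra M (history_algebra M X n)"
  unfolding subalgebra_def sets_history space_history
  by (auto intro!: sets.sigma_sets_subset)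

lemma avoid_history: "avoid j \<in> sets (history_algebra M X j)"
proof -
  have "X i -` U \<inter> space M \<in> sets (history_algebra M X j)" if "i \<le> j" for i
    unfolding sets_history using that U by (intro sigma_sets.Basic) blast
  then have "space (history_algebra M X j) - (\<Union>i\<in>{1..j}. X i -` U \<inter> space M) \<in> sets (history_algebra M X j)"
    by (intro sets.Diff sets.top sets.finite_UN) auto
  moreover have "space (history_algebra M X j) - (\<Union>i\<in>{1..j}. X i -` U \<inter> space M) = avoid j"
    by (auto simp: avoid_def space_history)
  ultimately show ?thesis by simp
qed

lemma avoid_sets[measurable]: "avoid j \<in> sets M"
  using avoid_history subalgebra_history unfolding subalgebra_def by blast

lemma markov_property:
  assumes A[measurable]: "A \<in> sets borel"
  shows "emeasure M (avoid j \<inter> {\<omega>\<in>space M. X (Suc j) \<omega> \<in> A}) =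
    (\<integral>\<^sup>+\<omega>. indicator (avoid j) \<omega> * emeasure (P (X j \<omega>)) A \<partial>M)"
proof -
  interpret prob_space M by (rule prob_space_chain)
  interpret finite_measure_subalgebra M "history_algebra M X j"
    by unfold_locales (rule subalgebra_history)
  have meas: "(\<lambda>\<omega>. measure (P (X j \<omega>)) A) \<in> borel_measurable M"
    by (rule measurable_compose[OF X_measurable measurable_compose[OF kernel_subprob_algebra
            measurable_measure_subprob_algebra[OF A]]])
  have le1: "measure (P x) A \<le> 1" for x
    using borel_prob_kernel[of x] by (simp add: borel_prob_def prob_space.prob_le_1)
  have "measure M (avoid j \<inter> {\<omega>\<in>space M. X (Suc j) \<omega> \<in> A}) = (\<integral>\<omega>\<in>avoid j. indicator A (X (Suc j) \<omega>) \<partial>M)"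
  proof -
    have "measure M (avoid j \<inter> {\<omega>\<in>space M. X (Suc j) \<omega> \<in> A}) =
        (\<integral>\<omega>. indicator (avoid j \<inter> {\<omega>\<in>space M. X (Suc j) \<omega> \<in> A}) \<omega> \<partial>M)"
      by (simp add: Int_absorb2 avoid_def subset_iff)
    also have "\<dots> = (\<integral>\<omega>\<in>avoid j. indicator A (X (Suc j) \<omega>) \<partial>M)"
      unfolding set_lebesgue_integral_def by (intro Bochner_Integration.integral_cong) (auto simp: indicator_def)
    finally show ?thesis .
  qed
  also have "\<dots> = (\<integral>\<omega>\<in>avoid j. real_cond_exp M (history_algebra M X j) (\<lambda>\<omega>. indicator A (X (Suc j) \<omega>)) \<omega> \<partial>M)"
    by (rule real_cond_exp_intA[OF _ avoid_history])
      (rule integrable_const_bound[where B=1]; auto simp: indicator_def)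
  also have "\<dots> = (\<integral>\<omega>\<in>avoid j. measure (P (X j \<omega>)) A \<partial>M)"
    unfolding set_lebesgue_integral_def
  proof (rule integral_cong_AE)
    have "AE \<omega> in M. real_cond_exp M (history_algebra M X j) (\<lambda>\<omega>. indicator A (X (Suc j) \<omega>)) \<omega> = measure (P (X j \<omega>)) A"
      using chain A unfolding markov_chain_from_def by blast
    then show "AE \<omega> in M. indicator (avoid j) \<omega> *\<^sub>R real_cond_exp M (history_algebra M X j) (\<lambda>\<omega>. indicator A (X (Suc j) \<omega>)) \<omega>
        = indicator (avoid j) \<omega> *\<^sub>R measure (P (X j \<omega>)) A" by eventually_elim simp
  qed (use meas in measurable)
  finally have eq: "measure M (avoid j \<inter> {\<omega>\<in>space M. X (Suc j) \<omega> \<in> A}) = (\<integral>\<omega>. indicator (avoid j) \<omega> * measure (P (X j \<omega>)) A \<partial>M)"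
    by (simp add: set_lebesgue_integral_def)
  have "(\<integral>\<^sup>+\<omega>. indicator (avoid j) \<omega> * emeasure (P (X j \<omega>)) A \<partial>M) =
      (\<integral>\<^sup>+\<omega>. ennreal (indicator (avoid j) \<omega> * measure (P (X j \<omega>)) A) \<partial>M)"
    using borel_prob_kernel
    by (intro nn_integral_cong)
      (auto simp: indicator_def borel_prob_def finite_measure.emeasure_eq_measure prob_space.finite_measure)
  also have "\<dots> = ennreal (\<integral>\<omega>. indicator (avoid j) \<omega> * measure (P (X j \<omega>)) A \<partial>M)"
    using meas le1 by (intro nn_integral_eq_integral integrable_const_bound[where B=1])
      (auto simp: indicator_def)
  finally show ?thesis by (simp add: emeasure_eq_measure eq)
qed

text \<open>This identifies the abstract recursion with the given chain: the event \<open>avoid j\<close> belongs to the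
history up to time \<open>j\<close>, so the Markov property advances it by one step.\<close>

lemma occ_eq_law: "occ j = distr (density M (indicator (avoid j))) borel (X j)"
proof (induction j)
  case 0
  interpret prob_space M by (rule prob_space_chain)
  show ?case
  proof (rule measure_eqI)
    fix A assume "A \<in> sets (occ 0)"
    then have A[measurable]: "A \<in> sets borel" by simp
    have "emeasure (distr (density M (indicator (avoid 0))) borel (X 0)) A = emeasure M {\<omega>\<in>space M. X 0 \<omega> \<in> A}"
      by (subst emeasure_distr, simp, simp, subst emeasure_density)
        (auto simp: avoid_def indicator_def nn_integral_indicator[symmetric] simp del: nn_integral_indicator intro!: nn_integral_cong)
    also have "\<dots> = indicator A a"
    proof -
      have AE: "AE \<omega> in M. X 0 \<omega> = a" using chain by (simp add: markov_chain_from_def)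
      have "emeasure M {\<omega>\<in>space M. X 0 \<omega> \<in> A} = emeasure M {\<omega>\<in>space M. a \<in> A}"
        using AE by (intro emeasure_eq_AE) auto
      then show ?thesis by (auto simp: indicator_def emeasure_space_1)
    qed
    finally show "emeasure (occ 0) A = emeasure (distr (density M (indicator (avoid 0))) borel (X 0)) A" by simp
  qed simp
next
  case (Suc j)
  show ?case
  proof (rule measure_eqI)
    fix A assume "A \<in> sets (occ (Suc j))"
    then have A[measurable]: "A \<in> sets borel" by (simp only: sets_occ)
    have P: "P \<in> occ j \<rightarrow>\<^sub>M subprob_algebra borel" by measurable
    have [measurable_cong]: "sets (occ j \<bind> P) = sets borel"
      by (intro sets_bind[OF sets_kernel[OF P]]) auto
    have "emeasure (occ (Suc j)) A = (\<integral>\<^sup>+x. ennreal (indicator (- U) x) * indicator A x \<partial>(occ j \<bind> P))"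
      by (simp add: emeasure_density)
    also have "\<dots> = (\<integral>\<^sup>+x. indicator (A - U) x \<partial>(occ j \<bind> P))"
      by (intro nn_integral_cong) (auto simp: indicator_def)
    also have "\<dots> = emeasure (occ j \<bind> P) (A - U)" by (intro nn_integral_indicator) auto
    also have "\<dots> = (\<integral>\<^sup>+x. emeasure (P x) (A - U) \<partial>occ j)"
      by (rule emeasure_bind[OF _ P]) auto
    also have "\<dots> = (\<integral>\<^sup>+\<omega>. indicator (avoid j) \<omega> * emeasure (P (X j \<omega>)) (A - U) \<partial>M)"
    proof -
      have "(\<lambda>x. emeasure (P x) (A - U)) \<in> borel_measurable borel"
        by (rule measurable_compose[OF kernel_subprob_algebra measurable_emeasure_subprob_algebra]) auto
      then show ?thesis unfolding Suc.IH by (subst nn_integral_distr) (auto simp: nn_integral_density)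
    qed
    also have "\<dots> = emeasure M (avoid j \<inter> {\<omega>\<in>space M. X (Suc j) \<omega> \<in> A - U})"
      by (rule markov_property[symmetric]) auto
    also have "avoid j \<inter> {\<omega>\<in>space M. X (Suc j) \<omega> \<in> A - U} = avoid (Suc j) \<inter> {\<omega>\<in>space M. X (Suc j) \<omega> \<in> A}"
      by (auto simp: avoid_def le_Suc_eq)
    also have "emeasure M \<dots> = emeasure (distr (density M (indicator (avoid (Suc j)))) borel (X (Suc j))) A"
      by (subst emeasure_distr, simp, simp, subst emeasure_density)
        (auto simp: indicator_def nn_integral_indicator[symmetric] simp del: nn_integral_indicator intro!: nn_integral_cong)
    finally show "emeasure (occ (Suc j)) A = emeasure (distr (density M (indicator (avoid (Suc j)))) borel (X (Suc j))) A" .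
  qed (simp only: sets_occ sets_distr)
qed

lemma mass_eq_avoid: "ennreal (mass j) = emeasure M (avoid j)"
proof -
  have "ennreal (mass j) = emeasure (occ j) UNIV"
    using finite_occ[of j] by (simp add: mass_def finite_measure.emeasure_eq_measure)
  also have "\<dots> = emeasure M (avoid j)"
    unfolding occ_eq_law using sets.sets_into_space[OF avoid_sets, of j]
    by (subst emeasure_distr, simp, simp, subst emeasure_density)
      (auto simp: indicator_def nn_integral_indicator[symmetric] simp del: nn_integral_indicator intro!: nn_integral_cong)
  finally show ?thesis .
qed

lemma avoid_le_hitting_time:
  "(\<Sum>j. indicator (avoid j) \<omega>) \<le> ennreal_of_enat (hitting_time X U \<omega>)"
proof (cases "\<exists>n. 1 \<le> n \<and> X n \<omega> \<in> U")
  case False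
  then have "{n. 1 \<le> n \<and> X n \<omega> \<in> U} = {}" by auto
  then show ?thesis by (simp add: hitting_time_def Inf_enat_def top_enat_def)
next
  case True
  define n where "n = (LEAST n. 1 \<le> n \<and> X n \<omega> \<in> U)"
  have n: "1 \<le> n" "X n \<omega> \<in> U" using LeastI_ex[OF True] by (auto simp: n_def)
  have "enat n \<le> hitting_time X U \<omega>"
    unfolding hitting_time_def by (intro Inf_greatest) (auto simp: n_def intro: Least_le)
  then have le: "ennreal_of_enat (enat n) \<le> ennreal_of_enat (hitting_time X U \<omega>)"
    by (simp only: ennreal_of_enat_le_iff)
  have "(\<Sum>j. indicator (avoid j) \<omega>) = (\<Sum>j<n. indicator (avoid j) \<omega> :: ennreal)"
    using n by (intro suminf_finite) (auto simp: avoid_def indicator_def)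
  also have "\<dots> \<le> (\<Sum>j<n. 1)" by (intro sum_mono) (simp add: indicator_def)
  also have "\<dots> = ennreal_of_enat (enat n)" by simp
  finally show ?thesis using le by (rule order_trans)
qed

text \<open>\<open>mass j\<close> is the probability of a return after time \<open>j\<close>; these add up to the mean return time.\<close>

lemma mass_summable:
  assumes "(\<integral>\<^sup>+\<omega>. ennreal_of_enat (hitting_time X U \<omega>) \<partial>M) < \<infinity>"
  shows "summable mass"
proof (rule summable_suminf_not_top)
  have "(\<Sum>j. ennreal (mass j)) = (\<Sum>j. \<integral>\<^sup>+\<omega>. indicator (avoid j) \<omega> \<partial>M)"
    by (simp add: mass_eq_avoid)
  also have "\<dots> = (\<integral>\<^sup>+\<omega>. (\<Sum>j. indicator (avoid j) \<omega>) \<partial>M)"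
    by (rule nn_integral_suminf[symmetric]) measurable
  also have "\<dots> \<le> (\<integral>\<^sup>+\<omega>. ennreal_of_enat (hitting_time X U \<omega>) \<partial>M)"
    by (intro nn_integral_mono avoid_le_hitting_time)
  finally show "(\<Sum>j. ennreal (mass j)) \<noteq> top" using assms by (auto simp: top_unique)
qed (rule mass_nonneg)

end

end

section \<open>Existence of a stationary distribution\<close>

theorem proposition4p1:
  fixes P :: "'a::{polish_space, order} \<Rightarrow> 'a measure"
    and x\<^sub>0 y\<^sub>0 :: 'a
    and M :: "'b measure" and X :: "nat \<Rightarrow> 'b \<Rightarrow> 'a"
    and N :: "'c measure" and Y :: "nat \<Rightarrow> 'c \<Rightarrow> 'a"
  assumes "closed_order TYPE('a)"
    and "bounded_monotone_convergence TYPE('a)"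
    and "markov_kernel P"
    and "stochastically_monotone P"
    and "x\<^sub>0 \<le> y\<^sub>0"
    and "markov_chain_from P x\<^sub>0 M X"
    and "markov_chain_from P y\<^sub>0 N Y"
    and "(\<integral>\<^sup>+\<omega>. ennreal_of_enat (hitting_time X {x. x\<^sub>0 \<le> x} \<omega>) \<partial>M) < \<infinity>"
    and "(\<integral>\<^sup>+\<omega>. ennreal_of_enat (hitting_time Y {y. y \<le> y\<^sub>0} \<omega>) \<partial>N) < \<infinity>"
  shows "\<exists>\<pi>. stationary_distribution P \<pi>"
proof -
  interpret monotone_kernel P
    by (intro monotone_kernel.intro borel_kernel.intro monotone_kernel_axioms.intro assms(3,4))
  interpret L: excursion P "x\<^sub>0" "{x. x\<^sub>0 \<le> x}"
    by (intro excursion.intro excursion_axioms.intro borel_kernel_axioms borel_closed closed_Ici assms(1))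
  interpret R: excursion P "y\<^sub>0" "{y. y \<le> y\<^sub>0}"
    by (intro excursion.intro excursion_axioms.intro borel_kernel_axioms borel_closed closed_Iic assms(1))
  show ?thesis
    by (rule stationary_if_summable[OF assms(1,2,5) L.mass_summable[OF assms(6,8)] R.mass_summable[OF assms(7,9)]])
qed

end
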